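(* Let $A:\mathbb{R}\to\mathbb{R}$ be a function of locally bounded variation, vanishing on $(-\infty,1)$, such that the Mellin transform $\mathcal{A}(s):=\int_1^\infty x^{-s}\,dA(x)$ is convergent for $\Re s>1$. Let $n$ and $m_k$ ($0\le k\le n$) be positive integers, let $c_{k,l}$ be complex numbers and let $\omega_{k,l}$, $b_k$ ($0\le k\le n$, $1\le l\le m_k$) be real numbers with $b_0=0$, $b_k>0$ for $k\ge1$, and $\omega_{k,l}>-1$. For $\Re s>0$ define $$G(s)=\frac{1}{s+1}\mathcal{A}(s+1)-\sum_{k=0}^{n}\sum_{l=1}^{m_k}\left(\frac{c_{k,l}}{(s+ib_k)^{\omega_{k,l}+1}}+\frac{\overline{c_{k,l}}}{(s-ib_k)^{\omega_{k,l}+1}}\right),$$ and for $T>0$, $\sigma>0$ define $$\eta(\sigma,T)=\int_{-T}^{T}|G(2\sigma+i\tau)-G(\sigma+i\tau)|\,d\tau .$$ Assume that $A$ is moderately decreasing on $[0,\infty)$, with constants $B_1,B_2$ and function $\varphi$. Put $\omega:=\min_{k,l}\omega_{k,l}$ and $\Omega:=\max_{k,l}\omega_{k,l}$. Then for every $T>0$ and every $x\ge x_0(T):=\max(e^{16/15},e^{32/T})$ we have $$\left|A(x)-x\sum_{k=0}^{n}\sum_{l=1}^{m_k}\frac{(\log x)^{\omega_{k,l}}}{\Gamma(\omega_{k,l}+1)}\,2\Re\left(c_{k,l}e^{-ib_k\log x}\right)\right|\ll x\,\rho_T(x),$$ where the implicit constant depends only on $B_1$, $B_2$, the $c_{k,l}$,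 $\Omega$, the $b_k$ and $\sup_{[1,e]}A_-$, and where $$\rho_T(x)=\sqrt{\varphi(\sqrt{x})}+\max_{\kappa\in\{1/2,1\}}\left\{\left(\frac{e^{10/T}}{T}+1\right)\eta\left(\frac{1}{\log x},T\right)+\frac{e^{10/T}}{T}\log^{\Omega_+}x+\frac{1}{\log x}\left(\frac{1}{T^{\Omega+1}}+\frac{1}{T^{\omega+1}}\right)\right\}^{\kappa}.$$
   Context: Notation: $r_+=\max(r,0)$ and $A_-=\max(-A,0)$. Powers $z^{\omega+1}$ with $\Re z>0$ are taken with the principal branch. The Stieltjes integral $\int_1^\infty x^{-s}\,dA(x)$ includes the possible jump of $A$ at $1$, so that $\mathcal{A}(s)=s\int_1^\infty A(x)x^{-s-1}\,dx$ for $\Re s>1$. For $a\ge0$, a real function $F$ on $[a,\infty)$ is moderately decreasing (with constants $B_1,B_2$ and function $\varphi$) if there exist positive constants $B_1,B_2$ such that for all $v\ge0$ and $u\ge a$, $F(u+v)-F(u)\ge -B_1v-B_2\max(1,u)\varphi(u)$, where $\varphi$ is a nonincreasing function on $[a,\infty)$ with $\varphi(x)=1$ for $x\in[a,\max(1,a)]$ and $\lim_{u\to\infty}\varphi(u)=0$. *)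

theory Defs
  imports "HOL-Analysis.Analysis"
begin

definition bounded_variation_on :: "(real \<Rightarrow> real) \<Rightarrow> real \<Rightarrow> real \<Rightarrow> bool" where
  "bounded_variation_on f a b \<longleftrightarrow>
     (\<exists>V. \<forall>D. D division_of {a..b} \<longrightarrow> (\<Sum>K\<in>D. \<bar>f (Sup K) - f (Inf K)\<bar>) \<le> V)"

definition locally_bounded_variation :: "(real \<Rightarrow> real) \<Rightarrow> bool" where
  "locally_bounded_variation f \<longleftrightarrow> (\<forall>a b. bounded_variation_on f a b)"

text \<open>Riemann--Stieltjes integral of \<open>f\<close> with respect to \<open>g\<close> over \<open>[a, b]\<close>, as the limit of
  Riemann--Stieltjes sums when the mesh tends to zero. The gauge is a ball of constant radius, so
  this is not the Henstock--Kurzweil variant. A jump of \<open>g\<close> at \<open>a\<close> counts only with its right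
  part \<open>g(a+) - g(a)\<close>.\<close>

definition has_stieltjes_integral ::
    "(real \<Rightarrow> complex) \<Rightarrow> (real \<Rightarrow> real) \<Rightarrow> complex \<Rightarrow> real \<Rightarrow> real \<Rightarrow> bool" where
  "has_stieltjes_integral f g I a b \<longleftrightarrow>
     (\<forall>e>0. \<exists>d>0. \<forall>p. p tagged_division_of {a..b} \<and> (\<lambda>x. ball x d) fine p \<longrightarrow>
        norm ((\<Sum>(x, K)\<in>p. f x * of_real (g (Sup K) - g (Inf K))) - I) < e)"

text \<open>The improper integral of \<open>x\<^sup>-\<^sup>s dA(x)\<close> over \<open>[1, \<infinity>)\<close>, for \<open>A\<close> vanishing on \<open>(-\<infinity>, 1)\<close>.
  The integral includes the full jump of \<open>A\<close> at \<open>1\<close>; its left part \<open>A(1) - A(1-) = A(1)\<close> is not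
  seen by the integral over \<open>[1, X]\<close> and is added separately, with weight \<open>1\<^sup>-\<^sup>s = 1\<close>.\<close>

definition has_mellin_stieltjes :: "(real \<Rightarrow> real) \<Rightarrow> complex \<Rightarrow> complex \<Rightarrow> bool" where
  "has_mellin_stieltjes A s L \<longleftrightarrow>
     (\<exists>J. (\<forall>X\<ge>1. has_stieltjes_integral (\<lambda>x. of_real x powr (- s)) A (J X) 1 X) \<and>
          ((\<lambda>X. of_real (A 1) + J X) \<longlongrightarrow> L) at_top)"

definition mellin_stieltjes_converges :: "(real \<Rightarrow> real) \<Rightarrow> complex \<Rightarrow> bool" where
  "mellin_stieltjes_converges A s \<longleftrightarrow> (\<exists>L. has_mellin_stieltjes A s L)"

definition mellin_stieltjes :: "(real \<Rightarrow> real) \<Rightarrow> complex \<Rightarrow> complex" where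
  "mellin_stieltjes A s = (THE L. has_mellin_stieltjes A s L)"

lemma has_stieltjes_integral_unique:
  assumes "has_stieltjes_integral f g I a b" "has_stieltjes_integral f g J a b"
  shows "I = J"
proof (rule ccontr)
  define e where "e = norm (I - J) / 2"
  assume "I \<noteq> J"
  then have e: "e > 0" by (simp add: e_def)
  let ?S = "\<lambda>p. \<Sum>(x, K)\<in>p. f x * of_real (g (Sup K) - g (Inf K))"
  obtain d1 where d1: "d1 > 0" "\<And>p. p tagged_division_of {a..b} \<Longrightarrow> (\<lambda>x. ball x d1) fine p
      \<Longrightarrow> norm (?S p - I) < e"
    using assms(1)[unfolded has_stieltjes_integral_def, rule_format, OF e] by auto
  obtain d2 where d2: "d2 > 0" "\<And>p. p tagged_division_of {a..b} \<Longrightarrow> (\<lambda>x. ball x d2) fine p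
      \<Longrightarrow> norm (?S p - J) < e"
    using assms(2)[unfolded has_stieltjes_integral_def, rule_format, OF e] by auto
  obtain p where p: "p tagged_division_of {a..b}" "(\<lambda>x. ball x d1 \<inter> ball x d2) fine p"
    using fine_division_exists[OF gauge_Int[OF gauge_ball[OF d1(1)] gauge_ball[OF d2(1)]], of a b]
    unfolding box_real by blast
  have "norm (?S p - I) < e" "norm (?S p - J) < e"
    using d1(2)[OF p(1)] d2(2)[OF p(1)] p(2) unfolding fine_Int by blast+
  moreover have "norm (I - J) \<le> norm (?S p - I) + norm (?S p - J)"
    using norm_triangle_ineq4[of "?S p - J" "?S p - I"] by simp
  ultimately show False by (simp add: e_def)
qed

lemma has_mellin_stieltjes_unique:
  assumes "has_mellin_stieltjes A s L" "has_mellin_stieltjes A s L'"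
  shows "L = L'"
proof -
  obtain J J' where J: "\<forall>X\<ge>1. has_stieltjes_integral (\<lambda>x. of_real x powr (- s)) A (J X) 1 X"
      "((\<lambda>X. of_real (A 1) + J X) \<longlongrightarrow> L) at_top"
    and J': "\<forall>X\<ge>1. has_stieltjes_integral (\<lambda>x. of_real x powr (- s)) A (J' X) 1 X"
      "((\<lambda>X. of_real (A 1) + J' X) \<longlongrightarrow> L') at_top"
    using assms unfolding has_mellin_stieltjes_def by blast
  have "\<forall>\<^sub>F X in at_top. of_real (A 1) + J X = of_real (A 1) + J' X"
    using eventually_ge_at_top[of 1]
  proof eventually_elim
    case (elim X)
    then have "J X = J' X"
      by (intro has_stieltjes_integral_unique[OF J(1)[rule_format] J'(1)[rule_format]])
    then show ?case by simp
  qed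
  then have "((\<lambda>X. of_real (A 1) + J' X) \<longlongrightarrow> L) at_top"
    by (rule Lim_transform_eventually[OF J(2)])
  then show ?thesis
    using tendsto_unique[OF trivial_limit_at_top_linorder _ J'(2)] by simp
qed

lemma mellin_stieltjes_eqI: "has_mellin_stieltjes A s L \<Longrightarrow> mellin_stieltjes A s = L"
  unfolding mellin_stieltjes_def by (rule the_equality) (auto intro: has_mellin_stieltjes_unique)

definition moderately_decreasing ::
    "real \<Rightarrow> (real \<Rightarrow> real) \<Rightarrow> real \<Rightarrow> real \<Rightarrow> (real \<Rightarrow> real) \<Rightarrow> bool" where
  "moderately_decreasing a F B1 B2 \<phi> \<longleftrightarrow>
     B1 > 0 \<and> B2 > 0 \<and>
     antimono_on {a..} \<phi> \<and> (\<forall>x\<in>{a..max 1 a}. \<phi> x = 1) \<and> (\<phi> \<longlongrightarrow> 0) at_top \<and>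
     (\<forall>v\<ge>0. \<forall>u\<ge>a. F (u + v) - F u \<ge> - B1 * v - B2 * max 1 u * \<phi> u)"

definition G_fun :: "(real \<Rightarrow> real) \<Rightarrow> nat \<Rightarrow> (nat \<Rightarrow> nat) \<Rightarrow> (nat \<Rightarrow> nat \<Rightarrow> complex) \<Rightarrow>
    (nat \<Rightarrow> real) \<Rightarrow> (nat \<Rightarrow> nat \<Rightarrow> real) \<Rightarrow> complex \<Rightarrow> complex" where
  "G_fun A n m c b \<omega> s =
     1 / (s + 1) * mellin_stieltjes A (s + 1) -
     (\<Sum>k=0..n. \<Sum>l=1..m k.
        c k l / (s + \<i> * of_real (b k)) powr of_real (\<omega> k l + 1) +
        cnj (c k l) / (s - \<i> * of_real (b k)) powr of_real (\<omega> k l + 1))"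

definition eta_fun :: "(complex \<Rightarrow> complex) \<Rightarrow> real \<Rightarrow> real \<Rightarrow> real" where
  "eta_fun G \<sigma> T = integral {-T..T} (\<lambda>\<tau>. norm (G (Complex (2 * \<sigma>) \<tau>) - G (Complex \<sigma> \<tau>)))"

text \<open>Here \<open>w\<close> and \<open>W\<close> stand for the minimum and the maximum of the exponents.\<close>

definition rho_fun :: "(complex \<Rightarrow> complex) \<Rightarrow> (real \<Rightarrow> real) \<Rightarrow> real \<Rightarrow> real \<Rightarrow> real \<Rightarrow> real \<Rightarrow> real" where
  "rho_fun G \<phi> w W T x =
     sqrt (\<phi> (sqrt x)) +
     Max ((\<lambda>\<kappa>. ((exp (10 / T) / T + 1) * eta_fun G (1 / ln x) T
                + exp (10 / T) / T * ln x powr max W 0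
                + 1 / ln x * (1 / T powr (W + 1) + 1 / T powr (w + 1))) powr \<kappa>) ` {1/2, 1})"

end

theory Submission
  imports Defs "HOL-Complex_Analysis.Complex_Analysis"
begin

text \<open>With \<open>u = log x\<close> and \<open>a(t) = e\<^sup>-\<^sup>t A(e\<^sup>t)\<close>, the function \<open>G\<close> is the Laplace transform of \<open>a - p\<close>,
  where \<open>p\<close> is the main term, and \<open>G(\<sigma> + i\<tau>) - G(2\<sigma> + i\<tau>)\<close> with \<open>\<sigma> = 1/u\<close> is the Fourier transform of
  \<open>h(t) = (a(t) - p(t)) (e\<^sup>-\<^sup>t\<^sup>/\<^sup>u - e\<^sup>-\<^sup>2\<^sup>t\<^sup>/\<^sup>u)\<close>. The fourth power of the Dirichlet kernel is nonnegative and
  band-limited, so every average of \<open>h\<close> against it is bounded by \<open>\<eta>(\<sigma>, T)\<close>. Since \<open>A\<close> is moderately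
  decreasing, \<open>a\<close> is bounded below and \<open>h\<close> cannot drop quickly; hence averages of \<open>h\<close> over windows of
  length of order \<open>1/T\<close> control its values, first crudely and then, by a weighted supremum argument
  around \<open>u\<close>, with the gain \<open>1/T\<close>. The resulting bound is linear in \<open>\<eta>\<close> and in \<open>\<phi>(\<surd>x) \<le> \<surd>\<phi>(\<surd>x)\<close>, so it
  is covered by the exponent \<open>\<kappa> = 1\<close>.\<close>

section \<open>Functions of bounded variation\<close>

text \<open>The kernel has three duties: it is nonnegative, so that one-sided information on
  \<open>h\<close> may be inserted under the integral; it is band-limited, so that only |tau| <= T
  matters; and it is integrable against 1 + |s|, because the comparison function grows linearly. The
  Fejer kernel has the first two properties but decays like s^-2. The fourth power decays like s^-4,
  and four factors of bandwidth T/4 fill [-T, T].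

  Subtracting the value at 2/u gives the weight a zero at t = 0, which neutralises t^w for every w >
  -1, while near t = u the weight stays above 1/54, so that dividing by it costs only a constant.

  Two obstacles shape the rest. The Stieltjes integral is only assumed to converge conditionally;
  absolute convergence of the Laplace integral is extracted from the one-sided bound A(x) >= -(B1 +
  B2) x. And the constant is chosen before A, phi and the exponents, so each estimate of the main
  term has to be uniform for exponents in (-1, Omega], in particular when w + 1 approaches the pole
  of Gamma at 0.\<close>

lemma bounded_variation_on_decompose:
  fixes f :: "real \<Rightarrow> real"
  assumes bv: "bounded_variation_on f a b"
  obtains V W where "mono_on {a..b} V" "mono_on {a..b} W" "\<And>x. x \<in> {a..b} \<Longrightarrow> f x = V x - W x"
proof -
  define v where "v D = (\<Sum>K\<in>D. \<bar>f (Sup K) - f (Inf K)\<bar>)" for D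
  define S where "S x = {v D | D. D division_of {a..x}}" for x
  define V where "V x = Sup (S x)" for x
  obtain B where B: "\<And>D. D division_of {a..b} \<Longrightarrow> v D \<le> B"
    using bv unfolding bounded_variation_on_def v_def by blast
  \<comment> \<open>Appending the cell [x, y] raises the variation sum by exactly |f y - f x|. With
    y = b this bounds the set \<open>S x\<close>; after taking suprema it gives \<open>key\<close>,
    which makes both V and V - f monotone.\<close>
  have ext: "\<exists>E. E division_of {a..y} \<and> v E = v D + \<bar>f y - f x\<bar>"
    if D: "D division_of {a..x}" and xy: "a \<le> x" "x \<le> y" for D x y
  proof (cases "x = y")
    case True
    then show ?thesis using D by auto
  next
    case False
    then have lt: "x < y" using xy by simp
    have "{{x..y}} division_of {x..y}"
      using lt division_of_self[of x y] unfolding box_real by auto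
    then have "D \<union> {{x..y}} division_of {a..x} \<union> {x..y}"
      by (intro division_disjoint_union[OF D]) (auto simp: interior_atLeastAtMost_real)
    moreover have "{a..x} \<union> {x..y} = {a..y}"
      using xy by auto
    ultimately have E: "insert {x..y} D division_of {a..y}"
      by simp
    have "{x..y} \<notin> D"
    proof
      assume "{x..y} \<in> D"
      then have "{x..y} \<subseteq> {a..x}" using division_ofD(2)[OF D] by blast
      then show False using lt by simp
    qed
    then have "v (insert {x..y} D) = v D + \<bar>f y - f x\<bar>"
      using division_ofD(1)[OF D] lt by (simp add: v_def)
    then show ?thesis using E by blast
  qed
  have bdd: "bdd_above (S x)" if "x \<in> {a..b}" for x
  proof (rule bdd_aboveI)
    fix s assume "s \<in> S x"
    then obtain D where D: "D division_of {a..x}" "s = v D" unfolding S_def by blast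
    have "a \<le> x" "x \<le> b" using that by auto
    from ext[OF D(1) this] obtain E where "E division_of {a..b}" "v E = v D + \<bar>f b - f x\<bar>"
      by blast
    then show "s \<le> B" using B[of E] D by simp
  qed
  have ne: "S x \<noteq> {}" if "x \<in> {a..b}" for x
    using division_of_self[of a x] that unfolding S_def box_real by auto
  have key: "V x + \<bar>f y - f x\<bar> \<le> V y" if "x \<in> {a..b}" "y \<in> {a..b}" "x \<le> y" for x y
  proof -
    have "V x \<le> V y - \<bar>f y - f x\<bar>"
      unfolding V_def[of x]
    proof (rule cSup_least[OF ne[OF that(1)]])
      fix s assume "s \<in> S x"
      then obtain D where D: "D division_of {a..x}" "s = v D" unfolding S_def by blast
      have "a \<le> x" using that by auto
      from ext[OF D(1) this that(3)] obtain E where E: "E division_of {a..y}" "v E = v D + \<bar>f y - f x\<bar>"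
        by blast
      then have "v E \<in> S y" unfolding S_def by blast
      then have "v E \<le> V y"
        unfolding V_def using bdd[OF that(2)] by (intro cSup_upper)
      then show "s \<le> V y - \<bar>f y - f x\<bar>" using E D by simp
    qed
    then show ?thesis by simp
  qed
  show ?thesis
  proof
    show "mono_on {a..b} V"
      by (intro mono_onI) (use key in fastforce)
    show "mono_on {a..b} (\<lambda>x. V x - f x)"
    proof (rule mono_onI)
      fix x y assume "x \<in> {a..b}" "y \<in> {a..b}" "x \<le> y"
      then show "V x - f x \<le> V y - f y" using key[of x y] by linarith
    qed
  qed simp
qed

text \<open>Q is the sum of the two monotone parts. A bound by increments of one function telescopes
  over consecutive cells, which is what the error estimate for Riemann-Stieltjes sums needs.\<close>

lemma bounded_variation_on_control:
  fixes f :: "real \<Rightarrow> real"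
  assumes "bounded_variation_on f a b"
  obtains Q where "mono_on {a..b} Q"
    "\<And>x y. a \<le> x \<Longrightarrow> x \<le> y \<Longrightarrow> y \<le> b \<Longrightarrow> \<bar>f y - f x\<bar> \<le> Q y - Q x"
proof -
  obtain V W where V: "mono_on {a..b} V" and W: "mono_on {a..b} W"
    and f: "\<And>x. x \<in> {a..b} \<Longrightarrow> f x = V x - W x"
    by (rule bounded_variation_on_decompose[OF assms]) blast
  show ?thesis
  proof
    show "mono_on {a..b} (\<lambda>x. V x + W x)"
      by (rule mono_onI) (use V W in \<open>auto simp: mono_on_def intro!: add_mono\<close>)
    fix x y assume xy: "a \<le> x" "x \<le> y" "y \<le> b"
    then have "V x \<le> V y" "W x \<le> W y" using V W by (auto simp: mono_on_def)
    then show "\<bar>f y - f x\<bar> \<le> V y + W y - (V x + W x)" using f[of x] f[of y] xy by auto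
  qed
qed

lemma locally_bounded_variation_measurable:
  assumes "locally_bounded_variation A"
  shows "A \<in> borel_measurable borel"
proof (rule borel_measurable_LIMSEQ_real)
  show "(\<lambda>n. indicator {- real n..real n} x * A x) \<longlonglongrightarrow> A x" for x
  proof (rule tendsto_eventually)
    obtain n0 where n0: "\<bar>x\<bar> \<le> real n0" using real_arch_simple by blast
    show "\<forall>\<^sub>F n in sequentially. indicator {- real n..real n} x * A x = A x"
      using eventually_ge_at_top[of n0] by eventually_elim (use n0 in \<open>auto simp: indicator_def\<close>)
  qed
  fix n :: nat
  obtain V W where V: "mono_on {- real n..real n} V" and W: "mono_on {- real n..real n} W"
    and f: "\<And>x. x \<in> {- real n..real n} \<Longrightarrow> A x = V x - W x"
    by (rule bounded_variation_on_decompose[of A "- real n" "real n"])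
       (use assms in \<open>auto simp: locally_bounded_variation_def\<close>)
  have "(\<lambda>x. indicator {- real n..real n} x *\<^sub>R V x) \<in> borel_measurable borel"
       "(\<lambda>x. indicator {- real n..real n} x *\<^sub>R W x) \<in> borel_measurable borel"
    using borel_measurable_mono_on_fnc[OF V] borel_measurable_mono_on_fnc[OF W]
    by (simp_all add: borel_measurable_restrict_space_iff)
  then have "(\<lambda>x. indicator {- real n..real n} x *\<^sub>R V x - indicator {- real n..real n} x *\<^sub>R W x)
      \<in> borel_measurable borel"
    by (rule borel_measurable_diff)
  also have "(\<lambda>x. indicator {- real n..real n} x *\<^sub>R V x - indicator {- real n..real n} x *\<^sub>R W x)
      = (\<lambda>x. indicator {- real n..real n} x * A x)"
    using f by (auto simp: indicator_def fun_eq_iff)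
  finally show "(\<lambda>x. indicator {- real n..real n} x * A x) \<in> borel_measurable borel" .
qed

lemma locally_bounded_variation_bounded:
  assumes "locally_bounded_variation A"
  obtains M where "\<And>x. a \<le> x \<Longrightarrow> x \<le> b \<Longrightarrow> \<bar>A x\<bar> \<le> M"
proof -
  obtain Q where Q: "mono_on {a..b} Q"
    "\<And>x y. a \<le> x \<Longrightarrow> x \<le> y \<Longrightarrow> y \<le> b \<Longrightarrow> \<bar>A y - A x\<bar> \<le> Q y - Q x"
    by (rule bounded_variation_on_control[of A a b])
       (use assms in \<open>auto simp: locally_bounded_variation_def\<close>)
  show ?thesis
  proof
    fix x assume x: "a \<le> x" "x \<le> b"
    then have "Q x \<le> Q b" using Q(1) by (auto simp: mono_on_def)
    then show "\<bar>A x\<bar> \<le> \<bar>A a\<bar> + (Q b - Q a)"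
      using Q(2)[of a x] x by auto
  qed
qed

text \<open>The Stieltjes integral is tested on all fine tagged divisions; this left-tagged family
  is the one on which its value is computed. Strict monotonicity makes the cells distinct, so that
  sums over the division can later be reindexed by \<open>i\<close>.\<close>

lemma tagged_division_of_partition:
  fixes e :: "nat \<Rightarrow> real"
  assumes e: "strict_mono e" and N: "N > 0"
  shows "(\<lambda>i. (e i, {e i..e (Suc i)})) ` {..<N} tagged_division_of {e 0..e N}"
proof (rule tagged_division_ofI)
  have le: "e i \<le> e j" if "i \<le> j" for i j
    using e that by (simp add: strict_mono_less_eq)
  show "finite ((\<lambda>i. (e i, {e i..e (Suc i)})) ` {..<N})" by simp
  show "x \<in> K" "K \<subseteq> {e 0..e N}" "\<exists>a b. K = cbox a b"
    if "(x, K) \<in> (\<lambda>i. (e i, {e i..e (Suc i)})) ` {..<N}" for x K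
    using that le by (auto simp flip: box_real(2)) (auto intro: order_trans)
  show "interior K1 \<inter> interior K2 = {}"
    if 1: "(x1, K1) \<in> (\<lambda>i. (e i, {e i..e (Suc i)})) ` {..<N}"
      and 2: "(x2, K2) \<in> (\<lambda>i. (e i, {e i..e (Suc i)})) ` {..<N}"
      and ne: "(x1, K1) \<noteq> (x2, K2)" for x1 K1 x2 K2
  proof -
    obtain i j where ij: "K1 = {e i..e (Suc i)}" "K2 = {e j..e (Suc j)}" "i \<noteq> j"
      using 1 2 ne by auto
    consider "Suc i \<le> j" | "Suc j \<le> i" using ij(3) by linarith
    then show ?thesis
    proof cases
      case 1
      then show ?thesis using le[OF 1] by (auto simp: ij interior_atLeastAtMost_real)
    next
      case 2
      then show ?thesis using le[OF 2] by (auto simp: ij interior_atLeastAtMost_real)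
    qed
  qed
  have "(\<Union>i<Suc k. {e i..e (Suc i)}) = {e 0..e (Suc k)}" for k
  proof (induction k)
    case (Suc k)
    have "(\<Union>i<Suc (Suc k). {e i..e (Suc i)}) = {e 0..e (Suc k)} \<union> {e (Suc k)..e (Suc (Suc k))}"
      using Suc by (simp add: lessThan_Suc Un_commute)
    also have "\<dots> = {e 0..e (Suc (Suc k))}"
      using le[of 0 "Suc k"] le[of "Suc k" "Suc (Suc k)"] by auto
    finally show ?case .
  qed (simp add: lessThan_Suc)
  from this[of "N - 1"] have "(\<Union>i<N. {e i..e (Suc i)}) = {e 0..e N}" using N by simp
  moreover have "{K. \<exists>x. (x, K) \<in> (\<lambda>i. (e i, {e i..e (Suc i)})) ` {..<N}} = (\<lambda>i. {e i..e (Suc i)}) ` {..<N}"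
    by auto
  ultimately show "\<Union> {K. \<exists>x. (x, K) \<in> (\<lambda>i. (e i, {e i..e (Suc i)})) ` {..<N}} = {e 0..e N}"
    by simp
qed

lemma stieltjes_sum_partition:
  fixes e :: "nat \<Rightarrow> real" and f :: "real \<Rightarrow> complex"
  assumes "strict_mono e"
  shows "(\<Sum>(x, K)\<in>(\<lambda>i. (e i, {e i..e (Suc i)})) ` {..<N}. f x * of_real (g (Sup K) - g (Inf K)))
    = (\<Sum>i<N. f (e i) * of_real (g (e (Suc i)) - g (e i)))"
proof (subst sum.reindex)
  show "inj_on (\<lambda>i. (e i, {e i..e (Suc i)})) {..<N}"
    using assms by (auto simp: inj_on_def strict_mono_eq)
  have "e i \<le> e (Suc i)" for i using assms by (simp add: strict_mono_less_eq)
  then show "sum ((\<lambda>(x, K). f x * of_real (g (Sup K) - g (Inf K))) \<circ> (\<lambda>i. (e i, {e i..e (Suc i)}))) {..<N}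
     = (\<Sum>i<N. f (e i) * of_real (g (e (Suc i)) - g (e i)))"
    by (intro sum.cong) auto
qed

section \<open>Integration by parts for the Stieltjes integral\<close>

lemma sum_by_parts:
  fixes F a :: "nat \<Rightarrow> 'a::comm_ring"
  shows "(\<Sum>i<N. F i * (a (Suc i) - a i)) = F N * a N - F 0 * a 0 - (\<Sum>i<N. a (Suc i) * (F (Suc i) - F i))"
  by (induction N) (simp_all add: algebra_simps)

lemma set_integrable_bounded_Icc:
  fixes f :: "real \<Rightarrow> 'a::{banach, second_countable_topology}"
  assumes [measurable]: "f \<in> borel_measurable borel" and B: "\<And>t. a \<le> t \<Longrightarrow> t \<le> b \<Longrightarrow> norm (f t) \<le> B"
  shows "set_integrable lborel {a..b} f"
  unfolding set_integrable_def
proof (rule Bochner_Integration.integrable_bound[where f = "\<lambda>x. indicator {a..b} x * B"])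
  show "integrable lborel (\<lambda>x. indicator {a..b} x * B)"
    by (rule integrable_mult_left) (auto simp: emeasure_lborel_Icc_eq)
  show "AE x in lborel. norm (indicator {a..b} x *\<^sub>R f x) \<le> norm (indicator {a..b} x * B)"
    using B by (intro AE_I2) (auto simp: indicator_def intro: order_trans[OF _ abs_ge_self])
qed measurable

text \<open>On one cell, alpha(y) (f y - f x) is the integral of the constant alpha(y) against f',
  so the error is at most the oscillation of alpha times \<open>C\<close> times the mesh, and
  \<open>R\<close> makes the oscillations telescope. The value of alpha at the right endpoint is the
  one that summation by parts leaves behind when the tags are on the left.\<close>

lemma stieltjes_sum_error:
  fixes f f' :: "real \<Rightarrow> complex" and \<alpha> R :: "real \<Rightarrow> real"
  assumes d: "d > 0" and U: "real N * d = U"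
    and f': "\<And>t. (f has_vector_derivative f' t) (at t)"
    and C: "\<And>t. 0 \<le> t \<Longrightarrow> t \<le> U \<Longrightarrow> norm (f' t) \<le> C"
    and int: "(\<lambda>t. of_real (\<alpha> t) * f' t) integrable_on {0..U}"
    and R: "\<And>x y. 0 \<le> x \<Longrightarrow> x \<le> y \<Longrightarrow> y \<le> U \<Longrightarrow> \<bar>\<alpha> y - \<alpha> x\<bar> \<le> R y - R x"
  shows "k \<le> N \<Longrightarrow> norm ((\<Sum>i<k. \<alpha> (real (Suc i) * d) * (f (real (Suc i) * d) - f (real i * d)))
      - integral {0..real k * d} (\<lambda>t. of_real (\<alpha> t) * f' t)) \<le> C * d * (R (real k * d) - R 0)"
proof (induction k)
  case (Suc k)
  let ?x = "real k * d" and ?y = "real (Suc k) * d"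
  have y: "?y \<le> U" using Suc.prems d unfolding U[symmetric] by (intro mult_right_mono) auto
  have x: "0 \<le> ?x" "?x \<le> ?y" using d by (auto intro!: mult_right_mono)
  have int1: "(\<lambda>t. of_real (\<alpha> t) * f' t) integrable_on {0..?y}" "(\<lambda>t. of_real (\<alpha> t) * f' t) integrable_on {?x..?y}"
    using integrable_on_subinterval[OF int] x y by auto
  have "(f' has_integral (f ?y - f ?x)) {?x..?y}"
    by (rule fundamental_theorem_of_calculus[OF x(2)])
       (use f' has_vector_derivative_at_within in blast)
  then have "((\<lambda>t. of_real (\<alpha> ?y) * f' t) has_integral (of_real (\<alpha> ?y) * (f ?y - f ?x))) {?x..?y}"
    by (rule has_integral_mult_right)
  note diff = has_integral_diff[OF this integrable_integral[OF int1(2)]]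
  have "norm (of_real (\<alpha> ?y) * (f ?y - f ?x) - integral {?x..?y} (\<lambda>t. of_real (\<alpha> t) * f' t))
      \<le> (R ?y - R ?x) * C * measure lborel {?x..?y}"
  proof (rule has_integral_bound_real[OF _ finite.emptyI diff])
    show "0 \<le> (R ?y - R ?x) * C"
      using R[OF x y] C[of 0] norm_ge_zero[of "f' 0"] x y abs_ge_zero[of "\<alpha> ?y - \<alpha> ?x"]
      by (intro mult_nonneg_nonneg) linarith+
    show "norm (of_real (\<alpha> ?y) * f' t - of_real (\<alpha> t) * f' t) \<le> (R ?y - R ?x) * C" if "t \<in> {?x..?y} - {}" for t
    proof -
      have "norm (of_real (\<alpha> ?y) * f' t - of_real (\<alpha> t) * f' t) = \<bar>\<alpha> ?y - \<alpha> t\<bar> * norm (f' t)"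
        by (simp flip: left_diff_distrib of_real_diff add: norm_mult)
      also have "\<dots> \<le> (R ?y - R ?x) * C"
        using R[of t ?y] R[of ?x t] C[of t] that x y abs_ge_zero[of "\<alpha> t - \<alpha> ?x"]
        by (intro mult_mono) auto
      finally show ?thesis .
    qed
  qed
  also have "measure lborel {?x..?y} = d" using x by (simp add: algebra_simps)
  finally have 1: "norm (of_real (\<alpha> ?y) * (f ?y - f ?x) - integral {?x..?y} (\<lambda>t. of_real (\<alpha> t) * f' t)) \<le> (R ?y - R ?x) * C * d" .
  have comb: "integral {0..?x} (\<lambda>t. of_real (\<alpha> t) * f' t) + integral {?x..?y} (\<lambda>t. of_real (\<alpha> t) * f' t)
      = integral {0..?y} (\<lambda>t. of_real (\<alpha> t) * f' t)"
    by (rule Henstock_Kurzweil_Integration.integral_combine[OF x int1(1)])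
  have "norm ((\<Sum>i<Suc k. \<alpha> (real (Suc i) * d) * (f (real (Suc i) * d) - f (real i * d)))
      - integral {0..?y} (\<lambda>t. of_real (\<alpha> t) * f' t))
     = norm (((\<Sum>i<k. \<alpha> (real (Suc i) * d) * (f (real (Suc i) * d) - f (real i * d)))
      - integral {0..?x} (\<lambda>t. of_real (\<alpha> t) * f' t)) + (of_real (\<alpha> ?y) * (f ?y - f ?x) - integral {?x..?y} (\<lambda>t. of_real (\<alpha> t) * f' t)))"
    unfolding comb[symmetric] sum.lessThan_Suc by (simp only: add_diff_add)
  also have "\<dots> \<le> C * d * (R ?x - R 0) + (R ?y - R ?x) * C * d"
    by (rule order_trans[OF norm_triangle_ineq add_mono[OF Suc.IH 1]]) (use Suc.prems in auto)
  also have "\<dots> = C * d * (R ?y - R 0)" by (simp add: algebra_simps)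
  finally show ?case .
qed simp

text \<open>Points equally spaced in t = log x turn the Stieltjes sums into left-tagged sums for
  e^(-st). Abel summation moves the increments onto this smooth factor, and the remaining sum tends
  to an ordinary integral. The term \<open>- A 1\<close> cancels against the left jump added in
  \<open>has_mellin_stieltjes\<close>.\<close>

lemma has_stieltjes_integral_by_parts:
  assumes lbv: "locally_bounded_variation A" and U: "U > 0"
    and J: "has_stieltjes_integral (\<lambda>x. of_real x powr (- s)) A J 1 (exp U)"
  shows "J = exp (- (s * of_real U)) * A (exp U) - A 1
      + s * (LINT t:{0..U}|lborel. A (exp t) * exp (- (s * of_real t)))"
proof -
  define f where "f t = exp (- (s * of_real t))" for t :: real
  define f' where "f' t = - s * exp (- (s * of_real t))" for t :: real
  define \<alpha> where "\<alpha> t = A (exp t)" for t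
  have [measurable]: "A \<in> borel_measurable borel" by (rule locally_bounded_variation_measurable[OF lbv])
  have f': "(f has_vector_derivative f' t) (at t)" for t
    unfolding f_def f'_def
    by (auto intro!: derivative_eq_intros has_vector_derivative_real_field)
  obtain C where C: "\<And>t. 0 \<le> t \<Longrightarrow> t \<le> U \<Longrightarrow> norm (f' t) \<le> C"
  proof -
    have "compact (f' ` {0..U})"
      unfolding f'_def by (intro compact_continuous_image continuous_intros) auto
    then obtain C where "\<forall>x\<in>{0..U}. norm (f' x) \<le> C"
      by (auto dest!: compact_imp_bounded simp: bounded_iff)
    then show ?thesis using that by (intro that[of C]) auto
  qed
  obtain M where M: "\<And>x. 1 \<le> x \<Longrightarrow> x \<le> exp U \<Longrightarrow> \<bar>A x\<bar> \<le> M"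
    using locally_bounded_variation_bounded[OF lbv, of 1 "exp U"] by blast
  have M0: "0 \<le> M" using M[of 1] U by (simp add: order_trans[OF abs_ge_zero])
  obtain Q where Q: "mono_on {1..exp U} Q"
    "\<And>x y. 1 \<le> x \<Longrightarrow> x \<le> y \<Longrightarrow> y \<le> exp U \<Longrightarrow> \<bar>A y - A x\<bar> \<le> Q y - Q x"
    by (rule bounded_variation_on_control[of A 1 "exp U"])
       (use lbv in \<open>auto simp: locally_bounded_variation_def\<close>)
  have sint: "set_integrable lborel {0..U} (\<lambda>t. of_real (\<alpha> t) * f' t)"
  proof (rule set_integrable_bounded_Icc)
    show "(\<lambda>t. complex_of_real (\<alpha> t) * f' t) \<in> borel_measurable borel"
      unfolding \<alpha>_def f'_def by measurable
    show "norm (of_real (\<alpha> t) * f' t) \<le> M * C" if "0 \<le> t" "t \<le> U" for t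
      using M[of "exp t"] C[of t] that M0 by (auto simp: norm_mult \<alpha>_def intro!: mult_mono)
  qed
  have int: "(\<lambda>t. of_real (\<alpha> t) * f' t) integrable_on {0..U}"
    using set_borel_integral_eq_integral(1)[OF sint] .
  define I where "I = f U * \<alpha> U - f 0 * \<alpha> 0 - integral {0..U} (\<lambda>t. of_real (\<alpha> t) * f' t)"
  have J0: "norm (J - I) \<le> e" if e: "e > 0" for e
  proof -
    obtain \<delta> where \<delta>: "\<delta> > 0" "\<And>p. p tagged_division_of {1..exp U} \<Longrightarrow> (\<lambda>x. ball x \<delta>) fine p
        \<Longrightarrow> norm ((\<Sum>(x, K)\<in>p. of_real x powr (- s) * of_real (A (Sup K) - A (Inf K))) - J) < e / 2"
      using J[unfolded has_stieltjes_integral_def, rule_format, of "e/2"] e by auto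
    \<comment> \<open>Two demands on the number of cells: every cell in x has length at most e^U
      (e^d - 1), which must be below the mesh bound, and the error bound of
      \<open>stieltjes_sum_error\<close> must be below e/2.\<close>
    have lim1: "(\<lambda>N. exp U * (exp (U / real (Suc N)) - 1)) \<longlonglongrightarrow> exp U * (exp 0 - 1)"
      by (intro tendsto_intros LIMSEQ_Suc[OF lim_const_over_n])
    have lim2: "(\<lambda>N. C * (U / real (Suc N)) * (Q (exp U) - Q 1)) \<longlonglongrightarrow> C * 0 * (Q (exp U) - Q 1)"
      by (intro tendsto_intros LIMSEQ_Suc[OF lim_const_over_n])
    have "\<forall>\<^sub>F N in sequentially. exp U * (exp (U / real (Suc N)) - 1) < \<delta>
        \<and> C * (U / real (Suc N)) * (Q (exp U) - Q 1) < e / 2"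
      using order_tendstoD(2)[OF lim1, of \<delta>] order_tendstoD(2)[OF lim2, of "e/2"] \<delta>(1) e
      by (simp add: eventually_conj)
    then obtain n where n: "exp U * (exp (U / real (Suc n)) - 1) < \<delta>"
        "C * (U / real (Suc n)) * (Q (exp U) - Q 1) < e / 2"
      by (auto dest: eventually_happens)
    define N where "N = Suc n"
    define d where "d = U / real N"
    have N: "N > 0" by (simp add: N_def)
    have d: "d > 0" using U N by (simp add: d_def)
    have Nd: "real N * d = U" using N by (simp add: d_def)
    define x where "x i = exp (real i * d)" for i
    have mono: "strict_mono x"
      by (rule strict_monoI) (use d in \<open>simp add: x_def\<close>)
    define p where "p = (\<lambda>i. (x i, {x i..x (Suc i)})) ` {..<N}"
    have p: "p tagged_division_of {1..exp U}"
      using tagged_division_of_partition[OF mono N] by (simp add: p_def x_def Nd)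
    have "{x i..x (Suc i)} \<subseteq> ball (x i) \<delta>" if "i < N" for i
    proof -
      have "x (Suc i) - x i = x i * (exp d - 1)" by (simp add: x_def algebra_simps exp_add)
      also have "\<dots> \<le> exp U * (exp d - 1)"
        using that d by (intro mult_right_mono) (auto simp: x_def Nd[symmetric] intro!: mult_right_mono)
      also have "\<dots> < \<delta>" using n(1) by (simp add: d_def N_def)
      finally show ?thesis by (auto simp: dist_real_def)
    qed
    then have fine: "(\<lambda>x. ball x \<delta>) fine p" by (auto simp: p_def fine_def)
    have xf: "of_real (x i) powr (- s) = f (real i * d)" for i
      by (simp add: x_def f_def powr_def Ln_of_real)
    have sum: "(\<Sum>(x, K)\<in>p. of_real x powr (- s) * of_real (A (Sup K) - A (Inf K)))
       = (\<Sum>i<N. f (real i * d) * (of_real (\<alpha> (real (Suc i) * d)) - of_real (\<alpha> (real i * d))))"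
      using stieltjes_sum_partition[OF mono, of "\<lambda>x. of_real x powr (- s)" A N] unfolding p_def[symmetric] xf
      by (simp add: \<alpha>_def x_def)
    have err: "norm ((\<Sum>i<N. \<alpha> (real (Suc i) * d) * (f (real (Suc i) * d) - f (real i * d)))
      - integral {0..real N * d} (\<lambda>t. of_real (\<alpha> t) * f' t)) \<le> C * d * (Q (exp (real N * d)) - Q (exp 0))"
      by (rule stieltjes_sum_error[OF d Nd f' C int]) (use Q(2) in \<open>auto simp: \<alpha>_def\<close>)
    have "norm ((\<Sum>(x, K)\<in>p. of_real x powr (- s) * of_real (A (Sup K) - A (Inf K))) - I) < e / 2"
    proof -
      have "norm ((\<Sum>(x, K)\<in>p. of_real x powr (- s) * of_real (A (Sup K) - A (Inf K))) - I)
        = norm ((\<Sum>i<N. \<alpha> (real (Suc i) * d) * (f (real (Suc i) * d) - f (real i * d)))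
      - integral {0..real N * d} (\<lambda>t. of_real (\<alpha> t) * f' t))"
        unfolding sum I_def Nd
          sum_by_parts[of "\<lambda>i. f (real i * d)" "\<lambda>i. of_real (\<alpha> (real i * d))" N]
        by (simp add: norm_minus_commute)
      also note err
      finally have "norm ((\<Sum>(x, K)\<in>p. of_real x powr (- s) * of_real (A (Sup K) - A (Inf K))) - I)
          \<le> C * d * (Q (exp U) - Q 1)" unfolding Nd exp_zero .
      also have "\<dots> < e / 2" using n(2) by (simp only: d_def N_def)
      finally show ?thesis .
    qed
    moreover note \<delta>(2)[OF p fine]
    moreover have "norm (J - I) \<le> norm (S - I) + norm (S - J)" for S
      by (metis norm_minus_commute norm_triangle_sub dist_norm dist_triangle3)
    ultimately show ?thesis by (smt (verit) field_sum_of_halves)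
  qed
  have "J = I"
    using J0[of "norm (J - I) / 2"] by (cases "J = I") auto
  also have "I = f U * \<alpha> U - f 0 * \<alpha> 0 - integral {0..U} (\<lambda>t. of_real (\<alpha> t) * f' t)"
    by (simp add: I_def)
  also have "integral {0..U} (\<lambda>t. of_real (\<alpha> t) * f' t) = (LINT t:{0..U}|lborel. of_real (\<alpha> t) * f' t)"
    using set_borel_integral_eq_integral(2)[OF sint] by simp
  also have "(LINT t:{0..U}|lborel. of_real (\<alpha> t) * f' t) = (LINT t:{0..U}|lborel. - s * (A (exp t) * exp (- (s * of_real t))))"
    by (rule set_lebesgue_integral_cong) (auto simp: \<alpha>_def f'_def)
  also have "\<dots> = - s * (LINT t:{0..U}|lborel. A (exp t) * exp (- (s * of_real t)))"
    by (rule set_integral_mult_right)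
  finally show ?thesis by (simp add: I_def f_def \<alpha>_def)
qed

section \<open>The Mellin--Stieltjes transform as a Laplace transform\<close>

lemma set_integrable_lborelI:
  fixes f :: "real \<Rightarrow> 'a::euclidean_space"
  assumes "f absolutely_integrable_on S" "f \<in> borel_measurable borel" "S \<in> sets borel"
  shows "set_integrable lborel S f"
proof -
  have "(\<lambda>x. indicator S x *\<^sub>R f x) \<in> borel_measurable lborel"
    using assms(2,3) by measurable
  from integrable_completion[OF this] show ?thesis
    using assms(1) unfolding set_integrable_def by blast
qed

lemma exp_neg_of_real: "exp (- (complex_of_real r * complex_of_real t)) = of_real (exp (- (r * t)))"
  by (metis exp_of_real of_real_minus of_real_mult)

lemma exp_neg_integral:
  assumes "a > (0::real)"
  shows "set_integrable lborel {0..} (\<lambda>t. exp (- (a * t)))"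
    and "(LINT t:{0..}|lborel. exp (- (a * t))) = 1 / a"
proof -
  have hi: "((\<lambda>t. exp (- (a * t))) has_integral 1 / a) {0..}"
    using has_integral_exp_minus_to_infinity[OF assms, of 0] by simp
  then have "(\<lambda>t. exp (- (a * t))) absolutely_integrable_on {0..}"
    by (intro nonnegative_absolutely_integrable_1) (auto simp: integrable_on_def)
  then show *: "set_integrable lborel {0..} (\<lambda>t. exp (- (a * t)))"
    by (rule set_integrable_lborelI) auto
  show "(LINT t:{0..}|lborel. exp (- (a * t))) = 1 / a"
    using set_borel_integral_eq_integral(2)[OF *] hi by (simp add: integral_unique)
qed

context
  fixes A :: "real \<Rightarrow> real" and B :: real
  assumes lbv: "locally_bounded_variation A"
    and zero: "\<And>x. x < 1 \<Longrightarrow> A x = 0"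
    and conv: "\<And>s. Re s > 1 \<Longrightarrow> mellin_stieltjes_converges A s"
    and lower: "\<And>x. x \<ge> 1 \<Longrightarrow> A x \<ge> - B * x"
    and B: "B \<ge> 0"
begin

lemma set_integrable_A_exp:
  "set_integrable lborel {0..U} (\<lambda>t. of_real (A (exp t)) * exp (- (s * complex_of_real t)) :: complex)"
proof (cases "U \<ge> 0")
  case True
  note [measurable] = locally_bounded_variation_measurable[OF lbv]
  obtain M where M: "\<And>x. 1 \<le> x \<Longrightarrow> x \<le> exp U \<Longrightarrow> \<bar>A x\<bar> \<le> M"
    using locally_bounded_variation_bounded[OF lbv, of 1 "exp U"] by blast
  have M0: "0 \<le> M" using M[of 1] True by (simp add: order_trans[OF abs_ge_zero])
  have "compact ((\<lambda>t. exp (- (s * complex_of_real t))) ` {0..U})"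
    by (intro compact_continuous_image continuous_intros) auto
  then obtain C where C: "\<forall>x\<in>{0..U}. norm (exp (- (s * of_real x))) \<le> C"
    by (auto dest!: compact_imp_bounded simp: bounded_iff)
  show ?thesis
  proof (rule set_integrable_bounded_Icc)
    show "norm (of_real (A (exp t)) * exp (- (s * complex_of_real t))) \<le> M * C" if "0 \<le> t" "t \<le> U" for t
      unfolding norm_mult using M[of "exp t"] C that M0 by (intro mult_mono) auto
  qed measurable
qed (simp add: set_integrable_def)

lemma mellin_stieltjes_limit:
  assumes "Re s > 1"
  shows "((\<lambda>U. exp (- (s * complex_of_real U)) * of_real (A (exp U))
      + s * (LINT t:{0..U}|lborel. of_real (A (exp t)) * exp (- (s * complex_of_real t)))) \<longlongrightarrow> mellin_stieltjes A s) at_top"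
proof -
  obtain L where L: "has_mellin_stieltjes A s L"
    using conv[OF assms] unfolding mellin_stieltjes_converges_def by blast
  then obtain J where J: "\<forall>X\<ge>1. has_stieltjes_integral (\<lambda>x. of_real x powr (- s)) A (J X) 1 X"
    and lim: "((\<lambda>X. of_real (A 1) + J X) \<longlongrightarrow> L) at_top"
    unfolding has_mellin_stieltjes_def by blast
  have "((\<lambda>U. of_real (A 1) + J (exp U)) \<longlongrightarrow> L) at_top"
    by (rule filterlim_compose[OF lim exp_at_top])
  moreover have "\<forall>\<^sub>F U in at_top. of_real (A 1) + J (exp U) = exp (- (s * complex_of_real U)) * of_real (A (exp U))
      + s * (LINT t:{0..U}|lborel. of_real (A (exp t)) * exp (- (s * complex_of_real t)))"
    using eventually_gt_at_top[of 0]
  proof eventually_elim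
    case (elim U)
    then show ?case
      using has_stieltjes_integral_by_parts[OF lbv elim, of s "J (exp U)"] J by simp
  qed
  ultimately show ?thesis
    unfolding mellin_stieltjes_eqI[OF L] by (rule Lim_transform_eventually)
qed

lemma mellin_real_limit:
  assumes "r > 1"
  shows "((\<lambda>U. exp (- (r * U)) * A (exp U)
      + r * (LINT t:{0..U}|lborel. A (exp t) * exp (- (r * t)))) \<longlongrightarrow> Re (mellin_stieltjes A (of_real r))) at_top"
proof -
  have "Re (exp (- (complex_of_real r * complex_of_real U)) * of_real (A (exp U))
      + of_real r * (LINT t:{0..U}|lborel. of_real (A (exp t)) * exp (- (complex_of_real r * complex_of_real t))))
     = exp (- (r * U)) * A (exp U) + r * (LINT t:{0..U}|lborel. A (exp t) * exp (- (r * t)))" for U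
  proof -
    have "(LINT t:{0..U}|lborel. of_real (A (exp t)) * exp (- (complex_of_real r * complex_of_real t)) :: complex)
       = (LINT t:{0..U}|lborel. of_real (A (exp t) * exp (- (r * t))))"
      by (rule set_lebesgue_integral_cong) (auto simp: exp_neg_of_real)
    also have "\<dots> = of_real (LINT t:{0..U}|lborel. A (exp t) * exp (- (r * t)))"
      by (rule set_integral_complex_of_real)
    finally show ?thesis by (simp add: exp_neg_of_real)
  qed
  then show ?thesis
    using tendsto_Re[OF mellin_stieltjes_limit[of "of_real r"]] assms by simp
qed

text \<open>Convergence of the Mellin transform bounds only the sum of the boundary term and the
  truncated integral. Since A(x) >= -Bx, the boundary term is at least -B for r > 1, which bounds
  the truncated integrals from above. Adding B e^t to A(e^t) makes the integrand nonnegative, and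
  monotone convergence applies.\<close>

lemma integrable_A_exp_real:
  assumes r: "r > 1"
  shows "integrable lborel (\<lambda>t. A (exp t) * exp (- (r * t)))"
proof -
  note [measurable] = locally_bounded_variation_measurable[OF lbv]
  define q where "q t = indicator {0..} t * ((A (exp t) + B * exp t) * exp (- (r * t)))" for t
  define f where "f n t = indicator {0..real n} t * ((A (exp t) + B * exp t) * exp (- (r * t)))" for n t
  have eint: "set_integrable lborel {0..} (\<lambda>t. exp (- ((r - 1) * t)))"
    and eval: "(LINT t:{0..}|lborel. exp (- ((r - 1) * t))) = 1 / (r - 1)"
    using exp_neg_integral[of "r - 1"] r by auto
  have nonneg: "0 \<le> (A (exp t) + B * exp t) * exp (- (r * t))" if "t \<ge> 0" for t
    using lower[of "exp t"] that by auto
  have *: "A (exp t) * exp (- (r * t)) = Re (of_real (A (exp t)) * exp (- (complex_of_real r * complex_of_real t)))" for t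
    by (simp add: exp_neg_of_real)
  have Aint: "set_integrable lborel {0..real n} (\<lambda>t. A (exp t) * exp (- (r * t)))" for n
  proof -
    have "set_integrable lborel {0..real n} (\<lambda>t. Re (of_real (A (exp t)) * exp (- (complex_of_real r * complex_of_real t))))"
      using integrable_Re[OF set_integrable_A_exp[of "real n" "of_real r", unfolded set_integrable_def]]
      unfolding set_integrable_def by (simp only: scaleR_complex.sel real_scaleR_def)
    then show ?thesis unfolding * by simp
  qed
  have eint_n: "set_integrable lborel {0..real n} (\<lambda>t. exp (- ((r - 1) * t)))" for n
    by (rule set_integrable_subset[OF eint]) auto
  have split: "(A (exp t) + B * exp t) * exp (- (r * t)) = A (exp t) * exp (- (r * t)) + B * exp (- ((r - 1) * t))" for t
    by (simp add: algebra_simps flip: exp_add)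
  have f_eq: "f n = (\<lambda>t. indicator {0..real n} t *\<^sub>R (A (exp t) * exp (- (r * t)) + B * exp (- ((r - 1) * t))))" for n
    by (simp add: f_def split fun_eq_iff)
  have fint: "integrable lborel (f n)" for n
    using set_integral_add(1)[OF Aint set_integrable_mult_right[of B, OF eint_n]]
    by (simp only: f_eq set_integrable_def)
  have fval: "integral\<^sup>L lborel (f n) \<le> (LINT t:{0..real n}|lborel. A (exp t) * exp (- (r * t))) + B / (r - 1)" for n
  proof -
    have "integral\<^sup>L lborel (f n) = (LINT t:{0..real n}|lborel. A (exp t) * exp (- (r * t)) + B * exp (- ((r - 1) * t)))"
      by (simp only: f_eq set_lebesgue_integral_def)
    also have "\<dots> = (LINT t:{0..real n}|lborel. A (exp t) * exp (- (r * t))) + B * (LINT t:{0..real n}|lborel. exp (- ((r - 1) * t)))"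
      using set_integral_add(2)[OF Aint set_integrable_mult_right[of B, OF eint_n]] by simp
    also have "(LINT t:{0..real n}|lborel. exp (- ((r - 1) * t))) \<le> (LINT t:{0..}|lborel. exp (- ((r - 1) * t)))"
      unfolding set_lebesgue_integral_def
      using eint eint_n by (intro integral_mono) (auto simp: set_integrable_def indicator_def)
    finally show ?thesis using B eval by (simp add: mult_left_mono)
  qed
  have conv': "(\<lambda>n. exp (- (r * real n)) * A (exp (real n))
      + r * (LINT t:{0..real n}|lborel. A (exp t) * exp (- (r * t)))) \<longlonglongrightarrow> Re (mellin_stieltjes A (of_real r))"
    by (rule filterlim_compose[OF mellin_real_limit[OF r] filterlim_real_sequentially])
  define Z where "Z n = exp (- (r * real n)) * A (exp (real n))
      + r * (LINT t:{0..real n}|lborel. A (exp t) * exp (- (r * t)))" for n :: nat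
  have "Bseq Z"
    using conv' unfolding Z_def by (intro convergent_imp_Bseq) (auto simp: convergent_def)
  then obtain K0 where K0: "\<And>n. norm (Z n) \<le> K0" unfolding Bseq_def by blast
  have "Z n \<le> K0" for n using K0[of n] by (auto dest: abs_le_D1)
  then obtain K where K: "\<And>n. exp (- (r * real n)) * A (exp (real n))
      + r * (LINT t:{0..real n}|lborel. A (exp t) * exp (- (r * t))) \<le> K"
    unfolding Z_def by blast
  have up: "(LINT t:{0..real n}|lborel. A (exp t) * exp (- (r * t))) \<le> (K + B) / r" for n
  proof -
    have "- B \<le> - B * exp (- ((r - 1) * real n))"
      using B r by (simp add: mult_left_le)
    also have "\<dots> = exp (- (r * real n)) * (- B * exp (real n))" by (simp add: algebra_simps flip: exp_add)
    also have "\<dots> \<le> exp (- (r * real n)) * A (exp (real n))"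
      using lower[of "exp (real n)"] by (intro mult_left_mono) auto
    finally show ?thesis using K[of n] r by (simp add: field_simps)
  qed
  have inc: "f m t \<le> f n t" if "m \<le> n" for m n t
    using that nonneg[of t] by (auto simp: f_def indicator_def)
  have "incseq (\<lambda>n. integral\<^sup>L lborel (f n))"
    by (intro incseq_SucI integral_mono fint inc) auto
  moreover have "\<forall>n. integral\<^sup>L lborel (f n) \<le> (K + B) / r + B / (r - 1)"
    using order_trans[OF fval add_right_mono[OF up]] by blast
  ultimately obtain l where l: "(\<lambda>n. integral\<^sup>L lborel (f n)) \<longlonglongrightarrow> l"
    by (rule incseq_convergent)
  have "integrable lborel q"
  proof (rule integrable_monotone_convergence[OF fint _ _ l])
    show "AE t in lborel. mono (\<lambda>n. f n t)" by (auto intro!: monoI inc)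
    show "AE t in lborel. (\<lambda>n. f n t) \<longlonglongrightarrow> q t"
    proof (rule AE_I2, rule tendsto_eventually)
      fix t :: real
      obtain n0 where n0: "t \<le> real n0" using real_arch_simple by blast
      show "\<forall>\<^sub>F n in sequentially. f n t = q t"
        using eventually_ge_at_top[of n0] by eventually_elim (use n0 in \<open>auto simp: f_def q_def indicator_def\<close>)
    qed
    show "q \<in> borel_measurable lborel" unfolding q_def by measurable
  qed
  then have "integrable lborel (\<lambda>t. q t - indicator {0..} t *\<^sub>R (B * exp (- ((r - 1) * t))))"
    using set_integrable_mult_right[of B, OF eint] unfolding set_integrable_def
    by (rule Bochner_Integration.integrable_diff)
  also have "(\<lambda>t. q t - indicator {0..} t *\<^sub>R (B * exp (- ((r - 1) * t)))) = (\<lambda>t. A (exp t) * exp (- (r * t)))"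
    using zero by (auto simp: q_def split indicator_def fun_eq_iff)
  finally show ?thesis .
qed

lemma integrable_A_exp:
  assumes "Re s > 1"
  shows "integrable lborel (\<lambda>t. of_real (A (exp t)) * exp (- (s * complex_of_real t)) :: complex)"
proof (rule Bochner_Integration.integrable_bound[OF integrable_A_exp_real[OF assms]])
  show "AE t in lborel. norm (of_real (A (exp t)) * exp (- (s * complex_of_real t)) :: complex) \<le> norm (A (exp t) * exp (- (Re s * t)))"
    by (intro AE_I2) (simp add: norm_mult)
qed (use locally_bounded_variation_measurable[OF lbv] in measurable)

lemma tendsto_integral_A_exp:
  assumes "Re s > 1"
  shows "((\<lambda>U. LINT t:{0..U}|lborel. of_real (A (exp t)) * exp (- (s * complex_of_real t)) :: complex) \<longlongrightarrow>
     (LINT t|lborel. of_real (A (exp t)) * exp (- (s * complex_of_real t)))) at_top"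
proof -
  have "((\<lambda>U. LINT t:{0..U}|lborel. of_real (A (exp t)) * exp (- (s * complex_of_real t)) :: complex) \<longlongrightarrow>
     (LINT t:{0..}|lborel. of_real (A (exp t)) * exp (- (s * complex_of_real t)))) at_top"
    using integrable_A_exp[OF assms]
    by (intro tendsto_set_lebesgue_integral_at_top) (auto simp: set_integrable_def intro!: integrable_mult_indicator)
  also have "(LINT t:{0..}|lborel. of_real (A (exp t)) * exp (- (s * complex_of_real t)) :: complex)
     = (LINT t|lborel. of_real (A (exp t)) * exp (- (s * complex_of_real t)))"
    unfolding set_lebesgue_integral_def
    using zero by (intro Bochner_Integration.integral_cong) (auto simp: indicator_def)
  finally show ?thesis .
qed

text \<open>Both terms of the limit converge for some \<open>r\<close> strictly between \<open>1\<close> and \<open>Re s\<close>, so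
  \<open>A(e\<^sup>U) e\<^sup>-\<^sup>r\<^sup>U\<close> is convergent, and the remaining factor tends to \<open>0\<close>.\<close>

lemma A_exp_tendsto_0:
  assumes s: "Re s > 1"
  shows "((\<lambda>U. exp (- (s * complex_of_real U)) * of_real (A (exp U))) \<longlongrightarrow> 0) at_top"
proof -
  define r where "r = (1 + Re s) / 2"
  have r: "r > 1" "r < Re s" using s by (auto simp: r_def)
  have "((\<lambda>U. exp (- (complex_of_real r * complex_of_real U)) * of_real (A (exp U)) + of_real r * (LINT t:{0..U}|lborel. of_real (A (exp t)) * exp (- (complex_of_real r * complex_of_real t)))
      - of_real r * (LINT t:{0..U}|lborel. of_real (A (exp t)) * exp (- (complex_of_real r * complex_of_real t))))
    \<longlongrightarrow> mellin_stieltjes A (of_real r) - of_real r * (LINT t|lborel. of_real (A (exp t)) * exp (- (complex_of_real r * complex_of_real t)))) at_top"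
    using r by (intro tendsto_intros mellin_stieltjes_limit tendsto_integral_A_exp) auto
  then have "((\<lambda>U. exp (- (complex_of_real r * complex_of_real U)) * of_real (A (exp U)))
    \<longlongrightarrow> mellin_stieltjes A (of_real r) - of_real r * (LINT t|lborel. of_real (A (exp t)) * exp (- (complex_of_real r * complex_of_real t)))) at_top"
    by simp
  note lim1 = tendsto_norm[OF this]
  have "((\<lambda>U. exp (- ((Re s - r) * U))) \<longlongrightarrow> 0) at_top"
    using r by (intro filterlim_compose[OF exp_at_bot] filterlim_uminus_at_bot_at_top[THEN filterlim_compose]
       filterlim_tendsto_pos_mult_at_top[OF tendsto_const] filterlim_ident) auto
  from tendsto_mult[OF this lim1]
  have "((\<lambda>U. exp (- ((Re s - r) * U)) * norm (exp (- (complex_of_real r * complex_of_real U)) * of_real (A (exp U)))) \<longlongrightarrow> 0) at_top"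
    by simp
  moreover have "exp (- ((Re s - r) * U)) * norm (exp (- (complex_of_real r * complex_of_real U)) * of_real (A (exp U)))
     = norm (exp (- (s * complex_of_real U)) * of_real (A (exp U)))" for U
    by (simp add: norm_mult algebra_simps flip: exp_add mult.assoc)
  ultimately show ?thesis by (simp add: tendsto_norm_zero_iff)
qed

text \<open>The boundary term of the integration by parts vanishes in the limit. Used at s + 1, the
  formula makes 1/(s+1) times the Mellin transform equal to the Laplace transform of e^-t A(e^t),
  which explains the normalisation in G.\<close>

lemma mellin_stieltjes_eq_laplace:
  assumes "Re s > 1"
  shows "mellin_stieltjes A s = s * (LINT t|lborel. of_real (A (exp t)) * exp (- (s * complex_of_real t)))"
proof -
  have "((\<lambda>U. exp (- (s * complex_of_real U)) * of_real (A (exp U)) + s * (LINT t:{0..U}|lborel. of_real (A (exp t)) * exp (- (s * complex_of_real t))))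
    \<longlongrightarrow> 0 + s * (LINT t|lborel. of_real (A (exp t)) * exp (- (s * complex_of_real t)))) at_top"
    by (intro tendsto_intros A_exp_tendsto_0 tendsto_integral_A_exp assms)
  then show ?thesis
    using tendsto_unique[OF _ mellin_stieltjes_limit[OF assms]] by (simp add: trivial_limit_at_top_linorder)
qed

end

section \<open>Laplace transforms of powers\<close>

lemma set_integrable_powr_exp:
  fixes w x :: real
  assumes "w > -1" "x > 0"
  shows "set_integrable lborel {0..} (\<lambda>t. t powr w * exp (- (x * t)))"
proof -
  have "(\<lambda>t. complex_of_real t powr (of_real (w + 1) - 1) / of_real (exp (x * t))) absolutely_integrable_on {0<..}"
    using assms by (intro absolutely_integrable_Gamma_integral) auto
  then have "(\<lambda>t. norm (complex_of_real t powr (of_real (w + 1) - 1) / of_real (exp (x * t)))) absolutely_integrable_on {0<..}"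
    by (rule absolutely_integrable_norm[unfolded o_def])
  also have "?this \<longleftrightarrow> (\<lambda>t. t powr w * exp (- (x * t))) absolutely_integrable_on {0<..}"
    by (intro set_integrable_cong) (auto simp: norm_divide norm_powr_real_powr exp_minus field_simps)
  finally have "set_integrable lborel {0<..} (\<lambda>t. t powr w * exp (- (x * t)))"
    by (rule set_integrable_lborelI) auto
  also have "?this \<longleftrightarrow> ?thesis"
    unfolding set_integrable_def
    by (intro Bochner_Integration.integrable_cong) (auto simp: indicator_def)
  finally show ?thesis .
qed

lemma laplace_powr_real:
  fixes w x :: real
  assumes w: "w > -1" and x: "x > 0"
  shows "(LINT t:{0..}|lborel. t powr w * exp (- (x * t))) = Gamma (w + 1) / x powr (w + 1)"
proof -
  have *: "(LINT t:{0..}|lborel. t powr w * exp (- t)) = Gamma (w + 1)"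
  proof -
    have "(LINT t:{0..}|lborel. t powr w * exp (- t)) = integral {0..} (\<lambda>t. t powr w * exp (- t))"
      using set_borel_integral_eq_integral(2)[OF set_integrable_powr_exp[OF w, of 1]] by simp
    also have "\<dots> = Gamma (w + 1)"
      using Gamma_integral_real[of "w + 1"] w by (intro integral_unique) (simp add: exp_minus field_simps)
    finally show ?thesis .
  qed
  have "Gamma (w + 1) = \<bar>x\<bar> *\<^sub>R (LINT t|lborel. indicator {0..} (0 + x * t) *\<^sub>R ((0 + x * t) powr w * exp (- (0 + x * t))))"
    unfolding *[symmetric] set_lebesgue_integral_def
    using x by (intro lborel_integral_real_affine) auto
  also have "\<dots> = x * (LINT t|lborel. x powr w * (indicator {0..} t *\<^sub>R (t powr w * exp (- (x * t)))))"
  proof -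
    have "(LINT t|lborel. indicator {0..} (0 + x * t) *\<^sub>R ((0 + x * t) powr w * exp (- (0 + x * t))))
       = (LINT t|lborel. x powr w * (indicator {0..} t *\<^sub>R (t powr w * exp (- (x * t)))))"
      using x by (intro Bochner_Integration.integral_cong) (auto simp: indicator_def powr_mult zero_le_mult_iff)
    then show ?thesis using x by simp
  qed
  also have "\<dots> = x powr (w + 1) * (LINT t:{0..}|lborel. t powr w * exp (- (x * t)))"
    using x by (simp add: set_lebesgue_integral_def powr_add)
  finally show ?thesis using x by (simp add: field_simps)
qed

lemma set_integrable_powr_cexp:
  fixes w :: real and z :: complex
  assumes "w > -1" "Re z > 0"
  shows "set_integrable lborel {0..} (\<lambda>t. of_real (t powr w) * exp (- (z * of_real t)))"
  unfolding set_integrable_def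
proof (rule Bochner_Integration.integrable_bound[OF set_integrable_powr_exp[OF assms, unfolded set_integrable_def]])
  show "AE t in lborel. norm (indicator {0..} t *\<^sub>R (of_real (t powr w) * exp (- (z * complex_of_real t))))
       \<le> norm (indicator {0..} t *\<^sub>R (t powr w * exp (- (Re z * t))))"
    by (intro AE_I2) (auto simp: indicator_def norm_mult)
qed measurable

text \<open>Both sides are holomorphic on Re z > 0 and agree on the positive reals, where the
  formula is a rescaled Gamma integral; the identity theorem does the rest.\<close>

lemma laplace_powr:
  fixes w :: real and z :: complex
  assumes w: "w > -1" and z: "Re z > 0"
  shows "(LINT t:{0..}|lborel. of_real (t powr w) * exp (- (z * of_real t))) = of_real (Gamma (w + 1)) / z powr of_real (w + 1)"
proof -
  define F where "F z = (LINT t:{0..}|lborel. of_real (t powr w) * exp (- (z * complex_of_real t)))" for z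
  \<comment> \<open>Cutting off at both ends removes the possible singularity of t^w at 0 as well as
    the infinite range, so that the Leibniz rule makes each \<open>Fn n\<close> holomorphic.\<close>
  define I where "I n = {1 / real (Suc n)..real (Suc n)}" for n
  define Fn where "Fn n z = integral (cbox (1 / real (Suc n)) (real (Suc n))) (\<lambda>t. of_real (t powr w) * exp (- (z * complex_of_real t)))" for n z
  define S where "S = {z. Re z > 0}"
  have S: "open S" "convex S" unfolding S_def
    by (auto simp: open_halfspace_Re_gt convex_halfspace_Re_gt)
  have Fn_eq: "Fn n z = (LINT t:I n|lborel. of_real (t powr w) * exp (- (z * complex_of_real t)))" if "z \<in> S" for n z
  proof -
    have "set_integrable lborel (I n) (\<lambda>t. of_real (t powr w) * exp (- (z * complex_of_real t)))"
      by (rule set_integrable_subset[OF set_integrable_powr_cexp[OF w]]) (use that in \<open>auto simp: I_def S_def intro: order_trans[rotated]\<close>)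
    from set_borel_integral_eq_integral(2)[OF this] show ?thesis by (simp add: Fn_def I_def)
  qed
  have diff: "norm (F z - Fn n z) \<le> (LINT t|lborel. indicator ({0..} - I n) t * (t powr w * exp (- (r * t))))"
    if z: "z \<in> S" and r: "r > 0" "r \<le> Re z" for n z r
  proof -
    have sub: "I n \<subseteq> {0..}" by (auto simp: I_def intro: order_trans[rotated])
    have int: "integrable lborel (\<lambda>t. indicator {0..} t *\<^sub>R (of_real (t powr w) * exp (- (z * complex_of_real t))))"
      using set_integrable_powr_cexp[OF w] z by (auto simp: S_def set_integrable_def)
    have int': "integrable lborel (\<lambda>t. indicator (I n) t *\<^sub>R (of_real (t powr w) * exp (- (z * complex_of_real t))))"
      using set_integrable_subset[OF int[folded set_integrable_def], of "I n"] sub by (auto simp: set_integrable_def I_def)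
    have int2: "integrable lborel (\<lambda>t. indicator {0..} t *\<^sub>R (t powr w * exp (- (r * t))))"
      using set_integrable_powr_exp[OF w r(1)] by (auto simp: set_integrable_def)
    have int2': "integrable lborel (\<lambda>t. indicator (I n) t *\<^sub>R (t powr w * exp (- (r * t))))"
      using set_integrable_subset[OF int2[folded set_integrable_def], of "I n"] sub by (auto simp: set_integrable_def I_def)
    have "F z - Fn n z = (LINT t|lborel. indicator {0..} t *\<^sub>R (of_real (t powr w) * exp (- (z * complex_of_real t)))
        - indicator (I n) t *\<^sub>R (of_real (t powr w) * exp (- (z * complex_of_real t))))"
      unfolding Fn_eq[OF z] F_def set_lebesgue_integral_def
      by (rule Bochner_Integration.integral_diff[symmetric, OF int int'])
    also have "norm \<dots> \<le> (LINT t|lborel. norm (indicator {0..} t *\<^sub>R (of_real (t powr w) * exp (- (z * complex_of_real t)))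
        - indicator (I n) t *\<^sub>R (of_real (t powr w) * exp (- (z * complex_of_real t)))))"
      by (rule integral_norm_bound)
    also have "\<dots> \<le> (LINT t|lborel. indicator {0..} t *\<^sub>R (t powr w * exp (- (r * t))) - indicator (I n) t *\<^sub>R (t powr w * exp (- (r * t))))"
    proof (rule integral_mono)
      show "norm (indicator {0..} t *\<^sub>R (of_real (t powr w) * exp (- (z * complex_of_real t)))
        - indicator (I n) t *\<^sub>R (of_real (t powr w) * exp (- (z * complex_of_real t))))
        \<le> indicator {0..} t *\<^sub>R (t powr w * exp (- (r * t))) - indicator (I n) t *\<^sub>R (t powr w * exp (- (r * t)))" for t
        using sub r by (auto simp: indicator_def norm_mult intro!: mult_left_mono mult_right_mono)
      show "integrable lborel (\<lambda>t. norm (indicator {0..} t *\<^sub>R (of_real (t powr w) * exp (- (z * complex_of_real t)))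
        - indicator (I n) t *\<^sub>R (of_real (t powr w) * exp (- (z * complex_of_real t)))))"
        by (intro integrable_norm Bochner_Integration.integrable_diff int int')
      show "integrable lborel (\<lambda>t. indicator {0..} t *\<^sub>R (t powr w * exp (- (r * t))) - indicator (I n) t *\<^sub>R (t powr w * exp (- (r * t))))"
        by (intro Bochner_Integration.integrable_diff int2 int2')
    qed
    also have "\<dots> = (LINT t|lborel. indicator ({0..} - I n) t * (t powr w * exp (- (r * t))))"
      using sub by (intro Bochner_Integration.integral_cong) (auto simp: indicator_def)
    finally show ?thesis .
  qed
  have lim0: "(\<lambda>n. (LINT t|lborel. indicator ({0..} - I n) t * (t powr w * exp (- (r * t))))) \<longlonglongrightarrow> 0" if r: "r > 0" for r
  proof -
    have "(\<lambda>n. (LINT t|lborel. indicator ({0..} - I n) t * (t powr w * exp (- (r * t))))) \<longlonglongrightarrow> (LINT (t::real)|lborel. (0::real))"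
    proof (rule integral_dominated_convergence[where w = "\<lambda>t. indicator {0..} t *\<^sub>R (t powr w * exp (- (r * t)))"])
      show "integrable lborel (\<lambda>t. indicator {0..} t *\<^sub>R (t powr w * exp (- (r * t))))"
        using set_integrable_powr_exp[OF w r] by (simp add: set_integrable_def)
      show "AE t in lborel. (\<lambda>n. indicator ({0..} - I n) t * (t powr w * exp (- (r * t)))) \<longlonglongrightarrow> 0"
      proof (rule AE_I2, rule tendsto_eventually)
        fix t :: real
        show "\<forall>\<^sub>F n in sequentially. indicator ({0..} - I n) t * (t powr w * exp (- (r * t))) = 0"
        proof (cases "t > 0")
          case True
          have "(\<lambda>n. 1 / real (Suc n)) \<longlonglongrightarrow> 0" by (rule LIMSEQ_Suc[OF lim_const_over_n])
          then have "\<forall>\<^sub>F n in sequentially. 1 / real (Suc n) < t" using True by (rule order_tendstoD)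
          moreover have "\<forall>\<^sub>F n in sequentially. t \<le> real n"
            using filterlim_real_sequentially by (auto simp: filterlim_at_top)
          ultimately show ?thesis by eventually_elim (auto simp: I_def indicator_def)
        qed (auto simp: indicator_def)
      qed
      show "AE t in lborel. norm (indicator ({0..} - I n) t * (t powr w * exp (- (r * t)))) \<le> indicator {0..} t *\<^sub>R (t powr w * exp (- (r * t)))" for n
        by (intro AE_I2) (auto simp: indicator_def)
      show "(\<lambda>t. indicator ({0..} - I n) t * (t powr w * exp (- (r * t)))) \<in> borel_measurable lborel" for n
        unfolding I_def by measurable
    qed simp
    then show ?thesis by simp
  qed
  have holF: "F holomorphic_on S"
  proof (rule holomorphic_uniform_sequence[OF S(1)])
    show "Fn n holomorphic_on S" for n
      unfolding Fn_def
    proof (rule leibniz_rule_holomorphic[OF _ _ _ S(2)])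
      show "((\<lambda>z. of_real (t powr w) * exp (- (z * complex_of_real t))) has_field_derivative
          - of_real t * (of_real (t powr w) * exp (- (z * complex_of_real t)))) (at z within S)" for z t
        by (auto intro!: derivative_eq_intros)
      show "(\<lambda>t. of_real (t powr w) * exp (- (z * complex_of_real t))) integrable_on cbox (1 / real (Suc n)) (real (Suc n))" for z
        by (intro integrable_continuous continuous_intros) auto
      show "continuous_on (S \<times> cbox (1 / real (Suc n)) (real (Suc n)))
         (\<lambda>(z, t). - complex_of_real t * (of_real (t powr w) * exp (- (z * complex_of_real t))))"
        unfolding case_prod_beta by (intro continuous_intros) auto
    qed
    fix z0 assume z0: "z0 \<in> S"
    \<comment> \<open>Half of the real part keeps the closed ball inside Re z >= r, where a single
      tail integral bounds the difference of \<open>F\<close> and \<open>Fn n\<close>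
      uniformly.\<close>
    define r where "r = Re z0 / 2"
    have r: "r > 0" using z0 by (simp add: r_def S_def)
    have ge: "r \<le> Re z" if "z \<in> cball z0 r" for z
      using that abs_Re_le_cmod[of "z0 - z"] by (simp add: r_def dist_norm)
    have sub: "cball z0 r \<subseteq> S" using ge r by (force simp: S_def)
    have "uniform_limit (cball z0 r) Fn F sequentially"
    proof (rule uniform_limitI)
      fix e :: real assume "e > 0"
      with lim0[OF r] have "\<forall>\<^sub>F n in sequentially. (LINT t|lborel. indicator ({0..} - I n) t * (t powr w * exp (- (r * t)))) < e"
        by (rule order_tendstoD)
      then show "\<forall>\<^sub>F n in sequentially. \<forall>z\<in>cball z0 r. dist (Fn n z) (F z) < e"
      proof eventually_elim
        case (elim n)
        show ?case
        proof
          fix z assume "z \<in> cball z0 r"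
          then show "dist (Fn n z) (F z) < e"
            using diff[of z r n] ge[of z] sub r elim by (auto simp: dist_norm norm_minus_commute)
        qed
      qed
    qed
    then show "\<exists>d>0. cball z0 d \<subseteq> S \<and> uniform_limit (cball z0 d) Fn F sequentially"
      using r sub by blast
  qed
  define H where "H z = F z - of_real (Gamma (w + 1)) / z powr of_real (w + 1)" for z
  have "H holomorphic_on S"
    unfolding H_def
  proof (intro holomorphic_intros holF)
    show "z \<notin> \<real>\<^sub>\<le>\<^sub>0" if "z \<in> S" for z
      using that by (auto simp: S_def complex_nonpos_Reals_iff)
    show "z powr of_real (w + 1) \<noteq> 0" if "z \<in> S" for z
      using that by (auto simp: S_def)
  qed
  moreover have "of_real ` {0<..} \<subseteq> S" by (auto simp: S_def)
  moreover have "(1::complex) islimpt of_real ` {0<..}"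
  proof -
    have "(1::complex) islimpt of_real ` ({0<..} :: real set)"
    proof (rule islimpt_approachable[THEN iffD2], intro allI impI)
      fix e :: real assume e: "e > 0"
      have "complex_of_real (1 + e / 2) \<in> of_real ` {0<..}" using e by (intro imageI) auto
      moreover have "complex_of_real (1 + e / 2) - 1 = of_real (e / 2)" by simp
      then have "complex_of_real (1 + e / 2) \<noteq> 1 \<and> dist (complex_of_real (1 + e / 2)) 1 < e"
        using e unfolding dist_norm by (metis norm_of_real abs_of_pos half_gt_zero less_irrefl norm_zero right_minus_eq field_less_half_sum field_sum_of_halves less_add_same_cancel2)
      ultimately show "\<exists>x'\<in>complex_of_real ` {0<..}. x' \<noteq> 1 \<and> dist x' 1 < e" by blast
    qed
    then show ?thesis .
  qed
  moreover have "H x = 0" if "x \<in> of_real ` {0<..}" for x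
  proof -
    obtain y :: real where y: "x = of_real y" "y > 0" using \<open>x \<in> _\<close> by auto
    have "F x = (LINT t:{0..}|lborel. of_real (t powr w * exp (- (y * t))))"
      unfolding F_def y exp_neg_of_real by simp
    also have "\<dots> = of_real (Gamma (w + 1) / y powr (w + 1))"
      unfolding set_integral_complex_of_real laplace_powr_real[OF w y(2)] ..
    finally show ?thesis using y by (simp add: H_def powr_of_real flip: of_real_add)
  qed
  ultimately have "H z = 0"
    using z S(2) by (intro analytic_continuation[of H S "of_real ` {0<..}" 1 z] S convex_connected) (auto simp: S_def)
  then show ?thesis by (simp add: H_def F_def)
qed

section \<open>The Jackson kernel and the Fourier transform\<close>

definition fourier :: "(real \<Rightarrow> complex) \<Rightarrow> real \<Rightarrow> complex" where
  "fourier h \<tau> = (LINT t|lborel. h t * exp (- (\<i> * of_real (\<tau> * t))))"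

definition dirichlet :: "real \<Rightarrow> real \<Rightarrow> real" where
  "dirichlet b t = (if t = 0 then 2 * b else 2 * sin (b * t) / t)"

lemma dirichlet_measurable [measurable]: "dirichlet b \<in> borel_measurable borel"
  unfolding dirichlet_def by measurable

lemma abs_dirichlet_le:
  assumes "b > 0" shows "\<bar>dirichlet b t\<bar> \<le> 2 * b"
proof (cases "t = 0")
  case False
  have "\<bar>sin (b * t)\<bar> \<le> \<bar>b * t\<bar>" by (rule abs_sin_x_le_abs_x)
  then show ?thesis using False assms by (simp add: dirichlet_def abs_mult field_simps)
qed (use assms in \<open>simp add: dirichlet_def\<close>)

lemma integral_exp_dirichlet:
  assumes b: "b > 0"
  shows "(LINT \<tau>:{-b..b}|lborel. exp (\<i> * of_real (\<tau> * t))) = of_real (dirichlet b t)"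
proof -
  have si: "set_integrable lborel {-b..b} (\<lambda>\<tau>. exp (\<i> * of_real (\<tau> * t)))"
    by (rule set_integrable_bounded_Icc[where B = 1]) auto
  have "((\<lambda>\<tau>. exp (\<i> * of_real (\<tau> * t))) has_integral of_real (dirichlet b t)) {-b..b}"
  proof (cases "t = 0")
    case True
    then show ?thesis using has_integral_const_real[of "1::complex" "-b" b] b
      by (simp add: dirichlet_def scaleR_conv_of_real)
  next
    case False
    have "((\<lambda>\<tau>. exp (\<i> * of_real (\<tau> * t))) has_integral
        (exp (\<i> * of_real (b * t)) / (\<i> * t) - exp (\<i> * of_real (- b * t)) / (\<i> * t))) {-b..b}"
    proof (rule fundamental_theorem_of_calculus)
      show "((\<lambda>\<tau>. exp (\<i> * of_real (\<tau> * t)) / (\<i> * of_real t)) has_vector_derivative exp (\<i> * of_real (\<tau> * t))) (at \<tau> within {-b..b})" for \<tau>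
      proof -
        define c where "c = \<i> * complex_of_real t"
        have "((\<lambda>z. exp (z * c) / c) has_field_derivative exp (of_real \<tau> * c)) (at (of_real \<tau>))"
          using False by (auto intro!: derivative_eq_intros simp: c_def)
        from has_vector_derivative_at_within[OF has_vector_derivative_real_field[OF this]]
        have "((\<lambda>x. exp (of_real x * c) / c) has_vector_derivative exp (of_real \<tau> * c)) (at \<tau> within {-b..b})" .
        moreover have "exp (\<i> * of_real (x * t)) = exp (of_real x * c)" for x
          by (simp add: c_def mult_ac)
        ultimately show ?thesis
          unfolding c_def by simp
      qed
    qed (use b in auto)
    also have "exp (\<i> * of_real (b * t)) / (\<i> * t) - exp (\<i> * of_real (- b * t)) / (\<i> * t) = of_real (dirichlet b t)"
    proof -
      have "cis (b * t) - cis (- b * t) = \<i> * of_real (2 * sin (b * t))"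
        by (simp add: complex_eq_iff)
      then have "(cis (b * t) - cis (- b * t)) / (\<i> * of_real t) = of_real (dirichlet b t)"
        using False by (simp add: dirichlet_def)
      then show ?thesis by (simp only: cis_conv_exp diff_divide_distrib)
    qed
    finally show ?thesis .
  qed
  then show ?thesis
    using set_borel_integral_eq_integral(2)[OF si] by (simp add: integral_unique)
qed

context
  fixes h :: "real \<Rightarrow> complex"
  assumes h: "integrable lborel h"
begin

lemma integrand_measurable: "h \<in> borel_measurable borel"
  using borel_measurable_integrable[OF h] by simp

lemma fourier_measurable: "fourier h \<in> borel_measurable borel"
proof -
  note [measurable] = integrand_measurable
  show ?thesis unfolding fourier_def[abs_def] by measurable
qed

lemma norm_fourier_le: "norm (fourier h \<tau>) \<le> (LINT t|lborel. norm (h t))"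
  unfolding fourier_def
  by (rule order_trans[OF integral_norm_bound]) (simp add: norm_mult)

lemma set_integrable_fourier: "set_integrable lborel {a..b} (\<lambda>\<tau>. norm (fourier h \<tau>))"
  by (rule set_integrable_bounded_Icc)
     (use fourier_measurable norm_fourier_le in \<open>auto intro: measurable_compose\<close>)

text \<open>Writing the Dirichlet kernel as an integral of exponentials over [-b, b] and exchanging
  the integrals turns the average into a Fourier inversion integral truncated to that band.\<close>

lemma integral_dirichlet_le:
  assumes b: "b > 0"
  shows "norm (LINT t|lborel. h t * of_real (dirichlet b (v - t))) \<le> (LINT \<tau>:{-b..b}|lborel. norm (fourier h \<tau>))"
proof -
  note [measurable] = integrand_measurable fourier_measurable
  define f where "f t \<tau> = h t * (indicator {-b..b} \<tau> *\<^sub>R exp (\<i> * of_real (\<tau> * (v - t))))" for t \<tau>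
  have bound: "set_integrable lborel {-b..b} (\<lambda>\<tau>. exp (\<i> * of_real (\<tau> * s)))" for s
    by (rule set_integrable_bounded_Icc[where B = 1]) auto
  have "integrable (lborel \<Otimes>\<^sub>M lborel) (case_prod f)"
  proof (rule lborel_pair.Fubini_integrable)
    show "case_prod f \<in> borel_measurable (lborel \<Otimes>\<^sub>M lborel)"
      unfolding f_def by measurable
    have "(LINT \<tau>|lborel. norm (case_prod f (t, \<tau>))) = (2 * b) * norm (h t)" for t
    proof -
      have "(LINT \<tau>|lborel. norm (case_prod f (t, \<tau>))) = (LINT \<tau>|lborel. norm (h t) * indicator {-b..b} \<tau>)"
        by (intro Bochner_Integration.integral_cong) (auto simp: f_def norm_mult indicator_def)
      then show ?thesis using b by simp
    qed
    then show "integrable lborel (\<lambda>t. LINT \<tau>|lborel. norm (case_prod f (t, \<tau>)))"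
      using h by simp
    show "AE t in lborel. integrable lborel (\<lambda>\<tau>. case_prod f (t, \<tau>))"
      unfolding f_def case_prod_conv
      by (intro AE_I2 integrable_mult_right bound[unfolded set_integrable_def])
  qed
  from lborel_pair.Fubini_integral[OF this]
  have "(LINT \<tau>|lborel. LINT t|lborel. f t \<tau>) = (LINT t|lborel. LINT \<tau>|lborel. f t \<tau>)" .
  also have "\<dots> = (LINT t|lborel. h t * of_real (dirichlet b (v - t)))"
    unfolding f_def integral_exp_dirichlet[OF b, symmetric] set_lebesgue_integral_def
      integral_mult_right_zero ..
  also have "(LINT \<tau>|lborel. LINT t|lborel. f t \<tau>) = (LINT \<tau>|lborel. indicator {-b..b} \<tau> *\<^sub>R (exp (\<i> * of_real (\<tau> * v)) * fourier h \<tau>))"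
  proof (rule Bochner_Integration.integral_cong[OF refl])
    fix \<tau>
    have "f t \<tau> = (indicator {-b..b} \<tau> * exp (\<i> * of_real (\<tau> * v))) * (h t * exp (- (\<i> * of_real (\<tau> * t))))" for t
      by (simp add: f_def right_diff_distrib exp_diff exp_minus divide_inverse indicator_def)
    then show "(LINT t|lborel. f t \<tau>) = indicator {-b..b} \<tau> *\<^sub>R (exp (\<i> * of_real (\<tau> * v)) * fourier h \<tau>)"
      by (simp add: fourier_def indicator_def)
  qed
  finally have "norm (LINT t|lborel. h t * of_real (dirichlet b (v - t)))
     = norm (LINT \<tau>|lborel. indicator {-b..b} \<tau> *\<^sub>R (exp (\<i> * of_real (\<tau> * v)) * fourier h \<tau>))"
    by simp
  also have "\<dots> \<le> (LINT \<tau>|lborel. norm (indicator {-b..b} \<tau> *\<^sub>R (exp (\<i> * of_real (\<tau> * v)) * fourier h \<tau>)))"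
    by (rule integral_norm_bound)
  also have "\<dots> = (LINT \<tau>:{-b..b}|lborel. norm (fourier h \<tau>))"
    unfolding set_lebesgue_integral_def
    by (intro Bochner_Integration.integral_cong) (auto simp: norm_mult indicator_def)
  finally show ?thesis .
qed

lemma integrable_mult_dirichlet:
  assumes "b > 0"
  shows "integrable lborel (\<lambda>t. h t * of_real (dirichlet b (v - t)))"
proof (rule Bochner_Integration.integrable_bound)
  show "integrable lborel (\<lambda>t. of_real (2 * b) * h t)" using h by simp
  show "AE t in lborel. norm (h t * of_real (dirichlet b (v - t))) \<le> norm (of_real (2 * b) * h t)"
    using abs_dirichlet_le[OF assms] assms
    by (intro AE_I2) (simp add: norm_mult mult.commute[of "norm (h _)"] mult_right_mono)
qed (use integrand_measurable in measurable)

end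

text \<open>Each factor convolves the Fourier transform with the indicator of \<open>[-b, b]\<close>, so it widens the
  relevant band by \<open>b\<close>. Bounding the convolution by the integral over the wider band avoids a
  second use of Fubini and costs only the factor \<open>fact k\<close>.\<close>

lemma integral_dirichlet_power_le:
  assumes b: "b > 0" and h: "integrable lborel h"
  shows "norm (LINT t|lborel. h t * of_real (dirichlet b (v - t) ^ Suc k))
    \<le> fact k * (2 * b) ^ k * (LINT \<tau>:{-(real (Suc k) * b)..real (Suc k) * b}|lborel. norm (fourier h \<tau>))"
  using h
proof (induction k arbitrary: h)
  case 0
  then show ?case using integral_dirichlet_le[OF 0 b, of v] by simp
next
  case (Suc k h)
  define h' where "h' t = h t * of_real (dirichlet b (v - t))" for t
  define c where "c = real (Suc k) * b"
  define Y where "Y = (LINT \<tau>:{-(c + b)..c + b}|lborel. norm (fourier h \<tau>))"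
  have c: "c > 0" using b by (simp add: c_def)
  have h': "integrable lborel h'"
    unfolding h'_def by (rule integrable_mult_dirichlet[OF Suc.prems b])
  have *: "norm (fourier h' \<tau>) \<le> Y" if \<tau>: "\<tau> \<in> {-c..c}" for \<tau>
  proof -
    \<comment> \<open>Multiplication by e^(-i tau t) translates the transform by tau; for |tau| <= c
      the translated band [-b, b] lies in [-(c + b), c + b].\<close>
    define g where "g t = h t * exp (- (\<i> * of_real (\<tau> * t)))" for t
    have hm: "h \<in> borel_measurable borel" by (rule integrand_measurable[OF Suc.prems])
    have g: "integrable lborel g"
      unfolding g_def
      by (rule Bochner_Integration.integrable_bound[OF Suc.prems]) (use hm in \<open>auto simp: norm_mult\<close>)
    have "fourier h' \<tau> = (LINT t|lborel. g t * of_real (dirichlet b (v - t)))"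
      by (simp add: fourier_def h'_def g_def mult_ac)
    also have "norm \<dots> \<le> (LINT x:{-b..b}|lborel. norm (fourier g x))"
      by (rule integral_dirichlet_le[OF g b])
    also have "\<dots> = (LINT x|lborel. indicator {-b..b} x * norm (fourier h (\<tau> + 1 * x)))"
    proof -
      have "fourier g x = fourier h (\<tau> + 1 * x)" for x
        unfolding fourier_def g_def
        by (intro Bochner_Integration.integral_cong) (simp_all add: mult.assoc algebra_simps flip: exp_add)
      then show ?thesis by (simp add: set_lebesgue_integral_def)
    qed
    also have "\<dots> \<le> (LINT x|lborel. indicator {-(c + b)..c + b} (\<tau> + 1 * x) *\<^sub>R norm (fourier h (\<tau> + 1 * x)))"
    proof (rule integral_mono_AE')
      show "integrable lborel (\<lambda>x. indicator {-(c + b)..c + b} (\<tau> + 1 * x) *\<^sub>R norm (fourier h (\<tau> + 1 * x)))"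
        by (rule lborel_integrable_real_affine[OF set_integrable_fourier[OF Suc.prems, of "-(c + b)" "c + b", unfolded set_integrable_def]]) simp
    qed (use \<tau> in \<open>auto simp: indicator_def\<close>)
    also have "\<dots> = Y"
      unfolding Y_def set_lebesgue_integral_def
      using lborel_integral_real_affine[of 1 "\<lambda>x. indicator {-(c + b)..c + b} x *\<^sub>R norm (fourier h x)" \<tau>]
      by (simp only: abs_one scaleR_one zero_neq_one not_False_eq_True simp_thms)
    finally show ?thesis .
  qed
  have Y0: "Y \<ge> 0" unfolding Y_def set_lebesgue_integral_def by (intro Bochner_Integration.integral_nonneg) auto
  have "(LINT \<tau>:{-c..c}|lborel. norm (fourier h' \<tau>)) \<le> (LINT \<tau>:{-c..c}|lborel. Y)"
    using * set_integrable_fourier[OF h']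
    by (intro set_integral_mono) (auto simp: set_integrable_def emeasure_lborel_Icc_eq)
  also have "\<dots> = 2 * c * Y" using c by (simp add: set_lebesgue_integral_def)
  finally have 1: "(LINT \<tau>:{-c..c}|lborel. norm (fourier h' \<tau>)) \<le> 2 * c * Y" .
  have "norm (LINT t|lborel. h t * of_real (dirichlet b (v - t) ^ Suc (Suc k)))
     = norm (LINT t|lborel. h' t * of_real (dirichlet b (v - t) ^ Suc k))"
    by (simp add: h'_def mult_ac)
  also have "\<dots> \<le> fact k * (2 * b) ^ k * (LINT \<tau>:{-c..c}|lborel. norm (fourier h' \<tau>))"
    using Suc.IH[OF h'] by (simp add: c_def)
  also have "\<dots> \<le> fact k * (2 * b) ^ k * (2 * c * Y)"
    using 1 b by (intro mult_left_mono) auto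
  also have "\<dots> = fact (Suc k) * (2 * b) ^ Suc k * Y"
    by (simp add: c_def algebra_simps)
  also have "Y = (LINT \<tau>:{-(real (Suc (Suc k)) * b)..real (Suc (Suc k)) * b}|lborel. norm (fourier h \<tau>))"
    unfolding Y_def c_def by (simp add: algebra_simps)
  finally show ?case .
qed

text \<open>The fourth is the smallest even power of sin s / s that is integrable against 1 + |s|;
  the value at 0 is the continuous extension.\<close>

definition jackson :: "real \<Rightarrow> real" where
  "jackson s = (if s = 0 then 1 else (sin s / s) ^ 4)"

lemma jackson_measurable [measurable]: "jackson \<in> borel_measurable borel"
  unfolding jackson_def by measurable

lemma jackson_nonneg: "0 \<le> jackson s"
  by (simp add: jackson_def)

lemma jackson_le_1: "jackson s \<le> 1"
proof (cases "s = 0")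
  case False
  have "\<bar>sin s\<bar> \<le> \<bar>s\<bar>" by (rule abs_sin_x_le_abs_x)
  then have "\<bar>sin s / s\<bar> \<le> 1" using False by simp
  then have "\<bar>sin s / s\<bar> ^ 4 \<le> 1 ^ 4" by (intro power_mono) auto
  moreover have "even (4::nat)" by simp
  ultimately have "(sin s / s) ^ 4 \<le> 1" by (simp only: power_even_abs power_one)
  then show ?thesis using False by (simp add: jackson_def)
qed (simp add: jackson_def)

lemma jackson_le: "jackson s \<le> 1 / s ^ 4" if "s \<noteq> 0"
proof -
  have "\<bar>sin s\<bar> ^ 4 \<le> 1 ^ 4" by (intro power_mono) auto
  then show ?thesis using that by (simp add: jackson_def power_divide divide_right_mono)
qed

lemma sin_ge_cubic: "sin x \<ge> x - x ^ 3 / 6" if "x \<ge> 0" for x :: real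
proof -
  have 1: "1 - y ^ 2 / 2 \<le> cos y" for y :: real
    using cos_double[of "y / 2"] sin_squared_eq[of "y/2"] abs_sin_x_le_abs_x[of "y / 2"]
      power_mono[of "\<bar>sin (y / 2)\<bar>" "\<bar>y / 2\<bar>" 2]
    by (simp add: power_divide cos_double_sin)
  have "(\<lambda>x. sin x - (x - x ^ 3 / 6)) 0 \<le> (\<lambda>x. sin x - (x - x ^ 3 / 6)) x"
  proof (rule DERIV_nonneg_imp_nondecreasing[OF that])
    fix y :: real assume "0 \<le> y"
    have "((\<lambda>x. sin x - (x - x ^ 3 / 6)) has_real_derivative (cos y - (1 - y ^ 2 / 2))) (at y)"
      by (auto intro!: derivative_eq_intros simp: power2_eq_square)
    then show "\<exists>d. ((\<lambda>x. sin x - (x - x ^ 3 / 6)) has_real_derivative d) (at y) \<and> 0 \<le> d"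
      using 1[of y] by (intro exI[of _ "cos y - (1 - y\<^sup>2 / 2)"]) auto
  qed
  then show ?thesis by simp
qed

text \<open>The constant is 5/6 = 1 - 1/6: by \<open>sin_ge_cubic\<close> and x^3 <= x, sin x >=
  5x/6 for 0 < x <= 1.\<close>

lemma jackson_ge: "jackson s \<ge> (5 / 6) ^ 4" if "\<bar>s\<bar> \<le> 1"
proof (cases "s = 0")
  case False
  have *: "5 / 6 \<le> sin x / x" if "0 < x" "x \<le> 1" for x :: real
  proof -
    have "x ^ 3 \<le> x" using that power_decreasing[of 1 3 x] by simp
    then show ?thesis using sin_ge_cubic[of x] that by (simp add: field_simps)
  qed
  have "5 / 6 \<le> sin s / s"
    using *[of s] *[of "- s"] False that by (cases "s > 0") auto
  then have "(5 / 6) ^ 4 \<le> (sin s / s) ^ 4" by (intro power_mono) auto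
  then show ?thesis using False by (simp add: jackson_def)
qed (simp add: jackson_def power_divide)

lemma dirichlet_power4: "b > 0 \<Longrightarrow> dirichlet b t ^ 4 = 16 * b ^ 4 * jackson (b * t)"
  by (simp add: dirichlet_def jackson_def power_divide power_mult_distrib)

text \<open>This is the case k = 3 of the power bound: 3! (2b)^3 = 48 b^3, divided by the factor 16
  b^4 of \<open>dirichlet_power4\<close>, leaves 3/b, and the four factors occupy the band of
  half-width 4b.\<close>

lemma integral_jackson_le:
  fixes h :: "real \<Rightarrow> real"
  assumes b: "b > 0" and h: "integrable lborel h"
  shows "\<bar>LINT t|lborel. h t * jackson (b * (v - t))\<bar>
    \<le> 3 / b * (LINT \<tau>:{-(4 * b)..4 * b}|lborel. norm (fourier (\<lambda>t. of_real (h t)) \<tau>))"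
proof -
  let ?Y = "LINT \<tau>:{-(4 * b)..4 * b}|lborel. norm (fourier (\<lambda>t. of_real (h t)) \<tau>)"
  have "norm (LINT t|lborel. of_real (h t) * complex_of_real (dirichlet b (v - t) ^ Suc 3)) \<le> fact 3 * (2 * b) ^ 3 * ?Y"
    using integral_dirichlet_power_le[OF b, of "\<lambda>t. of_real (h t)" v 3] h by simp
  also have "(LINT t|lborel. of_real (h t) * complex_of_real (dirichlet b (v - t) ^ Suc 3))
     = (LINT t|lborel. of_real (16 * b ^ 4 * (h t * jackson (b * (v - t)))))"
    using b by (intro Bochner_Integration.integral_cong) (simp_all add: dirichlet_power4 mult_ac del: of_real_power)
  also have "norm \<dots> = 16 * b ^ 4 * \<bar>LINT t|lborel. h t * jackson (b * (v - t))\<bar>"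
    unfolding integral_complex_of_real norm_of_real integral_mult_right_zero abs_mult by simp
  finally have "16 * b ^ 4 * \<bar>LINT t|lborel. h t * jackson (b * (v - t))\<bar> \<le> 48 * b ^ 3 * ?Y"
    by (simp add: fact_numeral)
  then have "(16 * b ^ 3) * (b * \<bar>LINT t|lborel. h t * jackson (b * (v - t))\<bar>) \<le> (16 * b ^ 3) * (3 * ?Y)"
    by (simp add: power_numeral_reduce algebra_simps)
  then have "b * \<bar>LINT t|lborel. h t * jackson (b * (v - t))\<bar> \<le> 3 * ?Y"
    using b by (simp only: mult_le_cancel_left_pos zero_less_mult_iff zero_less_power zero_less_numeral simp_thms)
  then show ?thesis using b by (simp add: field_simps)
qed

section \<open>Local Tauberian estimates\<close>

text \<open>A majorant of (1 + |s|) \<open>jackson s\<close> outside a window of radius r, chosen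
  because its integral is explicit. It vanishes inside, where the window itself is
  estimated.\<close>

definition kernel_tail :: "real \<Rightarrow> real \<Rightarrow> real" where
  "kernel_tail r s = (if r \<le> \<bar>s\<bar> then (1 + \<bar>s\<bar>) / s ^ 4 else 0)"

lemma kernel_tail_integral:
  assumes r: "r > 0"
  shows "integrable lborel (kernel_tail r)"
    and "(LINT s|lborel. kernel_tail r s) = 2 / (3 * r ^ 3) + 1 / r ^ 2"
proof -
  define f where "f s = 1 / s ^ 4 + 1 / s ^ 3" for s :: real
  define g where "g s = indicator {r..} s *\<^sub>R f s" for s :: real
  have hi: "(f has_integral 1 / (3 * r ^ 3) + 1 / (2 * r ^ 2)) {r..}"
    unfolding f_def
    using has_integral_add[OF has_integral_inverse_power_to_inf[of 4 r] has_integral_inverse_power_to_inf[of 3 r]] r by simp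
  then have "f absolutely_integrable_on {r..}"
    using r by (intro nonnegative_absolutely_integrable_1) (auto simp: integrable_on_def f_def)
  then have si: "set_integrable lborel {r..} f"
    by (rule set_integrable_lborelI) (auto simp: f_def[abs_def])
  then have g: "integrable lborel g" by (simp add: g_def[abs_def] set_integrable_def)
  have gval: "(LINT s|lborel. g s) = 1 / (3 * r ^ 3) + 1 / (2 * r ^ 2)"
    using set_borel_integral_eq_integral(2)[OF si] hi
    by (simp add: g_def set_lebesgue_integral_def integral_unique)
  have eq: "kernel_tail r s = g s + g (0 + (-1) * s)" for s
  proof (cases "s = 0")
    case False
    then show ?thesis using r
      by (auto simp: kernel_tail_def g_def f_def indicator_def field_simps power_numeral_reduce)
  qed (use r in \<open>auto simp: kernel_tail_def g_def f_def indicator_def\<close>)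
  have g': "integrable lborel (\<lambda>s. g (0 + (-1) * s))"
    by (rule lborel_integrable_real_affine[OF g]) simp
  have g'val: "(LINT s|lborel. g (0 + (-1) * s)) = 1 / (3 * r ^ 3) + 1 / (2 * r ^ 2)"
    using lborel_integral_real_affine[of "-1" g 0] gval by simp
  show "integrable lborel (kernel_tail r)"
    unfolding eq[abs_def] by (rule Bochner_Integration.integrable_add[OF g g'])
  show "(LINT s|lborel. kernel_tail r s) = 2 / (3 * r ^ 3) + 1 / r ^ 2"
    unfolding eq Bochner_Integration.integral_add[OF g g'] gval g'val by simp
qed

text \<open>As the kernel is nonnegative, h may be replaced by its lower bounds. In the variable s =
  b (v - t) the integrand is then at least (5/6)^4 a for |s| <= 1, nonnegative up to r, and at least
  -N \<open>kernel_tail r s\<close> beyond. The factor 9/10 is a lower bound for 2 (5/6)^4. For a <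
  0 the right-hand side is nonnegative and nothing has to be shown.\<close>

lemma jackson_window_bound:
  fixes h :: "real \<Rightarrow> real"
  assumes b: "b > 0" and r: "r \<ge> 1" and h: "integrable lborel h" and N: "N \<ge> 0" and e: "e \<ge> 0"
    and int: "(LINT t|lborel. h t * jackson (b * (v - t))) \<le> e / b"
    and inside: "\<And>t. \<bar>t - v\<bar> \<le> r / b \<Longrightarrow> h t \<ge> a"
    and outside: "\<And>t. \<bar>t - v\<bar> > r / b \<Longrightarrow> h t \<ge> - N * (1 + b * \<bar>t - v\<bar>)"
  shows "9 / 10 * a \<le> e + N * (2 / (3 * r ^ 3) + 1 / r ^ 2)"
proof (cases "a \<ge> 0")
  case True
  define f where "f s = a * (5 / 6) ^ 4 * indicator {-1..1} s - N * kernel_tail r s" for s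
  have r0: "r > 0" using r by simp
  note kt = kernel_tail_integral[OF r0]
  have f: "integrable lborel f"
    unfolding f_def by (intro Bochner_Integration.integrable_diff integrable_mult_right kt) simp
  have fval: "(LINT s|lborel. f s) = a * (5 / 6) ^ 4 * 2 - N * (2 / (3 * r ^ 3) + 1 / r ^ 2)"
    unfolding f_def using kt by (subst Bochner_Integration.integral_diff) auto
  have fb: "integrable lborel (\<lambda>t. f (b * v + (- b) * t))"
    using b by (intro lborel_integrable_real_affine[OF f]) simp
  have fbval: "(LINT s|lborel. f s) = b * (LINT t|lborel. f (b * v + (- b) * t))"
    using lborel_integral_real_affine[of "- b" f "b * v"] b by simp
  have hj: "integrable lborel (\<lambda>t. h t * jackson (b * (v - t)))"
  proof (rule Bochner_Integration.integrable_bound[OF h])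
    show "AE t in lborel. norm (h t * jackson (b * (v - t))) \<le> norm (h t)"
      by (intro AE_I2) (simp add: abs_mult jackson_nonneg jackson_le_1 mult_left_le)
  qed (use borel_measurable_integrable[OF h] in measurable)
  have "(LINT t|lborel. f (b * v + (- b) * t)) \<le> (LINT t|lborel. h t * jackson (b * (v - t)))"
  proof (rule integral_mono[OF fb hj])
    fix t
    define s where "s = b * v + (- b) * t"
    have s: "b * (v - t) = s" by (simp add: s_def algebra_simps)
    have abs_s: "\<bar>s\<bar> = b * \<bar>t - v\<bar>"
      using b by (simp add: s[symmetric] abs_mult abs_minus_commute)
    have in_iff: "\<bar>t - v\<bar> \<le> r / b \<longleftrightarrow> \<bar>s\<bar> \<le> r" using b by (simp add: abs_s field_simps)
    have j: "0 \<le> jackson s" by (rule jackson_nonneg)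
    show "f (b * v + (- b) * t) \<le> h t * jackson (b * (v - t))"
    proof (cases "\<bar>s\<bar> \<le> r")
      case inr: True
      have "f s \<le> a * (5 / 6) ^ 4 * indicator {-1..1} s"
        using N r by (simp add: f_def kernel_tail_def)
      also have "\<dots> \<le> a * jackson s"
        using True jackson_ge[of s] j by (auto simp: indicator_def intro!: mult_left_mono)
      also have "\<dots> \<le> h t * jackson s" using inside[of t] in_iff inr j by (intro mult_right_mono) auto
      finally show ?thesis by (simp add: s s_def)
    next
      case False
      then have s0: "s \<noteq> 0" using r by auto
      have "f s = - (N * (1 + \<bar>s\<bar>) * (1 / s ^ 4))" using False r by (auto simp: f_def kernel_tail_def indicator_def)
      also have "\<dots> \<le> - (N * (1 + \<bar>s\<bar>) * jackson s)"
        using N jackson_le[OF s0] by (intro le_imp_neg_le mult_left_mono) auto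
      also have "\<dots> = (- N * (1 + b * \<bar>t - v\<bar>)) * jackson s" by (simp add: abs_s)
      also have "\<dots> \<le> h t * jackson s"
        using outside[of t] in_iff False j by (intro mult_right_mono) auto
      finally show ?thesis by (simp add: s s_def)
    qed
  qed
  also note int
  finally have "b * (LINT t|lborel. f (b * v + (- b) * t)) \<le> e" using b by (simp add: field_simps)
  then have "a * (5 / 6) ^ 4 * 2 - N * (2 / (3 * r ^ 3) + 1 / r ^ 2) \<le> e"
    using fbval fval by simp
  moreover have "9 / 10 * a \<le> a * (5 / 6) ^ 4 * 2" using True by (simp add: power_divide)
  ultimately show ?thesis by linarith
next
  case False
  have "0 \<le> N * (2 / (3 * r ^ 3) + 1 / r ^ 2)" using N r by (intro mult_nonneg_nonneg add_nonneg_nonneg) auto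
  then show ?thesis using False e by linarith
qed

text \<open>Comparing \<open>\<bar>h\<bar>\<close> with \<open>\<psi>\<close>, which grows linearly away from \<open>u\<close>, makes the inequality for
  \<open>M = sup \<bar>h\<bar> / \<psi>\<close> self-improving: the kernel has a finite first moment, so the part of the integral
  outside the window contributes at most \<open>M / 2\<close>. The one-sided conditions \<open>up\<close> and \<open>down\<close> force
  windows that start, respectively end, at \<open>y\<close> instead of being centred there.\<close>

lemma tauberian_local:
  fixes h :: "real \<Rightarrow> real"
  assumes b: "b > 0" and h: "integrable lborel h" and bdd: "\<And>t. \<bar>h t\<bar> \<le> X"
    and int: "\<And>v. \<bar>LINT t|lborel. h t * jackson (b * (v - t))\<bar> \<le> e / b"
    and u: "u > 0" and E: "E \<ge> 0"
    and up: "\<And>y t. \<bar>y - u\<bar> \<le> u / 4 \<Longrightarrow> y \<le> t \<Longrightarrow> t \<le> y + 4 / b \<Longrightarrow> h t \<ge> h y - E"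
    and down: "\<And>y t. \<bar>y - u\<bar> \<le> u / 4 \<Longrightarrow> t \<le> y \<Longrightarrow> y - 4 / b \<le> t \<Longrightarrow> h t \<le> h y + E"
  shows "\<bar>h u\<bar> \<le> 8 * X / (b * u) + 2 * E + 4 * e"
proof -
  \<comment> \<open>The slope b/2 is tuned to the windows: their centres v lie at distance 2/b from
    y, outside them |t - y| <= 2 |t - v|, and therefore psi(t) <= psi(y) (1 + b |t - v|), which is
    the growth that \<open>jackson_window_bound\<close> allows.\<close>
  define \<psi> where "\<psi> t = 1 + b * \<bar>t - u\<bar> / 2" for t
  define M where "M = (SUP t. \<bar>h t\<bar> / \<psi> t)"
  have \<psi>1: "\<psi> t \<ge> 1" for t using b by (simp add: \<psi>_def)
  have \<psi>0: "\<psi> t > 0" for t by (rule less_le_trans[OF zero_less_one \<psi>1])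
  have X0: "X \<ge> 0" using bdd[of 0] by linarith
  have e0: "e \<ge> 0"
    using int[of 0] b by (meson abs_ge_zero order_trans zero_le_divide_iff not_le)
  have bddM: "bdd_above (range (\<lambda>t. \<bar>h t\<bar> / \<psi> t))"
  proof (rule bdd_aboveI)
    fix x assume "x \<in> range (\<lambda>t. \<bar>h t\<bar> / \<psi> t)"
    then obtain t where t: "x = \<bar>h t\<bar> / \<psi> t" by auto
    have "\<bar>h t\<bar> / \<psi> t \<le> \<bar>h t\<bar> / 1" using \<psi>1[of t] \<psi>0[of t] by (intro divide_left_mono) auto
    then show "x \<le> X" using bdd[of t] t by simp
  qed
  have Mup: "\<bar>h t\<bar> \<le> M * \<psi> t" for t
  proof -
    have "\<bar>h t\<bar> / \<psi> t \<le> M" unfolding M_def by (rule cSUP_upper[OF UNIV_I bddM])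
    then show ?thesis using \<psi>0[of t] by (simp add: field_simps)
  qed
  have M0: "M \<ge> 0" using Mup[of u] abs_ge_zero[of "h u"] by (simp add: \<psi>_def)
  have \<psi>_shift: "\<psi> t \<le> \<psi> y * (1 + b * \<bar>t - v\<bar>)"
    if v: "\<bar>v - y\<bar> = 2 / b" and t: "\<bar>t - v\<bar> > 2 / b" for t y v
  proof -
    have "\<bar>t - y\<bar> \<le> \<bar>t - v\<bar> + \<bar>v - y\<bar>" by linarith
    then have "\<bar>t - y\<bar> \<le> 2 * \<bar>t - v\<bar>" using v t by simp
    then have "b * \<bar>t - y\<bar> / 2 \<le> b * \<bar>t - v\<bar>" using b by simp
    moreover have "\<psi> t \<le> \<psi> y * (1 + b * \<bar>t - y\<bar> / 2)"
    proof -
      have "\<bar>t - u\<bar> \<le> \<bar>y - u\<bar> + \<bar>t - y\<bar>" by linarith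
      then have "b * \<bar>t - u\<bar> \<le> b * (\<bar>y - u\<bar> + \<bar>t - y\<bar>)" using b by (intro mult_left_mono) auto
      moreover have "0 \<le> (b * \<bar>y - u\<bar> / 2) * (b * \<bar>t - y\<bar> / 2)" using b by simp
      ultimately show ?thesis by (simp add: \<psi>_def algebra_simps)
    qed
    moreover have "\<psi> y * (1 + b * \<bar>t - y\<bar> / 2) \<le> \<psi> y * (1 + b * \<bar>t - v\<bar>)"
      using \<psi>0[of y] calculation(1) by (intro mult_left_mono) auto
    ultimately show ?thesis by linarith
  qed
  have near: "\<bar>h y\<bar> \<le> (E + 2 * e + M / 2) * \<psi> y" if y: "\<bar>y - u\<bar> \<le> u / 4" for y
  proof -
    have N: "M * \<psi> y \<ge> 0" using M0 \<psi>0[of y] by simp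
    \<comment> \<open>Radius 2 in units of 1/b makes the tail equal to 1/3; after division by 9/10
      the factor of M is 10/27, below 1/2.\<close>
    have num: "2 / (3 * 2 ^ 3) + 1 / 2 ^ 2 = (1 / 3 :: real)" by simp
    have out: "\<bar>h t\<bar> \<le> M * \<psi> y * (1 + b * \<bar>t - v\<bar>)"
      if "\<bar>v - y\<bar> = 2 / b" "\<bar>t - v\<bar> > 2 / b" for t v
      using Mup[of t] mult_left_mono[OF \<psi>_shift[OF that] M0] by (simp add: mult.assoc)
    have win: "\<bar>t - v\<bar> \<le> 2 / b \<Longrightarrow> v - 2 / b \<le> t \<and> t \<le> v - 2 / b + 4 / b" for t v
    proof -
      assume "\<bar>t - v\<bar> \<le> 2 / b"
      moreover have "4 / b = 2 / b + 2 / b" by simp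
      ultimately show ?thesis by (auto simp: abs_le_iff)
    qed
    have half: "4 / b = 2 / b + 2 / b" by simp
    have b2: "\<bar>2 / b\<bar> = 2 / b" using b by simp
    have 1: "9 / 10 * (h y - E) \<le> e + (M * \<psi> y) * (2 / (3 * 2 ^ 3) + 1 / 2 ^ 2)"
    proof (rule jackson_window_bound[OF b _ h N e0, where v = "y + 2 / b"])
      show "(LINT t|lborel. h t * jackson (b * (y + 2 / b - t))) \<le> e / b"
        using int[of "y + 2 / b"] by (rule abs_le_D1)
      show "h y - E \<le> h t" if "\<bar>t - (y + 2 / b)\<bar> \<le> 2 / b" for t
        using up[OF y, of t] win[OF that] by simp
      show "- (M * \<psi> y) * (1 + b * \<bar>t - (y + 2 / b)\<bar>) \<le> h t" if "\<bar>t - (y + 2 / b)\<bar> > 2 / b" for t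
      proof -
        have "\<bar>y + 2 / b - y\<bar> = 2 / b" using b2 by simp
        from out[OF this that] show ?thesis unfolding mult_minus_left by (simp add: abs_le_iff)
      qed
    qed simp
    have 2: "9 / 10 * (- h y - E) \<le> e + (M * \<psi> y) * (2 / (3 * 2 ^ 3) + 1 / 2 ^ 2)"
    proof (rule jackson_window_bound[OF b _ _ N e0, where v = "y - 2 / b" and h = "\<lambda>t. - h t"])
      show "(LINT t|lborel. - h t * jackson (b * (y - 2 / b - t))) \<le> e / b"
        using int[of "y - 2 / b"] by (simp add: abs_le_iff)
      show "- h y - E \<le> - h t" if "\<bar>t - (y - 2 / b)\<bar> \<le> 2 / b" for t
      proof -
        have "t \<le> y" "y - 4 / b \<le> t" using that half unfolding abs_le_iff by linarith+
        from down[OF y this] show ?thesis by simp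
      qed
      show "- (M * \<psi> y) * (1 + b * \<bar>t - (y - 2 / b)\<bar>) \<le> - h t" if "\<bar>t - (y - 2 / b)\<bar> > 2 / b" for t
      proof -
        have "\<bar>y - 2 / b - y\<bar> = 2 / b" using b2 by simp
        from out[OF this that] show ?thesis unfolding mult_minus_left by (simp add: abs_le_iff)
      qed
    qed (use h in auto)
    have "\<bar>h y\<bar> \<le> E + 2 * e + M * \<psi> y / 2"
      using 1 2 N e0 unfolding num by (simp add: abs_le_iff)
    also have "\<dots> \<le> E * \<psi> y + 2 * e * \<psi> y + M * \<psi> y / 2"
      using E e0 \<psi>1[of y] by (intro add_mono) (simp_all add: mult_le_cancel_left1)
    finally show ?thesis by (simp add: algebra_simps)
  qed
  have far: "\<bar>h y\<bar> \<le> 8 * X / (b * u) * \<psi> y" if y: "\<bar>y - u\<bar> > u / 4" for y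
  proof -
    have "b * u / 8 \<le> \<psi> y"
    proof -
      have "b * (u / 4) \<le> b * \<bar>y - u\<bar>" using y b by (intro mult_left_mono) auto
      then show ?thesis by (simp add: \<psi>_def)
    qed
    then have "8 / (b * u) * (b * u / 8) \<le> 8 / (b * u) * \<psi> y"
      using b u by (intro mult_left_mono) auto
    then have "1 \<le> 8 / (b * u) * \<psi> y" using b u by simp
    then have "X * 1 \<le> X * (8 / (b * u) * \<psi> y)" using X0 by (rule mult_left_mono)
    then show ?thesis using bdd[of y] by (simp add: mult_ac)
  qed
  have "M \<le> max (8 * X / (b * u)) (E + 2 * e + M / 2)"
    unfolding M_def
  proof (rule cSUP_least)
    fix y
    show "\<bar>h y\<bar> / \<psi> y \<le> max (8 * X / (b * u)) (E + 2 * e + (SUP t. \<bar>h t\<bar> / \<psi> t) / 2)"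
    proof (cases "\<bar>y - u\<bar> \<le> u / 4")
      case True
      from near[OF True] have "\<bar>h y\<bar> / \<psi> y \<le> E + 2 * e + M / 2"
        using \<psi>0[of y] by (simp add: pos_divide_le_eq)
      then show ?thesis by (simp add: M_def)
    next
      case False
      then have "\<bar>h y\<bar> / \<psi> y \<le> 8 * X / (b * u)"
        using far[of y] \<psi>0[of y] by (simp add: pos_divide_le_eq)
      then show ?thesis by simp
    qed
  qed simp
  moreover have "8 * X / (b * u) \<ge> 0" using X0 b u by simp
  \<comment> \<open>If the second entry of the maximum dominates, M / 2 is absorbed on the left,
    which doubles E + 2e. The claim follows because psi = 1 at u.\<close>
  ultimately have "M \<le> 8 * X / (b * u) + 2 * E + 4 * e" using E e0 by (auto simp: max_def split: if_splits)
  then show ?thesis using Mup[of u] by (simp add: \<psi>_def)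
qed

section \<open>Elementary bounds for the weight and the Tauberian estimate for weighted
  functions\<close>

definition laplace_weight :: "real \<Rightarrow> real \<Rightarrow> real" where
  "laplace_weight u t = exp (- (t / u)) - exp (- (2 * t / u))"

lemma laplace_weight_factor: "laplace_weight u t = exp (- (t / u)) * (1 - exp (- (t / u)))"
  by (simp add: laplace_weight_def algebra_simps flip: exp_add)

lemma laplace_weight_nonneg: "u > 0 \<Longrightarrow> t \<ge> 0 \<Longrightarrow> 0 \<le> laplace_weight u t"
  by (simp add: laplace_weight_factor)

lemma laplace_weight_le_1: "u > 0 \<Longrightarrow> t \<ge> 0 \<Longrightarrow> laplace_weight u t \<le> 1"
  unfolding laplace_weight_factor by (rule mult_le_one) auto

lemma laplace_weight_le: "u > 0 \<Longrightarrow> t \<ge> 0 \<Longrightarrow> laplace_weight u t \<le> t / u"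
proof -
  assume "u > 0" "t \<ge> 0"
  then have "exp (- (t / u)) * (1 - exp (- (t / u))) \<le> 1 * (t / u)"
    using exp_ge_add_one_self[of "- (t / u)"] by (intro mult_mono) auto
  then show ?thesis by (simp add: laplace_weight_factor)
qed

text \<open>The factor 1 - e^(-t/u) increases with t, so from y to t the weight shrinks at most by
  e^(-(t - y)/u). This carries a large value of the weighted function forward over a whole
  window.\<close>

lemma laplace_weight_shift:
  assumes "u > 0" "0 \<le> y" "y \<le> t"
  shows "exp (- ((t - y) / u)) * laplace_weight u y \<le> laplace_weight u t"
proof -
  have "exp (- ((t - y) / u)) * laplace_weight u y = exp (- (t / u)) * (1 - exp (- (y / u)))"
    by (simp add: laplace_weight_factor diff_divide_distrib flip: exp_add mult.assoc)
  also have "\<dots> \<le> laplace_weight u t"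
    unfolding laplace_weight_factor using assms by (intro mult_left_mono) (auto simp: divide_right_mono)
  finally show ?thesis .
qed

lemma laplace_weight_ge:
  assumes "u > 0" "u / 2 \<le> t" "t \<le> 3 * u / 2"
  shows "1 / 54 \<le> laplace_weight u t"
proof -
  define x where "x = t / u"
  have x: "1 / 2 \<le> x" "x \<le> 3 / 2" using assms by (auto simp: x_def field_simps)
  have e3: "exp (3::real) \<le> 27"
  proof -
    have "exp (3::real) = exp 1 ^ 3" by (simp flip: exp_of_nat_mult)
    also have "\<dots> \<le> 3 ^ 3" using exp_le by (intro power_mono) auto
    finally show ?thesis by simp
  qed
  \<comment> \<open>With x = t/u in [1/2, 3/2], e^(-2x) >= e^-3 >= 1/27 and e^x - 1 >= x >=
    1/2.\<close>
  have "1 / 54 \<le> exp (- 3) * (1 / 2 :: real)" using e3 by (simp add: exp_minus field_simps)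
  also have "\<dots> \<le> exp (- 2 * x) * (exp x - 1)"
  proof (rule mult_mono)
    show "1 / 2 \<le> exp x - 1" using x exp_ge_add_one_self[of x] by linarith
  qed (use x in auto)
  also have "\<dots> = laplace_weight u t"
    by (simp add: laplace_weight_def x_def algebra_simps flip: exp_add)
  finally show ?thesis .
qed

lemma laplace_weight_lipschitz:
  assumes "u \<ge> 1" "y \<ge> 0" "t \<ge> 0"
  shows "\<bar>laplace_weight u t - laplace_weight u y\<bar> \<le> 3 * \<bar>t - y\<bar>"
proof -
  have "norm (laplace_weight u t - laplace_weight u y) \<le> 3 * norm (t - y)"
  proof (rule field_differentiable_bound[of "{0..}"])
    show "(laplace_weight u has_field_derivative (- exp (- (z / u)) / u + 2 * exp (- (2 * z / u)) / u)) (at z within {0..})" for z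
      unfolding laplace_weight_def[abs_def] using assms by (auto intro!: derivative_eq_intros)
    show "norm (- exp (- (z / u)) / u + 2 * exp (- (2 * z / u)) / u) \<le> 3" if "z \<in> {0..}" for z
    proof -
      have 1: "exp (- (z / u)) / u \<le> 1 / 1" "exp (- (2 * z / u)) / u \<le> 1 / 1"
        using that assms by (intro frac_le; auto)+
      moreover have "0 \<le> exp (- (z / u)) / u" "0 \<le> exp (- (2 * z / u)) / u" using assms by auto
      ultimately show ?thesis by (simp add: abs_le_iff)
    qed
  qed (use assms in auto)
  then show ?thesis by simp
qed

text \<open>For \<open>T \<le> 64\<close> the crude bound for \<open>a\<close> obtained from a single window is already of the required size;
  for larger \<open>T\<close> that bound only enters with the factor \<open>1 / T\<close> gained by \<open>tauberian_local\<close>.\<close>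

lemma tauberian_core:
  fixes a p \<psi> :: "real \<Rightarrow> real"
  defines "h \<equiv> \<lambda>u t. indicator {0..} t * ((a t - p t) * laplace_weight u t)"
  assumes u: "u \<ge> 1" and T: "T > 0" and Tu: "T * u \<ge> 32" and U: "U \<ge> 1"
    and B: "B1 > 0" "B2 > 0" and C: "Cp \<ge> 0" "Cq \<ge> 0"
    and h: "integrable lborel (h u)"
    and \<eta>: "\<eta> = (LINT \<tau>:{-T..T}|lborel. norm (fourier (\<lambda>t. of_real (h u t)) \<tau>))"
    and lower: "\<And>t. t \<ge> 0 \<Longrightarrow> a t \<ge> - (B1 + B2)"
    and slow: "\<And>y t. 0 \<le> y \<Longrightarrow> y \<le> t \<Longrightarrow> a t \<ge> exp (y - t) * a y - B1 * (1 - exp (y - t)) - B2 * \<psi> y"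
    and \<psi>: "\<And>y. y \<ge> 0 \<Longrightarrow> \<psi> y \<le> 1" "\<And>y. y \<ge> u / 2 \<Longrightarrow> \<psi> y \<le> \<phi>0" and \<phi>0: "\<phi>0 \<ge> 0"
    and pw: "\<And>t. t \<ge> 0 \<Longrightarrow> \<bar>p t * laplace_weight u t\<bar> \<le> Cp * U"
    and plip: "\<And>y t. u / 2 \<le> y \<Longrightarrow> y \<le> t \<Longrightarrow> t \<le> 3 * u / 2 \<Longrightarrow>
        \<bar>p t * laplace_weight u t - p y * laplace_weight u y\<bar> \<le> Cq * U * (t - y)"
  shows "\<bar>a u - p u\<bar> \<le> 10 ^ 7 * (1 + B1 + B2 + Cp + Cq)
     * (\<phi>0 + (exp (10 / T) / T + 1) * \<eta> + exp (10 / T) / T * U)"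
proof -
  \<comment> \<open>Four Dirichlet factors of bandwidth \<open>b\<close> fill [-T, T], and
    \<open>integral_jackson_le\<close> supplies the 3 in \<open>e\<close>. Below, \<open>L\<close>
    bounds -h, \<open>X1\<close> bounds the absolute value of the weighted a, and \<open>X\<close>
    bounds that of h.\<close>
  define b where "b = T / 4"
  define w where "w = laplace_weight u"
  define e where "e = 3 * \<eta>"
  define L where "L = (B1 + B2 + Cp) * U"
  define X1 where "X1 = exp (8 / T) * (4 * e + 6 * L)"
  define X where "X = exp (8 / T) * (4 * e + 7 * L)"
  note pw = pw[folded w_def] and plip = plip[folded w_def]
  have u0: "u > 0" using u by simp
  have b: "b > 0" using T by (simp add: b_def)
  have \<eta>0: "\<eta> \<ge> 0" unfolding \<eta> set_lebesgue_integral_def by (intro Bochner_Integration.integral_nonneg) auto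
  have e0: "e \<ge> 0" using \<eta>0 by (simp add: e_def)
  have CpL: "B1 + B2 + Cp * U \<le> L"
  proof -
    have "(B1 + B2) * 1 \<le> (B1 + B2) * U" using B U by (intro mult_left_mono) auto
    then show ?thesis by (simp add: L_def algebra_simps)
  qed
  have CpU: "0 \<le> Cp * U" using C U by simp
  have L0: "L \<ge> 0" using CpL CpU B by linarith
  have int: "\<bar>LINT t|lborel. h u t * jackson (b * (v - t))\<bar> \<le> e / b" for v
    using integral_jackson_le[OF b h, of v] by (simp add: e_def b_def \<eta>)
  have w0: "0 \<le> w t" and w1: "w t \<le> 1" if "t \<ge> 0" for t
    using that laplace_weight_nonneg[OF u0 that] laplace_weight_le_1[OF u0 that] by (auto simp: w_def)
  have h_eq: "h u t = a t * w t - p t * w t" if "t \<ge> 0" for t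
    using that by (simp add: h_def w_def algebra_simps)
  have h_neg: "h u t = 0" if "t < 0" for t using that by (simp add: h_def)
  have aw_lower: "a t * w t \<ge> - (B1 + B2)" if t: "t \<ge> 0" for t
  proof -
    have "- (B1 + B2) \<le> - (B1 + B2) * w t" using w0[OF t] w1[OF t] B mult_left_le[of "w t" "B1 + B2"] by simp
    also have "\<dots> \<le> a t * w t" using lower[OF t] w0[OF t] by (intro mult_right_mono) auto
    finally show ?thesis .
  qed
  have h_lower: "h u t \<ge> - L" for t
  proof (cases "t \<ge> 0")
    case True
    then show ?thesis using aw_lower[OF True] pw[OF True] CpL h_eq[OF True] by (simp add: abs_le_iff)
  qed (use h_neg L0 in simp)
  have e8: "1 \<le> exp (8 / T)" using T by simp
  have crude: "a y * w y \<le> X1" if y: "y \<ge> 0" for y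
  proof (cases "a y \<ge> 0")
    case True
    \<comment> \<open>Over the window [y, y + 8/T] the slow decrease of a costs the factor e^(-8/T)
      and an additive B1 + B2. The weight costs at most e^(-1/4), since (8/T)/u <= 1/4 by T u >=
      32.\<close>
    define q where "q = exp (- (8 / T + 1 / 4))"
    have q0: "q > 0" by (simp add: q_def)
    have awy: "0 \<le> a y * w y" using True w0[OF y] by simp
    have "9 / 10 * (a y * w y * q - L) \<le> e + L * (2 / (3 * 1 ^ 3) + 1 / 1 ^ 2)"
    proof (rule jackson_window_bound[OF b _ h L0 e0, where v = "y + 1 / b"])
      show "(LINT t|lborel. h u t * jackson (b * (y + 1 / b - t))) \<le> e / b"
        using int[of "y + 1 / b"] by (rule abs_le_D1)
      show "a y * w y * q - L \<le> h u t" if "\<bar>t - (y + 1 / b)\<bar> \<le> 1 / b" for t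
      proof -
        have yt: "y \<le> t" "t \<le> y + 2 / b"
          using that by (auto simp: abs_le_iff)
        have t: "t \<ge> 0" using yt y by simp
        have d: "t - y \<le> 8 / T" using yt by (simp add: b_def)
        have "(t - y) / u \<le> (8 / T) / u" using d u0 by (intro divide_right_mono) auto
        also have "(8 / T) / u \<le> 1 / 4" using Tu T u0 by (simp add: field_simps)
        finally have d2: "(t - y) / u \<le> 1 / 4" .
        have "q \<le> exp (- (t - y) + - ((t - y) / u))"
          unfolding q_def exp_le_cancel_iff using d d2 by linarith
        then have "q \<le> exp (- (t - y)) * exp (- ((t - y) / u))" by (simp only: exp_add)
        then have "a y * w y * q \<le> a y * w y * (exp (- (t - y)) * exp (- ((t - y) / u)))"
          using awy by (rule mult_left_mono)
        also have "\<dots> = exp (y - t) * a y * (exp (- ((t - y) / u)) * w y)" by simp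
        also have "\<dots> \<le> exp (y - t) * a y * w t"
          using laplace_weight_shift[OF u0 y yt(1)] True by (intro mult_left_mono) (auto simp: w_def)
        also have "\<dots> \<le> (a t + (B1 + B2)) * w t"
        proof (rule mult_right_mono[OF _ w0[OF t]])
          have "B1 * (1 - exp (y - t)) \<le> B1 * 1" using B by (intro mult_left_mono) auto
          moreover have "B2 * \<psi> y \<le> B2 * 1" using B \<psi>(1)[OF y] by (intro mult_left_mono) auto
          ultimately show "exp (y - t) * a y \<le> a t + (B1 + B2)" using slow[OF y yt(1)] by linarith
        qed
        also have "\<dots> \<le> a t * w t + (B1 + B2)"
          using w1[OF t] B mult_left_le[of "w t" "B1 + B2"] by (simp add: distrib_right)
        finally show ?thesis using pw[OF t] CpL h_eq[OF t] by (simp add: abs_le_iff)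
      qed
      show "- L * (1 + b * \<bar>t - (y + 1 / b)\<bar>) \<le> h u t" for t
      proof -
        have "L * 1 \<le> L * (1 + b * \<bar>t - (y + 1 / b)\<bar>)" using L0 b by (intro mult_left_mono) auto
        then show ?thesis using h_lower[of t] by simp
      qed
    qed simp
    \<comment> \<open>The tail at r = 1 is 5/3, and (10/9)(5/3) + 1 = 77/27 is below 3.\<close>
    then have 1: "a y * w y * q \<le> 2 * e + 3 * L" using e0 L0 by simp
    have "exp (1 / 4 :: real) \<le> 2"
    proof -
      have "exp (1 / 4 :: real) ^ 4 \<le> 2 ^ 4" using exp_le by (simp flip: exp_of_nat_mult)
      then show ?thesis using power_mono_iff[of "exp (1 / 4 :: real)" 2 4] by simp
    qed
    then have "exp (1 / 4) * exp (8 / T) \<le> 2 * exp (8 / T)" by (intro mult_right_mono) auto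
    moreover have "1 / q = exp (8 / T + 1 / 4)" unfolding q_def exp_minus
      by (simp only: inverse_eq_divide[symmetric] inverse_inverse_eq)
    ultimately have "1 / q \<le> 2 * exp (8 / T)" by (simp only: exp_add mult.commute)
    have "a y * w y = (a y * w y * q) * (1 / q)" using q0 by simp
    also have "\<dots> \<le> (2 * e + 3 * L) * (2 * exp (8 / T))"
      using 1 \<open>1 / q \<le> _\<close> awy q0 e0 L0 by (intro mult_mono) auto
    also have "\<dots> = X1" by (simp add: X1_def algebra_simps)
    finally show ?thesis .
  next
    case False
    then have "a y * w y \<le> 0" using w0[OF y] by (simp add: mult_nonpos_nonneg)
    also have "0 \<le> X1" using e0 L0 by (simp add: X1_def)
    finally show ?thesis .
  qed
  have X1L: "L \<le> X1"
  proof -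
    have "1 * L \<le> exp (8 / T) * (4 * e + 6 * L)" using e8 e0 L0 by (intro mult_mono) auto
    then show ?thesis by (simp add: X1_def)
  qed
  have aw_abs: "\<bar>a y * w y\<bar> \<le> X1" if y: "y \<ge> 0" for y
    using crude[OF y] aw_lower[OF y] X1L CpL CpU by (simp add: abs_le_iff)
  have X: "X1 + L \<le> X" using mult_right_mono[OF e8 L0] by (simp add: X_def X1_def algebra_simps)
  have h_bdd: "\<bar>h u t\<bar> \<le> X" for t
  proof (cases "t \<ge> 0")
    case True
    then show ?thesis
      using aw_abs[OF True] pw[OF True] X CpL B h_eq[OF True] by (simp add: abs_le_iff)
  qed (use h_neg X X1L L0 in simp)
  have final: "\<bar>a u - p u\<bar> \<le> 54 * \<bar>h u u\<bar>"
  proof -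
    have "\<bar>a u - p u\<bar> * (1 / 54) \<le> \<bar>a u - p u\<bar> * w u"
      using laplace_weight_ge[OF u0, of u] u0 by (intro mult_left_mono) (auto simp: w_def)
    also have "\<dots> = \<bar>h u u\<bar>" using w0[of u] u0 h_eq[of u] by (simp add: abs_mult flip: left_diff_distrib)
    finally show ?thesis by simp
  qed
  define V where "V = exp (10 / T) / T"
  define D where "D = 1 + B1 + B2 + Cp + Cq"
  have V0: "V \<ge> 0" using T by (simp add: V_def)
  have D1: "D \<ge> 1" using B C by (simp add: D_def)
  have e10: "exp (8 / T) \<le> exp (10 / T)" using T by (simp add: divide_right_mono)
  have V1: "exp (8 / T) / T \<le> V" using e10 T by (simp add: V_def divide_right_mono)
  have LD: "L \<le> D * U" unfolding L_def D_def using U C by (intro mult_right_mono) auto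
  have V\<eta>: "V * \<eta> \<le> D * (V * \<eta>)" using mult_right_mono[OF D1, of "V * \<eta>"] V0 \<eta>0 by simp
  have VL: "V * L \<le> D * (V * U)" using mult_left_mono[OF LD V0] by (simp add: mult_ac)
  have VU0: "0 \<le> V * U" using V0 U by simp
  have V\<eta>0: "0 \<le> V * \<eta>" using V0 \<eta>0 by simp
  have XT: "X / T \<le> 12 * (D * (V * \<eta>)) + 7 * (D * (V * U))"
  proof -
    have "X / T = exp (8 / T) / T * (4 * e + 7 * L)" by (simp add: X_def)
    also have "\<dots> \<le> V * (4 * e + 7 * L)" using V1 e0 L0 by (intro mult_right_mono) auto
    also have "\<dots> = 12 * (V * \<eta>) + 7 * (V * L)" by (simp add: e_def algebra_simps)
    finally show ?thesis using V\<eta> VL by linarith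
  qed
  \<comment> \<open>The worst coefficient is 54 * 12 * (32 + 2 * 16 * 216), that of
    \<open>D * (V * \<eta>)\<close> when T > 64. It is about 4.5 * 10^6, and 10^7 is a round
    majorant.\<close>
  have main: "\<bar>a u - p u\<bar> \<le> 10 ^ 7 * (D * \<phi>0 + D * \<eta> + D * (V * \<eta>) + D * (V * U))"
  proof (cases "T \<le> 64")
    case True
    have "X * T \<le> X * 64" using True X X1L L0 by (intro mult_left_mono) auto
    then have "X \<le> 64 * (X / T)" using T by (simp add: field_simps)
    also have "\<dots> \<le> 64 * (12 * (D * (V * \<eta>)) + 7 * (D * (V * U)))"
      using XT by (rule mult_left_mono) simp
    finally have "X \<le> 64 * (12 * (D * (V * \<eta>)) + 7 * (D * (V * U)))" .
    then have "\<bar>a u - p u\<bar> \<le> 54 * (64 * (12 * (D * (V * \<eta>)) + 7 * (D * (V * U))))"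
      using final h_bdd[of u] by simp
    moreover have "0 \<le> D * \<phi>0" "0 \<le> D * \<eta>" "0 \<le> D * (V * \<eta>)" "0 \<le> D * (V * U)"
      using D1 \<phi>0 \<eta>0 V\<eta>0 VU0 by simp_all
    ultimately show ?thesis by simp
  next
    case False
    \<comment> \<open>\<open>W\<close> collects the losses proportional to t - y. On [u/2, 3u/2] the
      function a is at most 54 \<open>X1\<close> in absolute value, and
      \<open>w t * exp (y - t)\<close> differs from \<open>w y\<close> by at most 4 (t - y), namely
      3 from the weight and 1 from the exponential; hence 216 = 54 * 4. The window has length 4/b =
      16/T, so these losses gain the factor 1/T, whereas the loss \<open>B2 * \<phi>0\<close> does
      not shrink with T.\<close>
    define W where "W = 216 * X1 + B1 + Cq * U"
    define E where "E = 16 * (W / T) + B2 * \<phi>0"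
    have X10: "X1 \<ge> 0" using X1L L0 by linarith
    have W0: "0 \<le> W" using X10 B C U by (simp add: W_def)
    then have E0: "E \<ge> 0"
      unfolding E_def using B \<phi>0 T by (intro add_nonneg_nonneg mult_nonneg_nonneg divide_nonneg_nonneg) auto
    have step: "h u t \<ge> h u y - E" if y: "u / 2 \<le> y" and yt: "y \<le> t" and d: "t \<le> y + 16 / T" and t: "t \<le> 3 * u / 2" for y t
    proof -
      have y0: "y \<ge> 0" and t0: "t \<ge> 0" using y yt u0 by auto
      have wy: "1 / 54 \<le> w y" using laplace_weight_ge[OF u0 y] yt t by (simp add: w_def)
      have ay: "\<bar>a y\<bar> \<le> 54 * X1"
      proof -
        have "\<bar>a y\<bar> * (1 / 54) \<le> \<bar>a y\<bar> * w y" using wy by (intro mult_left_mono) auto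
        also have "\<dots> \<le> X1" using aw_abs[OF y0] w0[OF y0] by (simp add: abs_mult)
        finally show ?thesis by simp
      qed
      have expd: "1 - exp (y - t) \<le> t - y" "0 \<le> 1 - exp (y - t)"
        using exp_ge_add_one_self[of "y - t"] yt by (linarith, simp)
      have "\<bar>w t * exp (y - t) - w y\<bar> \<le> 4 * (t - y)"
      proof -
        have "w t * exp (y - t) - w y = (w t - w y) - w t * (1 - exp (y - t))" by (simp add: algebra_simps)
        moreover have "w t * (1 - exp (y - t)) \<le> 1 * (t - y)"
          using w0[OF t0] w1[OF t0] expd by (intro mult_mono) auto
        moreover have "0 \<le> w t * (1 - exp (y - t))"
          by (rule mult_nonneg_nonneg[OF w0[OF t0] expd(2)])
        moreover have "\<bar>w t - w y\<bar> \<le> 3 * (t - y)"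
          using laplace_weight_lipschitz[OF u y0 t0] yt by (simp add: w_def)
        ultimately show ?thesis by linarith
      qed
      then have "\<bar>a y\<bar> * \<bar>w t * exp (y - t) - w y\<bar> \<le> (54 * X1) * (4 * (t - y))"
        using ay by (intro mult_mono) (use X10 in auto)
      also have "(54 * X1) * (4 * (t - y)) = 216 * X1 * (t - y)" by simp
      finally have 1: "\<bar>a y * (w t * exp (y - t) - w y)\<bar> \<le> 216 * X1 * (t - y)" unfolding abs_mult .
      have "B1 * (1 - exp (y - t)) \<le> B1 * (t - y)" using expd B by (intro mult_left_mono) auto
      moreover have "B2 * \<psi> y \<le> B2 * \<phi>0" using \<psi>(2)[OF y] B by (intro mult_left_mono) auto
      ultimately have "exp (y - t) * a y - (B1 * (t - y) + B2 * \<phi>0) \<le> a t" using slow[OF y0 yt] by linarith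
      then have "(exp (y - t) * a y - (B1 * (t - y) + B2 * \<phi>0)) * w t \<le> a t * w t"
        using w0[OF t0] by (rule mult_right_mono)
      moreover have "(B1 * (t - y) + B2 * \<phi>0) * w t \<le> (B1 * (t - y) + B2 * \<phi>0) * 1"
        using w1[OF t0] B \<phi>0 yt by (intro mult_left_mono) auto
      ultimately have 2: "a t * w t \<ge> a y * (w t * exp (y - t)) - (B1 * (t - y) + B2 * \<phi>0)"
        by (simp add: algebra_simps)
      have 3: "\<bar>p t * w t - p y * w y\<bar> \<le> Cq * U * (t - y)" using plip[OF y yt t] .
      have "W * (t - y) \<le> W * (16 / T)" using d W0 by (intro mult_left_mono) auto
      also have "\<dots> = 16 * (W / T)" by simp
      also have "W * (t - y) = 216 * X1 * (t - y) + B1 * (t - y) + Cq * U * (t - y)"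
        unfolding W_def by (simp only: distrib_right)
      finally have 4: "216 * X1 * (t - y) + B1 * (t - y) + B2 * \<phi>0 + Cq * U * (t - y) \<le> E"
        by (simp add: E_def)
      have 5: "a y * (w t * exp (y - t) - w y) = a y * (w t * exp (y - t)) - a y * w y" by (simp add: algebra_simps)
      show ?thesis
        using 1 2 3 4 unfolding 5 h_eq[OF t0] h_eq[OF y0] by (simp only: abs_le_iff) linarith
    qed
    \<comment> \<open>For T > 64 a window of length 16/T is not longer than u/4, so windows attached
      to points within u/4 of u stay in [u/2, 3u/2], where \<open>step\<close> applies.\<close>
    have "64 * 1 \<le> T * u" using False u by (intro mult_mono) auto
    then have d: "16 / T \<le> u / 4" using T by (simp add: field_simps)
    have d4: "4 / b = 16 / T" by (simp add: b_def)
    have "\<bar>h u u\<bar> \<le> 8 * X / (b * u) + 2 * E + 4 * e"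
    proof (rule tauberian_local[OF b h h_bdd int u0 E0])
      fix y t assume y: "\<bar>y - u\<bar> \<le> u / 4"
      then have y': "3 * u / 4 \<le> y" "y \<le> 5 * u / 4" unfolding abs_le_iff by linarith+
      show "h u y - E \<le> h u t" if "y \<le> t" "t \<le> y + 4 / b"
        using y' that d u0 unfolding d4 by (intro step) auto
      show "h u t \<le> h u y + E" if "t \<le> y" "y - 4 / b \<le> t"
      proof -
        have "h u t - E \<le> h u y" using y' that d u0 unfolding d4 by (intro step) auto
        then show ?thesis by simp
      qed
    qed
    moreover have "8 * X / (b * u) \<le> 32 * (X / T)"
    proof -
      have "X / T / u \<le> X / T / 1" using u X X1L L0 T by (intro divide_left_mono divide_nonneg_nonneg) auto
      then show ?thesis by (simp add: b_def)
    qed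
    moreover have "E \<le> 16 * 216 * (X / T) + 16 * (D * (V * U)) + D * \<phi>0"
    proof -
      have "X1 / T \<le> X / T" using X L0 T by (intro divide_right_mono) auto
      moreover have "W / T = 216 * (X1 / T) + (B1 + Cq * U) / T"
        by (simp add: W_def add_divide_distrib)
      moreover have "(B1 + Cq * U) / T \<le> D * (V * U)"
      proof -
        have "B1 * 1 \<le> B1 * U" using B U by (intro mult_left_mono) auto
        moreover have "(B1 + Cq) * U \<le> D * U" unfolding D_def using B C U by (intro mult_right_mono) auto
        ultimately have "B1 + Cq * U \<le> D * U" by (simp add: algebra_simps)
        moreover have "1 / T \<le> V" using T by (simp add: V_def divide_right_mono)
        ultimately have "(B1 + Cq * U) * (1 / T) \<le> (D * U) * V"
          using B C U D1 T by (intro mult_mono) auto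
        then show ?thesis by (simp add: mult_ac)
      qed
      moreover have "B2 * \<phi>0 \<le> D * \<phi>0" unfolding D_def using B C \<phi>0 by (intro mult_right_mono) auto
      ultimately show ?thesis unfolding E_def by linarith
    qed
    moreover have "\<eta> \<le> D * \<eta>" using mult_right_mono[OF D1 \<eta>0] by simp
    moreover have "0 \<le> D * \<phi>0" "0 \<le> D * \<eta>" "0 \<le> D * (V * \<eta>)" "0 \<le> D * (V * U)"
      using D1 \<phi>0 \<eta>0 V\<eta>0 VU0 by simp_all
    ultimately show ?thesis using final XT unfolding e_def by simp
  qed
  also have "\<dots> = 10 ^ 7 * D * (\<phi>0 + (V + 1) * \<eta> + V * U)" by (simp add: algebra_simps)
  finally show ?thesis by (simp add: V_def D_def)
qed

section \<open>Bounds for the main term\<close>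

text \<open>The reciprocal Gamma function is continuous also at 0, so it is bounded on the compact
  interval [0, Omega + 1]. This gives one bound for all admissible exponents, including those close
  to -1.\<close>

lemma inverse_Gamma_bounded:
  obtains K :: real where "K \<ge> 0" "\<And>w. -1 < w \<Longrightarrow> w \<le> \<Omega> \<Longrightarrow> 0 < 1 / Gamma (w + 1) \<and> 1 / Gamma (w + 1) \<le> K"
proof -
  have "compact ((rGamma :: real \<Rightarrow> real) ` {0..\<Omega> + 1})"
    by (intro compact_continuous_image continuous_intros) auto
  then obtain K where K: "\<forall>x\<in>{0..\<Omega> + 1}. \<bar>rGamma x\<bar> \<le> K"
    by (auto dest!: compact_imp_bounded simp: bounded_iff)
  show ?thesis
  proof (rule that[of "max K 0"])
    fix w assume w: "-1 < w" "w \<le> \<Omega>"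
    have "Gamma (w + 1) > 0" using w by (intro Gamma_real_pos) simp
    then have "0 < 1 / Gamma (w + 1)" by simp
    moreover have "1 / Gamma (w + 1) = rGamma (w + 1)" by (simp add: rGamma_inverse_Gamma inverse_eq_divide)
    moreover have "rGamma (w + 1) \<le> K" using bspec[OF K, of "w + 1"] w by (simp add: abs_le_iff)
    ultimately show "0 < 1 / Gamma (w + 1) \<and> 1 / Gamma (w + 1) \<le> max K 0" by linarith
  qed simp
qed

text \<open>Raise z <= e^z at z = x/P to the power P. With x = t/u, this lets the decay e^(-t/u)
  absorb t^P at the cost of u^P.\<close>

lemma powr_le_exp:
  fixes x P :: real
  assumes x: "x \<ge> 0" and P: "P \<ge> 0"
  shows "x powr P \<le> (1 + P powr P) * exp x"
proof (cases "x = 0 \<or> P = 0")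
  case True
  have "x powr P \<le> 1 * exp x" using True x by auto
  also have "\<dots> \<le> (1 + P powr P) * exp x" by (intro mult_right_mono) auto
  finally show ?thesis .
next
  case False
  then have x0: "x > 0" and P0: "P > 0" using x P by auto
  have "x / P \<le> exp (x / P)" using exp_ge_add_one_self[of "x / P"] by linarith
  then have "(x / P) powr P \<le> exp (x / P) powr P" using x0 P0 by (intro powr_mono2) auto
  also have "\<dots> = exp x" using P0 by (simp add: powr_def)
  finally have "(x / P) powr P \<le> exp x" .
  have "x powr P = P powr P * (x / P) powr P" using x0 P0 by (simp add: powr_divide)
  also have "\<dots> \<le> P powr P * exp x" using \<open>(x / P) powr P \<le> exp x\<close> by (intro mult_left_mono) auto
  also have "\<dots> \<le> (1 + P powr P) * exp x" by (intro mult_right_mono) auto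
  finally show ?thesis .
qed

text \<open>For t >= 1 the exponential decay at scale u absorbs the power. For t < 1 the weight is
  at most t, and t * t^w stays bounded because w > -1.\<close>

lemma laplace_weight_powr_le:
  assumes u: "u \<ge> 1" and t: "t \<ge> 0" and w: "-1 < w" "w \<le> P" and P: "P \<ge> 0"
  shows "laplace_weight u t * t powr w \<le> (1 + P powr P) * u powr P"
proof (cases "t \<ge> 1")
  case True
  have "t powr w \<le> t powr P" using True w by (intro powr_mono) auto
  also have "\<dots> = (t / u) powr P * u powr P" using u True by (simp add: powr_divide)
  also have "\<dots> \<le> (1 + P powr P) * exp (t / u) * u powr P"
    using u True P by (intro mult_right_mono powr_le_exp) auto
  finally have 1: "t powr w \<le> (1 + P powr P) * exp (t / u) * u powr P" .
  have "laplace_weight u t \<le> exp (- (t / u))" by (simp add: laplace_weight_def)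
  then have "laplace_weight u t * t powr w \<le> exp (- (t / u)) * ((1 + P powr P) * exp (t / u) * u powr P)"
    using 1 by (intro mult_mono) auto
  also have "\<dots> = (exp (- (t / u)) * exp (t / u)) * ((1 + P powr P) * u powr P)" by (simp only: mult_ac)
  also have "\<dots> = (1 + P powr P) * u powr P" by (simp flip: exp_add)
  finally show ?thesis .
next
  case False
  have "laplace_weight u t \<le> t / u" using u t by (intro laplace_weight_le) auto
  also have "\<dots> \<le> t / 1" using u t by (intro divide_left_mono) auto
  finally have "laplace_weight u t * t powr w \<le> t * t powr w" by (simp add: mult_right_mono)
  also have "\<dots> \<le> 1"
  proof (cases "t = 0")
    case False
    then have "t * t powr w = t powr (1 + w)" using t by (simp add: powr_add)
    also have "\<dots> \<le> 1" using t \<open>\<not> t \<ge> 1\<close> w by (intro powr_le1) auto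
    finally show ?thesis .
  qed simp
  also have "\<dots> \<le> (1 + P powr P) * u powr P"
  proof -
    have "1 * 1 \<le> (1 + P powr P) * u powr P" using u P by (intro mult_mono ge_one_powr_ge_zero) auto
    then show ?thesis by simp
  qed
  finally show ?thesis .
qed

text \<open>For z >= 1 the exponent is raised to P and z is at most 2u. The additional factor 2
  covers 1/2 <= z < 1, where a negative exponent gives at most 1/z <= 2.\<close>

lemma powr_le_window:
  fixes z :: real
  assumes u: "u \<ge> 1" and z: "u / 2 \<le> z" "z \<le> 3 * u / 2" and w: "-1 < w" "w \<le> P" and P: "P \<ge> 0"
  shows "z powr w \<le> 2 * 2 powr P * u powr P"
proof (cases "z \<ge> 1")
  case True
  have "z powr w \<le> z powr P" using True w by (intro powr_mono) auto
  also have "\<dots> \<le> (2 * u) powr P" using True z u P by (intro powr_mono2) auto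
  also have "\<dots> = 2 powr P * u powr P" using u by (simp add: powr_mult)
  also have "\<dots> \<le> 2 * 2 powr P * u powr P" using u by simp
  finally show ?thesis .
next
  case False
  have "z powr w \<le> z powr (-1)" using False z u w by (intro powr_mono') auto
  also have "\<dots> = 1 / z" using z u by (simp add: powr_minus_divide)
  also have "\<dots> \<le> 2 * (1 * 1)" using z u by (simp add: field_simps)
  also have "\<dots> \<le> 2 * (2 powr P * u powr P)"
    using u P by (intro mult_left_mono mult_mono ge_one_powr_ge_zero) auto
  finally show ?thesis by simp
qed

text \<open>By the product rule, 5 + 2P + |beta| is the sum of 3 from the weight, 2 (1 + P) from the
  power (as |w| <= 1 + P and 1/z <= 2), and |beta| from the oscillating factor.\<close>

lemma weighted_term_lipschitz:
  fixes \<alpha> \<beta> \<gamma> :: real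
  assumes u: "u \<ge> 1" and y: "u / 2 \<le> y" "y \<le> t" "t \<le> 3 * u / 2" and w: "-1 < w" "w \<le> P" and P: "P \<ge> 0"
  defines "f \<equiv> \<lambda>t. laplace_weight u t * t powr w * (\<alpha> * cos (\<beta> * t) + \<gamma> * sin (\<beta> * t))"
  shows "\<bar>f t - f y\<bar> \<le> 2 * 2 powr P * u powr P * (\<bar>\<alpha>\<bar> + \<bar>\<gamma>\<bar>) * (5 + 2 * P + \<bar>\<beta>\<bar>) * (t - y)"
proof -
  define Q where "Q = 2 * 2 powr P * u powr P"
  define D where "D z = - exp (- (z / u)) / u + 2 * exp (- (2 * z / u)) / u" for z
  define C where "C z = \<alpha> * cos (\<beta> * z) + \<gamma> * sin (\<beta> * z)" for z
  define C' where "C' z = \<beta> * (- \<alpha> * sin (\<beta> * z) + \<gamma> * cos (\<beta> * z))" for z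
  define F where "F z = D z * z powr w * C z + laplace_weight u z * (w * z powr (w - 1)) * C z
      + laplace_weight u z * z powr w * C' z" for z
  have "norm (f t - f y) \<le> Q * (\<bar>\<alpha>\<bar> + \<bar>\<gamma>\<bar>) * (5 + 2 * P + \<bar>\<beta>\<bar>) * norm (t - y)"
  proof (rule field_differentiable_bound[of "{u / 2..3 * u / 2}"])
    fix z assume z: "z \<in> {u / 2..3 * u / 2}"
    then have z0: "z > 0" and z2: "z \<ge> 1 / 2" using u by auto
    show "(f has_field_derivative F z) (at z within {u / 2..3 * u / 2})"
    proof -
      have d1: "(laplace_weight u has_field_derivative D z) (at z within {u / 2..3 * u / 2})"
        unfolding laplace_weight_def[abs_def] D_def using u by (auto intro!: derivative_eq_intros)
      have d2: "((\<lambda>z. z powr w) has_field_derivative (w * z powr (w - 1))) (at z within {u / 2..3 * u / 2})"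
        using z0 by (auto intro!: derivative_eq_intros)
      have d3: "(C has_field_derivative C' z) (at z within {u / 2..3 * u / 2})"
        unfolding C_def[abs_def] C'_def by (auto intro!: derivative_eq_intros simp: algebra_simps)
      from DERIV_mult[OF DERIV_mult[OF d1 d2] d3]
      have "((\<lambda>z. laplace_weight u z * z powr w * C z) has_field_derivative F z) (at z within {u / 2..3 * u / 2})"
        by (simp add: F_def algebra_simps)
      then show ?thesis unfolding f_def C_def .
    qed
    have 1: "\<bar>D z\<bar> \<le> 3"
    proof -
      have "exp (- (z / u)) / u \<le> 1 / 1" using z0 u by (intro frac_le) auto
      moreover have "exp (- (2 * z / u)) / u \<le> 1 / 1" using z0 u by (intro frac_le) auto
      moreover have "0 \<le> exp (- (z / u)) / u" "0 \<le> exp (- (2 * z / u)) / u" using u by auto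
      ultimately show ?thesis by (simp add: D_def abs_le_iff)
    qed
    have zw: "z powr w \<le> Q" unfolding Q_def using z by (intro powr_le_window u w P) auto
    have Q0: "Q \<ge> 0" by (simp add: Q_def)
    have lw: "0 \<le> laplace_weight u z" "laplace_weight u z \<le> 1"
      using laplace_weight_nonneg[of u z] laplace_weight_le_1[of u z] u z0 by auto
    have C: "\<bar>C z\<bar> \<le> \<bar>\<alpha>\<bar> + \<bar>\<gamma>\<bar>"
    proof -
      have "\<bar>\<alpha> * cos (\<beta> * z)\<bar> \<le> \<bar>\<alpha>\<bar>" "\<bar>\<gamma> * sin (\<beta> * z)\<bar> \<le> \<bar>\<gamma>\<bar>"
        by (simp_all add: abs_mult mult_left_le)
      then show ?thesis unfolding C_def by linarith
    qed
    have C': "\<bar>C' z\<bar> \<le> \<bar>\<beta>\<bar> * (\<bar>\<alpha>\<bar> + \<bar>\<gamma>\<bar>)"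
    proof -
      have "\<bar>- \<alpha> * sin (\<beta> * z)\<bar> \<le> \<bar>\<alpha>\<bar>" "\<bar>\<gamma> * cos (\<beta> * z)\<bar> \<le> \<bar>\<gamma>\<bar>"
        by (simp_all add: abs_mult mult_left_le)
      then have "\<bar>- \<alpha> * sin (\<beta> * z) + \<gamma> * cos (\<beta> * z)\<bar> \<le> \<bar>\<alpha>\<bar> + \<bar>\<gamma>\<bar>" by linarith
      then show ?thesis unfolding C'_def abs_mult by (intro mult_left_mono) auto
    qed
    have zw': "\<bar>w * z powr (w - 1)\<bar> \<le> (1 + P) * (2 * Q)"
    proof -
      have "z powr (w - 1) = z powr w * (1 / z)" using z0 by (simp add: powr_diff)
      also have "\<dots> \<le> Q * 2" using zw z2 z0 Q0 by (intro mult_mono) (auto simp: field_simps)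
      finally have "z powr (w - 1) \<le> 2 * Q" by simp
      moreover have "\<bar>w\<bar> \<le> 1 + P" using w P by auto
      ultimately show ?thesis unfolding abs_mult using P by (intro mult_mono) auto
    qed
    have A: "\<bar>D z * z powr w * C z\<bar> \<le> 3 * Q * (\<bar>\<alpha>\<bar> + \<bar>\<gamma>\<bar>)"
      unfolding abs_mult using 1 zw C Q0 by (intro mult_mono) auto
    have B: "\<bar>laplace_weight u z * (w * z powr (w - 1)) * C z\<bar> \<le> 1 * ((1 + P) * (2 * Q)) * (\<bar>\<alpha>\<bar> + \<bar>\<gamma>\<bar>)"
      unfolding abs_mult[of _ "C z"] abs_mult[of "laplace_weight u z"]
      using lw zw' C Q0 P by (intro mult_mono) auto
    have E: "\<bar>laplace_weight u z * z powr w * C' z\<bar> \<le> 1 * Q * (\<bar>\<beta>\<bar> * (\<bar>\<alpha>\<bar> + \<bar>\<gamma>\<bar>))"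
      unfolding abs_mult[of _ "C' z"] abs_mult[of "laplace_weight u z"]
      using lw zw C' Q0 by (intro mult_mono) auto
    have "\<bar>F z\<bar> \<le> 3 * Q * (\<bar>\<alpha>\<bar> + \<bar>\<gamma>\<bar>) + 1 * ((1 + P) * (2 * Q)) * (\<bar>\<alpha>\<bar> + \<bar>\<gamma>\<bar>) + 1 * Q * (\<bar>\<beta>\<bar> * (\<bar>\<alpha>\<bar> + \<bar>\<gamma>\<bar>))"
      unfolding F_def using A B E by linarith
    also have "\<dots> = Q * (\<bar>\<alpha>\<bar> + \<bar>\<gamma>\<bar>) * (5 + 2 * P + \<bar>\<beta>\<bar>)" by (simp add: algebra_simps)
    finally show "norm (F z) \<le> Q * (\<bar>\<alpha>\<bar> + \<bar>\<gamma>\<bar>) * (5 + 2 * P + \<bar>\<beta>\<bar>)" by simp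
  qed (use y u in auto)
  then show ?thesis using y by (simp add: Q_def)
qed

text \<open>Twice the real part is the term plus its conjugate, and the two exponentials shift s by
  i beta and -i beta. The division by Gamma(w + 1) cancels the Gamma value in
  \<open>laplace_powr\<close>.\<close>

lemma laplace_oscillating_term:
  fixes w \<beta> :: real and c s :: complex
  assumes w: "w > -1" and s: "Re s > 0"
  defines "f \<equiv> \<lambda>t. of_real (t powr w / Gamma (w + 1) * (2 * Re (c * exp (- (\<i> * of_real (\<beta> * t)))))) * exp (- (s * of_real t))"
  shows "set_integrable lborel {0..} f"
    and "(LINT t:{0..}|lborel. f t) = c / (s + \<i> * of_real \<beta>) powr of_real (w + 1)
      + cnj c / (s - \<i> * of_real \<beta>) powr of_real (w + 1)"
proof -
  define g where "g = Gamma (w + 1)"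
  have "g > 0" unfolding g_def using w by (intro Gamma_real_pos) simp
  then have g: "g \<noteq> 0" by simp
  define z1 z2 where "z1 = s + \<i> * of_real \<beta>" and "z2 = s - \<i> * of_real \<beta>"
  have z: "Re z1 > 0" "Re z2 > 0" using s by (simp_all add: z1_def z2_def)
  have f: "f t = (c / of_real g) * (of_real (t powr w) * exp (- (z1 * of_real t)))
      + (cnj c / of_real g) * (of_real (t powr w) * exp (- (z2 * of_real t)))" for t
  proof -
    define E where "E = exp (- (\<i> * of_real (\<beta> * t)))"
    have "of_real (2 * Re (c * E)) = c * E + cnj (c * E)" by (rule complex_add_cnj[symmetric])
    moreover have "cnj E = exp (\<i> * of_real (\<beta> * t))" by (simp add: E_def exp_cnj)
    ultimately have 1: "of_real (2 * Re (c * E)) = c * E + cnj c * exp (\<i> * of_real (\<beta> * t))" by simp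
    have "exp (- (z1 * of_real t)) = E * exp (- (s * of_real t))"
         "exp (- (z2 * of_real t)) = exp (\<i> * of_real (\<beta> * t)) * exp (- (s * of_real t))"
      by (simp_all add: z1_def z2_def E_def algebra_simps flip: exp_add)
    moreover have "f t = of_real (t powr w) / of_real g * of_real (2 * Re (c * E)) * exp (- (s * of_real t))"
      unfolding f_def g_def E_def by simp
    ultimately show ?thesis unfolding 1 by (simp add: algebra_simps add_divide_distrib)
  qed
  note i1 = set_integrable_mult_right[of "c / of_real g", OF set_integrable_powr_cexp[OF w z(1)]]
  note i2 = set_integrable_mult_right[of "cnj c / of_real g", OF set_integrable_powr_cexp[OF w z(2)]]
  show "set_integrable lborel {0..} f"
    unfolding f[abs_def] by (rule set_integral_add(1)[OF i1 i2])
  have "(LINT t:{0..}|lborel. f t) = c / of_real g * (of_real g / z1 powr of_real (w + 1))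
      + cnj c / of_real g * (of_real g / z2 powr of_real (w + 1))"
    unfolding f set_integral_add(2)[OF i1 i2] set_integral_mult_right laplace_powr[OF w z(1)] laplace_powr[OF w z(2)]
    by (simp add: g_def)
  then show "(LINT t:{0..}|lborel. f t) = c / (s + \<i> * of_real \<beta>) powr of_real (w + 1)
      + cnj c / (s - \<i> * of_real \<beta>) powr of_real (w + 1)"
    using g by (simp add: z1_def z2_def)
qed

section \<open>From the Mellin transform of A to the hypotheses of the Tauberian estimate\<close>

lemma moderately_decreasing_nonneg:
  assumes "moderately_decreasing 0 F B1 B2 \<phi>" "x \<ge> 0"
  shows "0 \<le> \<phi> x"
proof (rule tendsto_upperbound[of \<phi> 0 at_top])
  show "(\<phi> \<longlongrightarrow> 0) at_top" using assms(1) by (simp add: moderately_decreasing_def)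
  show "\<forall>\<^sub>F y in at_top. \<phi> y \<le> \<phi> x"
    using eventually_ge_at_top[of x]
  proof eventually_elim
    case (elim y)
    then show ?case using assms by (auto simp: moderately_decreasing_def monotone_on_def)
  qed
qed simp

text \<open>A single finite index set replaces the double sum over k and l; the variable is t = log
  x and the factor x is divided out.\<close>

definition main_term :: "'i set \<Rightarrow> ('i \<Rightarrow> complex) \<Rightarrow> ('i \<Rightarrow> real) \<Rightarrow> ('i \<Rightarrow> real) \<Rightarrow> real \<Rightarrow> real" where
  "main_term I c \<beta> \<omega> t = (\<Sum>i\<in>I. t powr \<omega> i / Gamma (\<omega> i + 1) * (2 * Re (c i * exp (- (\<i> * of_real (\<beta> i * t))))))"

definition transform_remainder :: "(real \<Rightarrow> real) \<Rightarrow> 'i set \<Rightarrow> ('i \<Rightarrow> complex) \<Rightarrow> ('i \<Rightarrow> real) \<Rightarrow> ('i \<Rightarrow> real) \<Rightarrow> complex \<Rightarrow> complex" where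
  "transform_remainder A I c \<beta> \<omega> s = 1 / (s + 1) * mellin_stieltjes A (s + 1)
    - (\<Sum>i\<in>I. c i / (s + \<i> * of_real (\<beta> i)) powr of_real (\<omega> i + 1)
        + cnj (c i) / (s - \<i> * of_real (\<beta> i)) powr of_real (\<omega> i + 1))"

text \<open>The constant is written out so that its dependence on the data can be read off. Relative
  to u^P, the first sum bounds the size of the weighted main term and the second its Lipschitz
  constant on [u/2, 3u/2].\<close>

lemma wiener_ikehara_remainder:
  fixes A \<phi> :: "real \<Rightarrow> real" and I :: "'i set"
  assumes lbv: "locally_bounded_variation A"
    and zero: "\<And>x. x < 1 \<Longrightarrow> A x = 0"
    and conv: "\<And>s. Re s > 1 \<Longrightarrow> mellin_stieltjes_converges A s"
    and md: "moderately_decreasing 0 A B1 B2 \<phi>"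
    and fin: "finite I"
    and \<omega>: "\<And>i. i \<in> I \<Longrightarrow> -1 < \<omega> i" "\<And>i. i \<in> I \<Longrightarrow> \<omega> i \<le> P" and P: "P \<ge> 0"
    and K: "K \<ge> 0" "\<And>i. i \<in> I \<Longrightarrow> 0 < 1 / Gamma (\<omega> i + 1) \<and> 1 / Gamma (\<omega> i + 1) \<le> K"
    and T: "T > 0" and u: "u \<ge> 1" and Tu: "T * u \<ge> 32"
  shows "\<bar>exp (- u) * A (exp u) - main_term I c \<beta> \<omega> u\<bar> \<le> 10 ^ 7 *
      (1 + B1 + B2 + (\<Sum>i\<in>I. K * (2 * norm (c i)) * (1 + P powr P))
        + (\<Sum>i\<in>I. K * (2 * (2 * 2 powr P * (\<bar>Re (c i)\<bar> + \<bar>Im (c i)\<bar>) * (5 + 2 * P + \<bar>\<beta> i\<bar>)))))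
    * (\<phi> (exp (u / 2)) + (exp (10 / T) / T + 1) * eta_fun (transform_remainder A I c \<beta> \<omega>) (1 / u) T + exp (10 / T) / T * u powr P)"
proof -
  define a where "a t = exp (- t) * A (exp t)" for t
  define p where "p = main_term I c \<beta> \<omega>"
  define G where "G = transform_remainder A I c \<beta> \<omega>"
  define f where "f s t = indicator {0..} t *\<^sub>R (of_real (a t - p t) * exp (- (s * complex_of_real t)))" for s t
  have B: "B1 > 0" "B2 > 0" and \<phi>1: "\<And>x. x \<in> {0..1} \<Longrightarrow> \<phi> x = 1"
    and anti: "\<And>x y. 0 \<le> x \<Longrightarrow> x \<le> y \<Longrightarrow> \<phi> y \<le> \<phi> x"
    and dec: "\<And>v x. 0 \<le> v \<Longrightarrow> 0 \<le> x \<Longrightarrow> A (x + v) - A x \<ge> - B1 * v - B2 * max 1 x * \<phi> x"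
    using md by (auto simp: moderately_decreasing_def monotone_on_def)
  have u0: "u > 0" using u by simp
  have A_lower: "A x \<ge> - (B1 + B2) * x" if x: "x \<ge> 1" for x
  proof -
    \<comment> \<open>At the base point 0 both \<open>max 1 0\<close> and \<open>\<phi> 0\<close>
      are 1, so moderate decrease reads A(x) >= -B1 x - B2.\<close>
    have "A (0 + x) - A 0 \<ge> - B1 * x - B2 * max 1 0 * \<phi> 0" using x by (intro dec) auto
    moreover have "B2 * 1 \<le> B2 * x" using B x by (intro mult_left_mono) auto
    ultimately show ?thesis using zero[of 0] \<phi>1[of 0] by (simp add: algebra_simps)
  qed
  have B0: "0 \<le> B1 + B2" using B by simp
  note lap = integrable_A_exp[OF lbv zero conv A_lower B0] mellin_stieltjes_eq_laplace[OF lbv zero conv A_lower B0]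
  have f_int: "integrable lborel (f s)" and f_val: "(LINT t|lborel. f s t) = G s" if s: "Re s > 0" for s
  proof -
    define q where "q i t = of_real (t powr \<omega> i / Gamma (\<omega> i + 1) * (2 * Re (c i * exp (- (\<i> * of_real (\<beta> i * t)))))) * exp (- (s * complex_of_real t))" for i t
    define Aq where "Aq t = of_real (A (exp t)) * exp (- ((s + 1) * complex_of_real t))" for t
    have s1: "Re (s + 1) > 1" using s by simp
    have Aq: "integrable lborel Aq" "(LINT t|lborel. Aq t) = 1 / (s + 1) * mellin_stieltjes A (s + 1)"
    proof -
      show "integrable lborel Aq" unfolding Aq_def by (rule lap(1)) (use s1 in auto)
      have "mellin_stieltjes A (s + 1) = (s + 1) * (LINT t|lborel. Aq t)"
        unfolding Aq_def by (rule lap(2)) (use s1 in auto)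
      moreover have "s + 1 \<noteq> 0" using s1 by (metis less_numeral_extra(3) not_one_less_zero zero_complex.sel(1))
      ultimately show "(LINT t|lborel. Aq t) = 1 / (s + 1) * mellin_stieltjes A (s + 1)" by simp
    qed
    have q: "integrable lborel (\<lambda>t. indicator {0..} t *\<^sub>R q i t)"
        "(LINT t|lborel. indicator {0..} t *\<^sub>R q i t) = c i / (s + \<i> * of_real (\<beta> i)) powr of_real (\<omega> i + 1)
        + cnj (c i) / (s - \<i> * of_real (\<beta> i)) powr of_real (\<omega> i + 1)" if "i \<in> I" for i
      using laplace_oscillating_term[OF \<omega>(1)[OF that] s, of "c i" "\<beta> i"]
      unfolding set_integrable_def set_lebesgue_integral_def q_def by blast+
    have feq: "f s t = Aq t - (\<Sum>i\<in>I. indicator {0..} t *\<^sub>R q i t)" for t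
    proof (cases "t \<ge> 0")
      case True
      have "of_real (a t) * exp (- (s * complex_of_real t)) = Aq t"
        by (simp add: a_def Aq_def algebra_simps exp_of_real flip: exp_add)
           (simp add: exp_diff exp_minus exp_add exp_of_real field_simps)
      then show ?thesis using True
        by (simp add: f_def q_def p_def main_term_def algebra_simps sum_distrib_left sum_distrib_right)
    next
      case False
      then show ?thesis using zero[of "exp t"] by (simp add: f_def Aq_def)
    qed
    show "integrable lborel (f s)"
      unfolding feq[abs_def] by (intro Bochner_Integration.integrable_diff Bochner_Integration.integrable_sum Aq(1) q(1))
    have "(LINT t|lborel. f s t) = (LINT t|lborel. Aq t) - (\<Sum>i\<in>I. LINT t|lborel. indicator {0..} t *\<^sub>R q i t)"
      unfolding feq
      by (subst Bochner_Integration.integral_diff) (auto intro!: Bochner_Integration.integrable_sum Aq(1) q(1) simp: Bochner_Integration.integral_sum q(1))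
    also have "\<dots> = G s"
      unfolding G_def transform_remainder_def Aq(2) using q(2) by (simp cong: sum.cong)
    finally show "(LINT t|lborel. f s t) = G s" .
  qed
  define h where "h t = indicator {0..} t * ((a t - p t) * laplace_weight u t)" for t
  have hf: "of_real (h t) * exp (- (\<i> * of_real (\<tau> * t))) = f (Complex (1 / u) \<tau>) t - f (Complex (2 * (1 / u)) \<tau>) t" for t \<tau>
  proof -
    have e: "exp (- (Complex r \<tau> * of_real t)) = of_real (exp (- (r * t))) * exp (- (\<i> * of_real (\<tau> * t)))" for r
    proof -
      have "- (Complex r \<tau> * of_real t) = of_real (- (r * t)) + - (\<i> * of_real (\<tau> * t))"
        by (simp add: Complex_eq algebra_simps)
      then show ?thesis by (simp only: exp_add exp_of_real)
    qed
    show ?thesis unfolding f_def h_def e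
      by (simp add: laplace_weight_def indicator_def algebra_simps)
  qed
  have f2: "integrable lborel (\<lambda>t. f (Complex (1 / u) \<tau>) t - f (Complex (2 * (1 / u)) \<tau>) t)" for \<tau>
    using u0 by (intro Bochner_Integration.integrable_diff f_int) auto
  have h_int: "integrable lborel h"
    using integrable_Re[OF f2[of 0, folded hf]] by simp
  \<comment> \<open>With sigma = 1/u this is the negative of the difference inside
    \<open>eta_fun\<close>; the norm ignores the sign.\<close>
  have four: "fourier (\<lambda>t. of_real (h t)) \<tau> = G (Complex (1 / u) \<tau>) - G (Complex (2 * (1 / u)) \<tau>)" for \<tau>
    unfolding fourier_def hf using u0
    by (subst Bochner_Integration.integral_diff) (auto intro!: f_int simp: f_val)
  have eta: "eta_fun G (1 / u) T = (LINT \<tau>:{-T..T}|lborel. norm (fourier (\<lambda>t. of_real (h t)) \<tau>))"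
  proof -
    have "set_integrable lborel {-T..T} (\<lambda>\<tau>. norm (fourier (\<lambda>t. of_real (h t)) \<tau>))"
      using h_int by (intro set_integrable_fourier) simp
    from set_borel_integral_eq_integral(2)[OF this] show ?thesis
      unfolding eta_fun_def four by (simp add: norm_minus_commute)
  qed
  define U where "U = u powr P"
  have U: "U \<ge> 1" unfolding U_def using u P by (intro ge_one_powr_ge_zero) auto
  define Cp where "Cp = (\<Sum>i\<in>I. K * (2 * norm (c i)) * (1 + P powr P))"
  define Cq where "Cq = (\<Sum>i\<in>I. K * (2 * (2 * 2 powr P * (\<bar>Re (c i)\<bar> + \<bar>Im (c i)\<bar>) * (5 + 2 * P + \<bar>\<beta> i\<bar>))))"
  have Cp0: "Cp \<ge> 0" unfolding Cp_def using K(1) by (intro sum_nonneg mult_nonneg_nonneg) auto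
  have Cq0: "Cq \<ge> 0" unfolding Cq_def using K(1) P by (intro sum_nonneg mult_nonneg_nonneg) auto
  have bound3: "\<bar>g * r * l\<bar> \<le> K * R * M"
    if "0 < g" "g \<le> K" "\<bar>r\<bar> \<le> R" "0 \<le> l" "l \<le> M" for g r l R M :: real
    unfolding abs_mult using that by (intro mult_mono mult_nonneg_nonneg) auto
  have pw: "\<bar>p t * laplace_weight u t\<bar> \<le> Cp * U" if t: "t \<ge> 0" for t
  proof -
    have "\<bar>p t * laplace_weight u t\<bar> = \<bar>\<Sum>i\<in>I. (1 / Gamma (\<omega> i + 1)) * (2 * Re (c i * exp (- (\<i> * of_real (\<beta> i * t))))) * (laplace_weight u t * t powr \<omega> i)\<bar>"
      unfolding p_def main_term_def sum_distrib_right
      by (intro arg_cong[where f = abs] sum.cong) (simp_all add: mult_ac)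
    also have "\<dots> \<le> (\<Sum>i\<in>I. \<bar>(1 / Gamma (\<omega> i + 1)) * (2 * Re (c i * exp (- (\<i> * of_real (\<beta> i * t))))) * (laplace_weight u t * t powr \<omega> i)\<bar>)"
      by (rule sum_abs)
    also have "\<dots> \<le> (\<Sum>i\<in>I. K * (2 * norm (c i)) * ((1 + P powr P) * U))"
    proof (rule sum_mono)
      fix i assume i: "i \<in> I"
      have "\<bar>Re (c i * exp (- (\<i> * of_real (\<beta> i * t))))\<bar> \<le> norm (c i * exp (- (\<i> * of_real (\<beta> i * t))))"
        by (rule abs_Re_le_cmod)
      then have r: "\<bar>2 * Re (c i * exp (- (\<i> * of_real (\<beta> i * t))))\<bar> \<le> 2 * norm (c i)"
        by (simp add: norm_mult)
      have l: "laplace_weight u t * t powr \<omega> i \<le> (1 + P powr P) * U"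
        unfolding U_def by (rule laplace_weight_powr_le[OF u t \<omega>(1)[OF i] \<omega>(2)[OF i] P])
      have l0: "0 \<le> laplace_weight u t * t powr \<omega> i" using laplace_weight_nonneg[OF u0 t] by simp
      show "\<bar>(1 / Gamma (\<omega> i + 1)) * (2 * Re (c i * exp (- (\<i> * of_real (\<beta> i * t))))) * (laplace_weight u t * t powr \<omega> i)\<bar>
         \<le> K * (2 * norm (c i)) * ((1 + P powr P) * U)"
        by (rule bound3[OF _ _ r l0 l]) (use K(2)[OF i] in blast)+
    qed
    also have "\<dots> = Cp * U" unfolding Cp_def sum_distrib_right by (simp add: mult_ac)
    finally show ?thesis .
  qed
  have plip: "\<bar>p t * laplace_weight u t - p y * laplace_weight u y\<bar> \<le> Cq * U * (t - y)"
    if y: "u / 2 \<le> y" "y \<le> t" "t \<le> 3 * u / 2" for y t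
  proof -
    define g where "g i t = laplace_weight u t * t powr \<omega> i * (Re (c i) * cos (\<beta> i * t) + Im (c i) * sin (\<beta> i * t))" for i t
    have re: "Re (c i * exp (- (\<i> * of_real (\<beta> i * t)))) = Re (c i) * cos (\<beta> i * t) + Im (c i) * sin (\<beta> i * t)" for i t
    proof -
      have "exp (- (\<i> * of_real (\<beta> i * t))) = cis (- (\<beta> i * t))" by (simp add: cis_conv_exp)
      then show ?thesis by simp
    qed
    have pe: "p t * laplace_weight u t = (\<Sum>i\<in>I. (1 / Gamma (\<omega> i + 1)) * (2 * g i t))" for t
      unfolding p_def main_term_def re g_def sum_distrib_right
      by (intro sum.cong) (simp_all add: algebra_simps add_divide_distrib)
    have "\<bar>p t * laplace_weight u t - p y * laplace_weight u y\<bar> = \<bar>\<Sum>i\<in>I. (1 / Gamma (\<omega> i + 1)) * (2 * (g i t - g i y))\<bar>"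
      unfolding pe sum_subtractf[symmetric] by (simp add: right_diff_distrib diff_divide_distrib)
    also have "\<dots> \<le> (\<Sum>i\<in>I. \<bar>(1 / Gamma (\<omega> i + 1)) * (2 * (g i t - g i y))\<bar>)" by (rule sum_abs)
    also have "\<dots> \<le> (\<Sum>i\<in>I. K * (2 * (2 * 2 powr P * u powr P * (\<bar>Re (c i)\<bar> + \<bar>Im (c i)\<bar>) * (5 + 2 * P + \<bar>\<beta> i\<bar>) * (t - y))))"
    proof (rule sum_mono)
      fix i assume i: "i \<in> I"
      have l: "\<bar>g i t - g i y\<bar> \<le> 2 * 2 powr P * u powr P * (\<bar>Re (c i)\<bar> + \<bar>Im (c i)\<bar>) * (5 + 2 * P + \<bar>\<beta> i\<bar>) * (t - y)"
        unfolding g_def by (rule weighted_term_lipschitz[OF u y \<omega>(1)[OF i] \<omega>(2)[OF i] P])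
      show "\<bar>(1 / Gamma (\<omega> i + 1)) * (2 * (g i t - g i y))\<bar>
        \<le> K * (2 * (2 * 2 powr P * u powr P * (\<bar>Re (c i)\<bar> + \<bar>Im (c i)\<bar>) * (5 + 2 * P + \<bar>\<beta> i\<bar>) * (t - y)))"
        unfolding abs_mult[of "1 / _"] abs_mult[of 2]
        using K(2)[OF i] l K(1) by (intro mult_mono) auto
    qed
    also have "\<dots> = Cq * U * (t - y)" unfolding Cq_def U_def sum_distrib_right by (simp add: mult_ac)
    finally show ?thesis .
  qed
  have "\<bar>a u - p u\<bar> \<le> 10 ^ 7 * (1 + B1 + B2 + Cp + Cq)
     * (\<phi> (exp (u / 2)) + (exp (10 / T) / T + 1) * eta_fun G (1 / u) T + exp (10 / T) / T * U)"
  proof (rule tauberian_core[where \<psi> = "\<lambda>y. \<phi> (exp y)", OF u T Tu U B Cp0 Cq0 h_int[unfolded h_def[abs_def]] eta[unfolded h_def[abs_def]] _ _ _ _ _ pw plip])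
    show "- (B1 + B2) \<le> a t" if "t \<ge> 0" for t
    proof -
      have "exp (- t) * (- (B1 + B2) * exp t) \<le> exp (- t) * A (exp t)"
        using A_lower[of "exp t"] that by (intro mult_left_mono) auto
      also have "exp (- t) * (- (B1 + B2) * exp t) = - (B1 + B2) * (exp (- t) * exp t)" by (simp only: mult_ac)
      also have "exp (- t) * exp t = 1" by (simp flip: exp_add)
      finally show ?thesis by (simp add: a_def)
    qed
    show "exp (y - t) * a y - B1 * (1 - exp (y - t)) - B2 * \<phi> (exp y) \<le> a t" if "0 \<le> y" "y \<le> t" for y t
    proof -
      have "A (exp y + (exp t - exp y)) - A (exp y) \<ge> - B1 * (exp t - exp y) - B2 * max 1 (exp y) * \<phi> (exp y)"
        using that by (intro dec) auto
      then have "A (exp t) \<ge> A (exp y) - B1 * (exp t - exp y) - B2 * exp y * \<phi> (exp y)"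
        using that by (simp add: max_def)
      then have "exp (- t) * (A (exp y) - B1 * (exp t - exp y) - B2 * exp y * \<phi> (exp y)) \<le> a t"
        unfolding a_def by (intro mult_left_mono) auto
      moreover have "exp (- t) * (A (exp y) - B1 * (exp t - exp y) - B2 * exp y * \<phi> (exp y))
         = exp (y - t) * a y - B1 * (1 - exp (y - t)) - exp (y - t) * (B2 * \<phi> (exp y))"
        by (simp add: a_def exp_diff exp_minus field_simps)
      moreover have "exp (y - t) * (B2 * \<phi> (exp y)) \<le> 1 * (B2 * \<phi> (exp y))"
        using that B moderately_decreasing_nonneg[OF md, of "exp y"] by (intro mult_right_mono) auto
      ultimately show ?thesis by linarith
    qed
    show "\<phi> (exp y) \<le> 1" if "0 \<le> y" for y
      using anti[of 1 "exp y"] \<phi>1[of 1] that by simp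
    \<comment> \<open>For u = log x the point e^(u/2) is the square root of x, the argument of phi
      in \<open>rho_fun\<close>: the Tauberian windows look back no further than u/2.\<close>
    show "\<phi> (exp y) \<le> \<phi> (exp (u / 2))" if "u / 2 \<le> y" for y
      using that by (intro anti) auto
    show "0 \<le> \<phi> (exp (u / 2))" by (rule moderately_decreasing_nonneg[OF md]) simp
  qed
  then show ?thesis by (simp add: a_def p_def G_def Cp_def Cq_def U_def)
qed

section \<open>Effective Wiener--Ikehara theorem\<close>

theorem theorem6p3:
  fixes n :: nat and m :: "nat \<Rightarrow> nat" and c :: "nat \<Rightarrow> nat \<Rightarrow> complex" and b :: "nat \<Rightarrow> real"
    and B1 B2 \<Omega> S :: real
  assumes "n \<ge> 1" and "\<And>k. k \<le> n \<Longrightarrow> m k \<ge> 1"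
    and "b 0 = 0" and "\<And>k. 1 \<le> k \<Longrightarrow> k \<le> n \<Longrightarrow> b k > 0"
  shows "\<exists>C::real. \<forall>(A :: real \<Rightarrow> real) (\<phi> :: real \<Rightarrow> real) (\<omega> :: nat \<Rightarrow> nat \<Rightarrow> real).
     locally_bounded_variation A \<and> (\<forall>x<1. A x = 0) \<and>
     (\<forall>s. Re s > 1 \<longrightarrow> mellin_stieltjes_converges A s) \<and>
     (\<forall>k\<in>{0..n}. \<forall>l\<in>{1..m k}. \<omega> k l > -1) \<and>
     moderately_decreasing 0 A B1 B2 \<phi> \<and>
     Max {\<omega> k l | k l. k \<in> {0..n} \<and> l \<in> {1..m k}} = \<Omega> \<and>
     (SUP x\<in>{1..exp 1}. max (- A x) 0) = S \<longrightarrow>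
     (\<forall>T>0. \<forall>x\<ge>max (exp (16 / 15)) (exp (32 / T)).
        \<bar>A x - x * (\<Sum>k=0..n. \<Sum>l=1..m k. ln x powr \<omega> k l / Gamma (\<omega> k l + 1) *
                     (2 * Re (c k l * exp (- (\<i> * of_real (b k * ln x))))))\<bar>
        \<le> C * (x * rho_fun (G_fun A n m c b \<omega>) \<phi>
                     (Min {\<omega> k l | k l. k \<in> {0..n} \<and> l \<in> {1..m k}}) \<Omega> T x))"
proof -
  define I where "I = (SIGMA k:{0..n}. {1..m k})"
  define c' where "c' i = c (fst i) (snd i)" for i
  define b' where "b' i = b (fst i)" for i :: "nat \<times> nat"
  \<comment> \<open>Everything that enters \<open>C\<close> must be fixed before A, phi and omega.
    The exponents are represented by Omega alone, through \<open>P\<close> and the uniform bound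
    \<open>K\<close>.\<close>
  define P where "P = max \<Omega> 0"
  obtain K where K: "K \<ge> 0" "\<And>w. -1 < w \<Longrightarrow> w \<le> \<Omega> \<Longrightarrow> 0 < 1 / Gamma (w + 1) \<and> 1 / Gamma (w + 1) \<le> K"
    by (rule inverse_Gamma_bounded) blast
  define C where "C = 10 ^ 7 *
      (1 + B1 + B2 + (\<Sum>i\<in>I. K * (2 * norm (c' i)) * (1 + P powr P))
        + (\<Sum>i\<in>I. K * (2 * (2 * 2 powr P * (\<bar>Re (c' i)\<bar> + \<bar>Im (c' i)\<bar>) * (5 + 2 * P + \<bar>b' i\<bar>)))))"
  have finI: "finite I" by (auto simp: I_def)
  have P0: "P \<ge> 0" by (simp add: P_def)
  show ?thesis
  proof (intro exI[of _ C] allI impI)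
    fix A \<phi> :: "real \<Rightarrow> real" and \<omega> :: "nat \<Rightarrow> nat \<Rightarrow> real" and T x :: real
    assume asm: "locally_bounded_variation A \<and> (\<forall>x<1. A x = 0) \<and>
     (\<forall>s. Re s > 1 \<longrightarrow> mellin_stieltjes_converges A s) \<and>
     (\<forall>k\<in>{0..n}. \<forall>l\<in>{1..m k}. \<omega> k l > -1) \<and>
     moderately_decreasing 0 A B1 B2 \<phi> \<and>
     Max {\<omega> k l | k l. k \<in> {0..n} \<and> l \<in> {1..m k}} = \<Omega> \<and>
     (SUP x\<in>{1..exp 1}. max (- A x) 0) = S"
      and T: "T > 0" and x: "x \<ge> max (exp (16 / 15)) (exp (32 / T))"
    define \<omega>' where "\<omega>' i = \<omega> (fst i) (snd i)" for i
    define u where "u = ln x"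
    have md: "moderately_decreasing 0 A B1 B2 \<phi>" using asm by blast
    have x0: "x > 0" using x by (meson exp_gt_zero less_le_trans max.boundedE)
    then have xu: "x = exp u" by (simp add: u_def)
    have u: "u \<ge> 16 / 15" "u \<ge> 32 / T" using x unfolding xu by auto
    then have u1: "u \<ge> 1" and Tu: "T * u \<ge> 32" using T by (simp_all add: field_simps)
    have set_eq: "{\<omega> k l | k l. k \<in> {0..n} \<and> l \<in> {1..m k}} = \<omega>' ` I"
      by (force simp: I_def \<omega>'_def)
    have \<omega>1: "-1 < \<omega>' i" if "i \<in> I" for i using asm that by (auto simp: I_def \<omega>'_def)
    have \<omega>2: "\<omega>' i \<le> \<Omega>" if "i \<in> I" for i
    proof -
      have "\<omega>' i \<le> Max (\<omega>' ` I)" using finI that by (intro Max_ge) auto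
      then show ?thesis using asm unfolding set_eq by simp
    qed
    have \<omega>P: "\<omega>' i \<le> P" if "i \<in> I" for i using \<omega>2[OF that] by (simp add: P_def)
    have main: "main_term I c' b' \<omega>' u = (\<Sum>k=0..n. \<Sum>l=1..m k. ln x powr \<omega> k l / Gamma (\<omega> k l + 1) *
                     (2 * Re (c k l * exp (- (\<i> * of_real (b k * ln x))))))"
      unfolding main_term_def I_def u_def c'_def b'_def \<omega>'_def
      by (subst sum.Sigma) (auto simp: case_prod_beta)
    have rem: "transform_remainder A I c' b' \<omega>' = G_fun A n m c b \<omega>"
      unfolding transform_remainder_def G_fun_def I_def c'_def b'_def \<omega>'_def
      by (rule ext, subst sum.Sigma) (auto simp: case_prod_beta)
    define G where "G = G_fun A n m c b \<omega>"
    define Z where "Z = (exp (10 / T) / T + 1) * eta_fun G (1 / u) T + exp (10 / T) / T * u powr P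
      + 1 / u * (1 / T powr (\<Omega> + 1) + 1 / T powr (Min (\<omega>' ` I) + 1))"
    have bound: "\<bar>exp (- u) * A (exp u) - main_term I c' b' \<omega>' u\<bar>
      \<le> C * (\<phi> (exp (u / 2)) + (exp (10 / T) / T + 1) * eta_fun G (1 / u) T + exp (10 / T) / T * u powr P)"
      unfolding C_def G_def rem[symmetric]
      by (rule wiener_ikehara_remainder[OF _ _ _ md finI \<omega>1 \<omega>P P0 K(1) K(2) T u1 Tu]) (use asm \<omega>1 \<omega>2 in auto)
    have C0: "C \<ge> 0"
    proof -
      have "B1 > 0" "B2 > 0" using md by (auto simp: moderately_decreasing_def)
      then show ?thesis unfolding C_def using K(1) P0 by (intro mult_nonneg_nonneg add_nonneg_nonneg sum_nonneg) auto
    qed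
    have sqrt_x: "sqrt x = exp (u / 2)"
      unfolding xu by (rule real_sqrt_unique) (simp_all flip: exp_double)
    have \<phi>: "0 \<le> \<phi> (exp (u / 2))" "\<phi> (exp (u / 2)) \<le> 1"
    proof -
      show "0 \<le> \<phi> (exp (u / 2))" by (rule moderately_decreasing_nonneg[OF md]) simp
      have an: "antimono_on {0..} \<phi>" "\<forall>y\<in>{0..max 1 0}. \<phi> y = 1"
        using md unfolding moderately_decreasing_def by blast+
      have "\<phi> (exp (u / 2)) \<le> \<phi> 1" using monotone_onD[OF an(1), of 1 "exp (u / 2)"] u1 by simp
      moreover have "\<phi> 1 = 1" using an(2) by simp
      ultimately show "\<phi> (exp (u / 2)) \<le> 1" by simp
    qed
    have \<phi>_sqrt: "\<phi> (exp (u / 2)) \<le> sqrt (\<phi> (sqrt x))"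
      unfolding sqrt_x using \<phi> by (intro real_le_rsqrt) (simp add: power2_eq_square mult_left_le)
    \<comment> \<open>The case split is on integrability: the integral of a function that is not
      integrable is 0 by convention, so nonnegativity holds either way.\<close>
    have "eta_fun G (1 / u) T \<ge> 0" unfolding eta_fun_def by (cases "(\<lambda>\<tau>. cmod (G (Complex (2 * (1 / u)) \<tau>) - G (Complex (1 / u) \<tau>))) integrable_on {-T..T}")
       (auto intro: Henstock_Kurzweil_Integration.integral_nonneg simp: not_integrable_integral)
    then have Z0: "Z \<ge> 0" unfolding Z_def using T u1 by (intro add_nonneg_nonneg mult_nonneg_nonneg) auto
    have rho: "\<phi> (exp (u / 2)) + Z \<le> rho_fun G \<phi> (Min (\<omega>' ` I)) \<Omega> T x"
    proof -
      have "Z \<le> Z powr 1" using Z0 by simp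
      also have "\<dots> \<le> Max ((\<lambda>\<kappa>. Z powr \<kappa>) ` {1/2, 1})" by (intro Max_ge) auto
      finally show ?thesis using \<phi>_sqrt unfolding rho_fun_def Z_def u_def P_def by linarith
    qed
    have "(exp (10 / T) / T + 1) * eta_fun G (1 / u) T + exp (10 / T) / T * u powr P \<le> Z"
      unfolding Z_def using u1 by simp
    then have "\<phi> (exp (u / 2)) + (exp (10 / T) / T + 1) * eta_fun G (1 / u) T + exp (10 / T) / T * u powr P
       \<le> rho_fun G \<phi> (Min (\<omega>' ` I)) \<Omega> T x" using rho by linarith
    from order_trans[OF bound mult_left_mono[OF this C0]]
    have "\<bar>exp (- u) * A (exp u) - main_term I c' b' \<omega>' u\<bar> \<le> C * rho_fun G \<phi> (Min (\<omega>' ` I)) \<Omega> T x" .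
    then have "x * \<bar>exp (- u) * A (exp u) - main_term I c' b' \<omega>' u\<bar> \<le> x * (C * rho_fun G \<phi> (Min (\<omega>' ` I)) \<Omega> T x)"
      using x0 by (intro mult_left_mono) auto
    moreover have "x * \<bar>exp (- u) * A (exp u) - main_term I c' b' \<omega>' u\<bar> = \<bar>A x - x * main_term I c' b' \<omega>' u\<bar>"
    proof -
      have "x * \<bar>exp (- u) * A (exp u) - main_term I c' b' \<omega>' u\<bar> = \<bar>x * (exp (- u) * A (exp u) - main_term I c' b' \<omega>' u)\<bar>"
        using x0 by (simp add: abs_mult)
      also have "x * (exp (- u) * A (exp u) - main_term I c' b' \<omega>' u) = A x - x * main_term I c' b' \<omega>' u"
        unfolding xu by (simp add: right_diff_distrib flip: exp_add mult.assoc)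
      finally show ?thesis .
    qed
    ultimately show "\<bar>A x - x * (\<Sum>k=0..n. \<Sum>l=1..m k. ln x powr \<omega> k l / Gamma (\<omega> k l + 1) *
                     (2 * Re (c k l * exp (- (\<i> * of_real (b k * ln x))))))\<bar>
        \<le> C * (x * rho_fun (G_fun A n m c b \<omega>) \<phi>
                     (Min {\<omega> k l | k l. k \<in> {0..n} \<and> l \<in> {1..m k}}) \<Omega> T x)"
      unfolding set_eq main[symmetric] G_def by (simp add: mult_ac)
  qed
qed

end
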